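(* Let $\rho>0$ and let $h:[0,1]\to[0,\infty)$ be a continuous function with $h(0)=1$, $h(1)=0$. Suppose that the curvature of the smoothened boundary component decreases (in absolute value) monotonically to zero, i.e. $h$ is non-increasing with $h(\zeta)<h(0)$ for all $\zeta>0$, and that the arc length $s_\alpha=\rho\alpha/\int_0^1h(\xi)\,d\xi$ of the smoothened segment is less than twice the arc length $\rho\alpha$ of the circular segment it replaces, i.e. $\int_0^1 h(\xi)\,d\xi>\tfrac12$. Suppose further that $h$ satisfies the non-degeneracy condition (C): there exists an integer $n_*\ge 0$ such that $\frac{2n_*+1}{2n_*+2}<\int_0^1 h(\xi)\,d\xi$ and, for all $\zeta\in[0,1]$ with $\frac{2n_*+1}{2n_*+2}\,(1-\zeta)=\int_\zeta^1 h(\xi)\,d\xi$, one has $h(\zeta)\neq\frac{2n_*+\frac32}{2n_*+2}$. Then for all sufficiently small values of $\alpha>0$ there exists $L_{h,\alpha}>0$ such that for any separation distance $L$ with $0\le L<L_{h,\alpha}$ the resulting $C^2$-stadium has an elliptic periodic orbit.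
   Context: Construction of the $C^2$-stadium. Given $\rho>0$, $\alpha\in(0,\pi/2)$ and $h$, put $\Theta(\zeta)=\int_\zeta^1h(\xi)d\xi\big/\int_0^1h(\xi)d\xi$ and, for $0\le\zeta\le1$, let $\Gamma^\alpha(\zeta)=(\Gamma^\alpha_x(\zeta),\Gamma^\alpha_y(\zeta))$ with $$\tfrac1\rho\Gamma^\alpha_x(\zeta)=\alpha\,\frac{\int_\zeta^1\cos[\alpha\Theta(\xi)]d\xi}{\int_0^1h(\xi)d\xi},\qquad \tfrac1\rho\Gamma^\alpha_y(\zeta)=\cos\alpha+\alpha\,\frac{\int_0^\zeta\sin[\alpha\Theta(\xi)]d\xi}{\int_0^1h(\xi)d\xi}.$$ Let $c_\alpha=\Gamma^\alpha_x(0)-\rho\sin\alpha$. The curved boundary component $\Gamma$ is the union of the circular arc $\{(c_\alpha+\rho\cos\psi,\rho\sin\psi):|\psi|\le\frac\pi2-\alpha\}$, the smoothened segment $\{\Gamma^\alpha(\zeta):0\le\zeta\le1\}$ and the mirror image of the latter in the $x$-axis. The smoothened segment has arc length $s_\alpha=\rho\alpha/\int_0^1h$, it replaces a circular segment of angle $\alpha$, and at arc length $s$ from its junction with the circular arc its curvature is $-\frac1\rho h(s/s_\alpha)$ (negative sign = focusing); the endpoints $\Gamma^\alpha(1)$ and its mirror image lie on $\{x=0\}$, where the tangent is horizontal and the curvature vanishes. For $L\ge 0$ the $C^2$-stadium with separation distance $L$ is the convex billiard table bounded by $\Gamma$, the mirror image of $\Gamma$ in the line $x=-L/2$, and the two horizontal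 segments of length $L$ joining their endpoints. A periodic orbit of the billiard is elliptic (linearly stable) if its monodromy matrix $M$ (the $2\times2$ area-preserving linearization of the dynamics over one period, transversal to the orbit) satisfies $|\frac12\operatorname{tr}M|<1$. *)

theory Defs
  imports "HOL-Analysis.Analysis"
begin

section \<open>Billiards inside a closed plane curve\<close>

definition arc_length_param :: "(real \<Rightarrow> real \<times> real) \<Rightarrow> real \<Rightarrow> (real \<times> real) set \<Rightarrow> bool" where
  "arc_length_param \<gamma> l B \<longleftrightarrow>
     l > 0 \<and> \<gamma> C1_differentiable_on UNIV \<and>
     (\<forall>s. norm (vector_derivative \<gamma> (at s)) = 1) \<and>
     (\<forall>s. \<gamma> (s + l) = \<gamma> s) \<and> inj_on \<gamma> {0..<l} \<and> range \<gamma> = B"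

text \<open>
  Phase points are written in Birkhoff coordinates: \<open>x $ 1\<close> is the arc length parameter of a
  collision point (not reduced modulo the perimeter) and \<open>x $ 2\<close> is the tangential component of the
  unit velocity immediately after that collision. The billiard map preserves area in these
  coordinates.

  In \<open>bounce\<close>, \<open>e\<close> is the velocity on the chord between two successive collisions. The reflection
  law says that the tangential component of the velocity is the same before and after a collision,
  so the second coordinate of \<open>y\<close> can be read off from the incoming velocity \<open>e\<close>. The chord
  condition selects the inward pointing velocity at \<open>x\<close> and the first hit of the boundary.
\<close>

definition bounce :: "(real \<Rightarrow> real \<times> real) \<Rightarrow> real ^ 2 \<Rightarrow> real ^ 2 \<Rightarrow> bool" where
  "bounce \<gamma> x y \<longleftrightarrow>
     (let q = \<gamma> (x $ 1); q' = \<gamma> (y $ 1); e = sgn (q' - q) in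
       q \<noteq> q' \<and> open_segment q q' \<subseteq> inside (range \<gamma>) \<and>
       x $ 2 = e \<bullet> vector_derivative \<gamma> (at (x $ 1)) \<and>
       y $ 2 = e \<bullet> vector_derivative \<gamma> (at (y $ 1)))"

definition same_state :: "(real \<Rightarrow> real \<times> real) \<Rightarrow> real ^ 2 \<Rightarrow> real ^ 2 \<Rightarrow> bool" where
  "same_state \<gamma> x y \<longleftrightarrow> \<gamma> (x $ 1) = \<gamma> (y $ 1) \<and> x $ 2 = y $ 2"

definition returns :: "(real \<Rightarrow> real \<times> real) \<Rightarrow> nat \<Rightarrow> real ^ 2 \<Rightarrow> bool" where
  "returns \<gamma> n x \<longleftrightarrow> (\<exists>y. (bounce \<gamma> ^^ n) x y \<and> same_state \<gamma> x y)"

definition periodic_point :: "(real \<Rightarrow> real \<times> real) \<Rightarrow> nat \<Rightarrow> real ^ 2 \<Rightarrow> bool" where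
  "periodic_point \<gamma> n x \<longleftrightarrow>
     n > 0 \<and> returns \<gamma> n x \<and> (\<forall>m. 0 < m \<and> m < n \<longrightarrow> \<not> returns \<gamma> m x)"

text \<open>
  The map \<open>F\<close> is a branch of the \<open>n\<close>-th iterate of the billiard map near \<open>x\<close>. Branches differ only
  in the multiple of the perimeter added to the first coordinate, and being continuous at \<open>x\<close> fixes
  this multiple near \<open>x\<close> up to a constant, so \<open>M\<close> does not depend on \<open>F\<close>.
\<close>

definition monodromy_matrix ::
    "(real \<Rightarrow> real \<times> real) \<Rightarrow> nat \<Rightarrow> real ^ 2 \<Rightarrow> real ^ 2 ^ 2 \<Rightarrow> bool" where
  "monodromy_matrix \<gamma> n x M \<longleftrightarrow>
     (\<exists>F. same_state \<gamma> x (F x) \<and>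
          (\<forall>\<^sub>F z in nhds x. (bounce \<gamma> ^^ n) z (F z)) \<and>
          (F has_derivative (\<lambda>v. M *v v)) (at x))"

definition has_elliptic_periodic_orbit :: "(real \<times> real) set \<Rightarrow> bool" where
  "has_elliptic_periodic_orbit B \<longleftrightarrow>
     (\<exists>\<gamma> l n x M. arc_length_param \<gamma> l B \<and> periodic_point \<gamma> n x \<and>
        monodromy_matrix \<gamma> n x M \<and> \<bar>trace M / 2\<bar> < 1)"


section \<open>The stadium\<close>

definition Theta :: "(real \<Rightarrow> real) \<Rightarrow> real \<Rightarrow> real" where
  "Theta h \<zeta> = integral {\<zeta>..1} h / integral {0..1} h"

definition Gamma_x :: "real \<Rightarrow> (real \<Rightarrow> real) \<Rightarrow> real \<Rightarrow> real \<Rightarrow> real" where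
  "Gamma_x \<rho> h \<alpha> \<zeta> =
     \<rho> * (\<alpha> * (integral {\<zeta>..1} (\<lambda>\<xi>. cos (\<alpha> * Theta h \<xi>)) / integral {0..1} h))"

definition Gamma_y :: "real \<Rightarrow> (real \<Rightarrow> real) \<Rightarrow> real \<Rightarrow> real \<Rightarrow> real" where
  "Gamma_y \<rho> h \<alpha> \<zeta> =
     \<rho> * (cos \<alpha> + \<alpha> * (integral {0..\<zeta>} (\<lambda>\<xi>. sin (\<alpha> * Theta h \<xi>)) / integral {0..1} h))"

definition arc_centre :: "real \<Rightarrow> (real \<Rightarrow> real) \<Rightarrow> real \<Rightarrow> real" where
  "arc_centre \<rho> h \<alpha> = Gamma_x \<rho> h \<alpha> 0 - \<rho> * sin \<alpha>"

definition circular_arc :: "real \<Rightarrow> (real \<Rightarrow> real) \<Rightarrow> real \<Rightarrow> (real \<times> real) set" where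
  "circular_arc \<rho> h \<alpha> =
     {(arc_centre \<rho> h \<alpha> + \<rho> * cos \<psi>, \<rho> * sin \<psi>) | \<psi>. \<bar>\<psi>\<bar> \<le> pi / 2 - \<alpha>}"

definition smoothened_segment :: "real \<Rightarrow> (real \<Rightarrow> real) \<Rightarrow> real \<Rightarrow> (real \<times> real) set" where
  "smoothened_segment \<rho> h \<alpha> = (\<lambda>\<zeta>. (Gamma_x \<rho> h \<alpha> \<zeta>, Gamma_y \<rho> h \<alpha> \<zeta>)) ` {0..1}"

definition curved_component :: "real \<Rightarrow> (real \<Rightarrow> real) \<Rightarrow> real \<Rightarrow> (real \<times> real) set" where
  "curved_component \<rho> h \<alpha> =
     circular_arc \<rho> h \<alpha> \<union> smoothened_segment \<rho> h \<alpha> \<union>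
     (\<lambda>(x, y). (x, - y)) ` smoothened_segment \<rho> h \<alpha>"

text \<open>The map \<open>(x, y) \<mapsto> (- L - x, y)\<close> is the reflection in the line \<open>x = - L / 2\<close>.\<close>

definition stadium_boundary :: "real \<Rightarrow> (real \<Rightarrow> real) \<Rightarrow> real \<Rightarrow> real \<Rightarrow> (real \<times> real) set" where
  "stadium_boundary \<rho> h \<alpha> L =
     curved_component \<rho> h \<alpha> \<union> (\<lambda>(x, y). (- L - x, y)) ` curved_component \<rho> h \<alpha> \<union>
     closed_segment (- L, Gamma_y \<rho> h \<alpha> 1) (0, Gamma_y \<rho> h \<alpha> 1) \<union>
     closed_segment (- L, - Gamma_y \<rho> h \<alpha> 1) (0, - Gamma_y \<rho> h \<alpha> 1)"

definition nondegenerate :: "(real \<Rightarrow> real) \<Rightarrow> bool" where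
  "nondegenerate h \<longleftrightarrow>
     (\<exists>n::nat.
        (2 * real n + 1) / (2 * real n + 2) < integral {0..1} h \<and>
        (\<forall>\<zeta>\<in>{0..1}.
           (2 * real n + 1) / (2 * real n + 2) * (1 - \<zeta>) = integral {\<zeta>..1} h \<longrightarrow>
           h \<zeta> \<noteq> (2 * real n + 3 / 2) / (2 * real n + 2)))"

end

theory Submission
  imports Defs
begin

text \<open>Put \<open>m = 2 n + 2\<close>. The elliptic orbit is symmetric in the \<open>x\<close>-axis and has period \<open>2 m\<close>: from
  \<open>\<Gamma>(\<zeta>)\<close> it makes \<open>m\<close> chords along one circle, with \<open>m - 1\<close> bounces on the arc, to the mirror image of
  \<open>\<Gamma>(\<zeta>)\<close>, and returns by \<open>m\<close> chords along the other circle. On each side the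
  chords are determined by \<open>\<zeta>\<close>, and the reflection law at \<open>\<Gamma>(\<zeta>)\<close> is one equation for \<open>\<zeta>\<close>.
  Divided by \<open>\<alpha>\<close>, it tends for \<open>\<alpha> \<rightarrow> 0\<close>, \<open>L = o(\<alpha>)\<close> to
  \<open>(m - 1) / m (1 - \<zeta>) = \<integral>\<^sub>\<zeta>\<^sup>1 h\<close>. At a root \<open>\<zeta>\<^sub>0\<close> monotonicity gives \<open>(m - 1) / m < h \<zeta>\<^sub>0 < 1\<close>, so
  the root is transversal and survives for small \<open>\<alpha>\<close>. The matrix of each half of the orbit has
  limiting trace \<open>2 e\<close>, \<open>e = 1 - 2 m (1 - h \<zeta>\<^sub>0) \<in> (-1, 1)\<close>, and the monodromy matrix \<open>4 e\<^sup>2 - 2\<close>; the latter lies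
  in \<open>(-2, 2)\<close> because non-degeneracy says \<open>e \<noteq> 0\<close>.\<close>

text \<open>For \<alpha>, L \<rightarrow> 0 the table becomes the disc of radius \<rho>, the
  smoothened segment shrinks to the point (0, \<rho>) and the orbit becomes an inscribed regular
  polygon with 2 m sides. In this limit the reflection law holds for every \<zeta> and cannot select
  one; only its part of first order in \<alpha> does, which is why L must be negligible against
  \<alpha>. No derivative of the closing condition in \<zeta> is taken at positive \<alpha>: a
  strict sign change of the limit equation and the intermediate value theorem give a root, and
  ellipticity holds for every root near the limit root. In the limit the left half of the orbit is
  the right half rotated by pi, so the monodromy matrix tends to the square of a matrix with
  determinant 1 and trace 2 e. A second obstacle is that the boundary contains segments and points
  of zero curvature. Chords are therefore compared with all tangents to show that they run inside
  the curve, and the boundary is rebuilt from its curvature, so that smoothness at the junctions is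
  automatic.\<close>

lemma monotone_implicit_function:
  fixes F :: "'a::t2_space \<Rightarrow> real \<Rightarrow> real"
  assumes "open U" "x0 \<in> U" "d > 0" "F x0 b0 = 0"
    and contx: "\<And>b. b \<in> {b0-d..b0+d} \<Longrightarrow> continuous_on U (\<lambda>x. F x b)"
    and contb: "\<And>x. x \<in> U \<Longrightarrow> continuous_on {b0-d..b0+d} (F x)"
    and mono: "\<And>x b b'. \<lbrakk>x \<in> U; b0-d \<le> b; b < b'; b' \<le> b0+d\<rbrakk> \<Longrightarrow> F x b < F x b'"
  obtains V B where "open V" "x0 \<in> V" "V \<subseteq> U" "continuous_on V B" "B x0 = b0"
    "\<And>x. x \<in> V \<Longrightarrow> F x (B x) = 0" "\<And>x. x \<in> V \<Longrightarrow> b0-d < B x \<and> B x < b0+d"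
proof -
  \<comment> \<open>On \<open>V\<close> the signs at the two ends of the interval enclose a root.
    Openness uses continuity in \<open>x\<close> for these two values of \<open>b\<close>
    only.\<close>
  define V where "V = {x\<in>U. F x (b0-d) < 0} \<inter> {x\<in>U. 0 < F x (b0+d)}"
  have op: "open {x\<in>U. F x b < 0}" "open {x\<in>U. 0 < F x b}" if "b \<in> {b0-d..b0+d}" for b
    using continuous_open_preimage[OF contx[OF that] \<open>open U\<close>, of "{..<0}"]
          continuous_open_preimage[OF contx[OF that] \<open>open U\<close>, of "{0<..}"]
    by (simp_all add: vimage_def Int_def conj_commute)
  have V: "open V" "x0 \<in> V" "V \<subseteq> U"
    using op[of "b0-d"] op[of "b0+d"] assms mono[of x0 "b0-d" b0] mono[of x0 b0 "b0+d"]
    by (auto simp: V_def)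
  have "\<exists>b. b0-d < b \<and> b < b0+d \<and> F x b = 0" if x: "x \<in> V" for x
  proof -
    have "\<exists>b. b0-d \<le> b \<and> b \<le> b0+d \<and> F x b = 0"
      using x contb[of x] \<open>d > 0\<close> by (intro IVT') (auto simp: V_def)
    then obtain b where "b0-d \<le> b" "b \<le> b0+d" "F x b = 0" by blast
    moreover have "b \<noteq> b0-d" "b \<noteq> b0+d" using x \<open>F x b = 0\<close> by (auto simp: V_def)
    ultimately show ?thesis by (intro exI[of _ b]) auto
  qed
  then obtain B where B: "\<And>x. x \<in> V \<Longrightarrow> b0-d < B x \<and> B x < b0+d \<and> F x (B x) = 0"
    by metis
  have le: "b < b'" if "x \<in> V" "b \<in> {b0-d..b0+d}" "b' \<in> {b0-d..b0+d}" "F x b < F x b'" for x b b'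
    using mono[of x b' b] that V by (cases b b' rule: linorder_cases) fastforce+
  have "isCont B x" if x: "x \<in> V" for x
  proof -
    have "\<forall>\<^sub>F y in at x. \<bar>B y - B x\<bar> < e" if "e > 0" for e
    proof -
      \<comment> \<open>Truncation keeps both test points in the interval where \<open>F\<close> is
        controlled; the signs of \<open>F\<close> there persist near \<open>x\<close> and enclose
        the root.\<close>
      define b1 b2 where "b1 = max (b0-d) (B x - e/2)" and "b2 = min (b0+d) (B x + e/2)"
      have b: "b0-d \<le> b1" "b1 < B x" "B x < b2" "b2 \<le> b0+d" "B x - e < b1" "b2 < B x + e"
        using B[OF x] \<open>e > 0\<close> by (auto simp: b1_def b2_def)
      define W where "W = V \<inter> {y\<in>U. F y b1 < 0} \<inter> {y\<in>U. 0 < F y b2}"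
      have "open W" using op[of b1] op[of b2] V b by (auto simp: W_def)
      moreover have "x \<in> W"
        using mono[of x b1 "B x"] mono[of x "B x" b2] B[OF x] b x V by (auto simp: W_def)
      moreover have "\<bar>B y - B x\<bar> < e" if "y \<in> W" for y
        using that le[of y b1 "B y"] le[of y "B y" b2] B[of y] b by (fastforce simp: W_def)
      ultimately show ?thesis unfolding eventually_at_topological by blast
    qed
    then show ?thesis unfolding isCont_def by (intro tendstoI) (simp add: dist_real_def)
  qed
  then have "continuous_on V B" by (simp add: continuous_at_imp_continuous_on)
  moreover have "B x0 = b0"
    using B[OF V(2)] le[OF V(2), of b0 "B x0"] le[OF V(2), of "B x0" b0] \<open>F x0 b0 = 0\<close> \<open>d > 0\<close>
      mono[of x0 b0 "B x0"] mono[of x0 "B x0" b0] \<open>x0 \<in> U\<close>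
    by (cases b0 "B x0" rule: linorder_cases) auto
  ultimately show thesis using that V B by blast
qed

section \<open>Closed convex curves given by their tangent angle\<close>

text \<open>Total turning exactly 2 pi together with \<open>k\<close> \<ge> 0 makes the curve
  simple, convex and counterclockwise. Zeros of \<open>k\<close> are allowed, since a stadium has
  straight sides.\<close>

locale convex_curve =
  fixes k \<phi> X Y :: "real \<Rightarrow> real" and l :: real
  assumes l_pos: "l > 0"
    and k_cont: "continuous_on UNIV k"
    and k_nonneg: "k s \<ge> 0"
    and \<phi>_deriv: "(\<phi> has_real_derivative k s) (at s)"
    and X_deriv: "(X has_real_derivative cos (\<phi> s)) (at s)"
    and Y_deriv: "(Y has_real_derivative sin (\<phi> s)) (at s)"
    and \<phi>_period: "\<phi> (s + l) = \<phi> s + 2 * pi"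
    and X_period: "X (s + l) = X s"
    and Y_period: "Y (s + l) = Y s"
begin

definition \<gamma> :: "real \<Rightarrow> real \<times> real" where "\<gamma> s = (X s, Y s)"

text \<open>The signed distance of \<open>p\<close> from the tangent at \<open>\<gamma> s\<close>, positive on the inner side.\<close>

definition height :: "real \<Rightarrow> real \<times> real \<Rightarrow> real" where
  "height s p = - sin (\<phi> s) * (fst p - X s) + cos (\<phi> s) * (snd p - Y s)"

lemmas derivs [derivative_intros] =
  DERIV_chain2[OF \<phi>_deriv] DERIV_chain2[OF X_deriv] DERIV_chain2[OF Y_deriv]

lemma \<phi>_mono: "s \<le> t \<Longrightarrow> \<phi> s \<le> \<phi> t"
  using DERIV_nonneg_imp_nondecreasing[of s t \<phi>] \<phi>_deriv k_nonneg by blast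

lemma isCont_curve: "isCont \<phi> s" "isCont X s" "isCont Y s"
  using \<phi>_deriv X_deriv Y_deriv by (auto intro: DERIV_isCont)

lemma continuous_on_curve [continuous_intros]:
  "continuous_on S f \<Longrightarrow> continuous_on S (\<lambda>x. \<phi> (f x))"
  "continuous_on S f \<Longrightarrow> continuous_on S (\<lambda>x. X (f x))"
  "continuous_on S f \<Longrightarrow> continuous_on S (\<lambda>x. Y (f x))"
  by (rule continuous_on_compose2[where t=UNIV];
      simp add: isCont_curve continuous_at_imp_continuous_on)+

lemma \<gamma>_deriv: "(\<gamma> has_vector_derivative (cos (\<phi> s), sin (\<phi> s))) (at s)"
  unfolding \<gamma>_def[abs_def] using X_deriv Y_deriv
  by (intro has_vector_derivative_Pair) (auto simp: has_real_derivative_iff_has_vector_derivative)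

lemma vector_derivative_\<gamma>: "vector_derivative \<gamma> (at s) = (cos (\<phi> s), sin (\<phi> s))"
  by (rule vector_derivative_at[OF \<gamma>_deriv])

lemma period_int:
  "\<phi> (s + of_int n * l) = \<phi> s + of_int n * (2 * pi)"
  "X (s + of_int n * l) = X s" "Y (s + of_int n * l) = Y s"
proof -
  have "\<phi> (s + of_int n * l) = \<phi> s + of_int n * (2 * pi) \<and> X (s + of_int n * l) = X s
      \<and> Y (s + of_int n * l) = Y s"
  proof (induction n rule: int_induct[where k=0])
    case (step1 i)
    then show ?case
      using \<phi>_period[of "s + of_int i * l"] X_period[of "s + of_int i * l"]
        Y_period[of "s + of_int i * l"] by (simp add: algebra_simps)
  next
    case (step2 i)
    then show ?case
      using \<phi>_period[of "s + of_int (i - 1) * l"] X_period[of "s + of_int (i - 1) * l"]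
        Y_period[of "s + of_int (i - 1) * l"] by (simp add: algebra_simps)
  qed simp
  then show "\<phi> (s + of_int n * l) = \<phi> s + of_int n * (2 * pi)"
    "X (s + of_int n * l) = X s" "Y (s + of_int n * l) = Y s" by auto
qed

lemma period_shift:
  obtains n :: int where "s \<le> r + of_int n * l" "r + of_int n * l < s + l"
proof
  define n where "n = \<lceil>(s - r) / l\<rceil>"
  have "(s - r) / l \<le> of_int n" "of_int n < (s - r) / l + 1" unfolding n_def by linarith+
  then show "s \<le> r + of_int n * l" "r + of_int n * l < s + l"
    using l_pos by (simp_all add: field_simps)
qed

lemma cos_sin_period_int:
  "cos (\<phi> (s + of_int n * l)) = cos (\<phi> s)" "sin (\<phi> (s + of_int n * l)) = sin (\<phi> s)"
  unfolding period_int using cos.plus_of_int[where 'a=real] sin.plus_of_int[where 'a=real] by auto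

lemma \<gamma>_period_int: "\<gamma> (s + of_int n * l) = \<gamma> s"
  by (simp add: \<gamma>_def period_int)

lemma height_period_int: "height (s + of_int n * l) p = height s p"
  unfolding height_def by (simp only: cos_sin_period_int period_int(2,3))

lemma height_self [simp]: "height s (\<gamma> s) = 0"
  by (simp add: height_def \<gamma>_def)

section \<open>Position of the curve relative to its tangents\<close>

lemma height_deriv:
  "((\<lambda>r. height s (\<gamma> r)) has_real_derivative sin (\<phi> r - \<phi> s)) (at r)"
  unfolding height_def \<gamma>_def fst_conv snd_conv
  by (auto intro!: derivative_eq_intros simp: sin_diff)

text \<open>The height over the tangent at \<open>a\<close> has derivative sin (\<phi> r - \<phi>
  a), which is nonnegative during the first half turn and positive at some point before
  \<open>b\<close>. This also covers a turn of exactly pi.\<close>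

lemma height_pos_right:
  assumes "a \<le> b" "\<phi> b - \<phi> a \<le> pi" "\<phi> a < \<phi> b"
  shows "height a (\<gamma> b) > 0"
proof -
  \<comment> \<open>An intermediate angle strictly below \<open>\<phi> b\<close>, so that
    \<open>r < b\<close> leaves room for the strict increase after \<open>r\<close>.\<close>
  define t where "t = min ((\<phi> a + \<phi> b) / 2) (\<phi> a + pi / 2)"
  have t: "\<phi> a < t" "t < \<phi> b" "t < \<phi> a + pi" using assms by (auto simp: t_def min_def field_simps)
  obtain r where r: "a \<le> r" "r \<le> b" "\<phi> r = t"
    using IVT'[of \<phi> a t b] t assms isCont_curve(1)
    by (auto simp: continuous_at_imp_continuous_on)
  have "r < b" using r t by (auto simp: le_less)
  have nonneg: "sin (\<phi> x - \<phi> a) \<ge> 0" if "a \<le> x" "x \<le> b" for x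
    using \<phi>_mono[of a x] \<phi>_mono[of x b] that assms by (intro sin_ge_zero) auto
  have mono: "height a (\<gamma> x) \<le> height a (\<gamma> y)" if "a \<le> x" "x \<le> y" "y \<le> b" for x y
    using that nonneg height_deriv
    by (intro DERIV_nonneg_imp_nondecreasing[OF \<open>x \<le> y\<close>]) (meson order_trans)
  have "sin (\<phi> r - \<phi> a) > 0" using t r by (intro sin_gt_zero) auto
  from DERIV_pos_inc_right[OF height_deriv this] obtain d where d: "d > 0"
    "\<And>h. \<lbrakk>0 < h; h < d\<rbrakk> \<Longrightarrow> height a (\<gamma> r) < height a (\<gamma> (r + h))" by auto
  define e where "e = min (d/2) (b - r)"
  have "0 < e" "e < d" "r + e \<le> b" using d \<open>r < b\<close> by (auto simp: e_def)
  have "0 \<le> height a (\<gamma> r)" using mono[of a r] r by simp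
  also have "\<dots> < height a (\<gamma> (r + e))" using d(2) \<open>0 < e\<close> \<open>e < d\<close> by simp
  also have "\<dots> \<le> height a (\<gamma> b)" using mono[of "r+e" b] r \<open>0 < e\<close> \<open>r + e \<le> b\<close> by simp
  finally show ?thesis .
qed

lemma height_pos_left:
  assumes "a \<le> b" "\<phi> b - \<phi> a \<le> pi" "\<phi> a < \<phi> b"
  shows "height b (\<gamma> a) > 0"
proof -
  define t where "t = max ((\<phi> a + \<phi> b) / 2) (\<phi> b - pi / 2)"
  have t: "\<phi> a < t" "t < \<phi> b" "\<phi> b - pi < t" using assms by (auto simp: t_def max_def field_simps)
  obtain r where r: "a \<le> r" "r \<le> b" "\<phi> r = t"
    using IVT'[of \<phi> a t b] t assms isCont_curve(1)
    by (auto simp: continuous_at_imp_continuous_on)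
  have "a < r" using r t by (auto simp: le_less)
  have nonpos: "sin (\<phi> x - \<phi> b) \<le> 0" if "a \<le> x" "x \<le> b" for x
    using \<phi>_mono[of a x] \<phi>_mono[of x b] that assms sin_ge_zero[of "\<phi> b - \<phi> x"] sin_minus[of "\<phi> b - \<phi> x"]
    by simp
  have mono: "height b (\<gamma> x) \<ge> height b (\<gamma> y)" if "a \<le> x" "x \<le> y" "y \<le> b" for x y
    using that nonpos height_deriv
    by (intro DERIV_nonpos_imp_nonincreasing[OF \<open>x \<le> y\<close>]) (meson order_trans)
  have "sin (\<phi> b - \<phi> r) > 0" using t r by (intro sin_gt_zero) auto
  then have "sin (\<phi> r - \<phi> b) < 0" using sin_minus[of "\<phi> b - \<phi> r"] by simp
  from DERIV_neg_dec_left[OF height_deriv this] obtain d where d: "d > 0"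
    "\<And>h. \<lbrakk>0 < h; h < d\<rbrakk> \<Longrightarrow> height b (\<gamma> r) < height b (\<gamma> (r - h))" by auto
  define e where "e = min (d/2) (r - a)"
  have "0 < e" "e < d" "a \<le> r - e" using d \<open>a < r\<close> by (auto simp: e_def)
  have "0 \<le> height b (\<gamma> r)" using mono[of r b] r by simp
  also have "\<dots> < height b (\<gamma> (r - e))" using d(2) \<open>0 < e\<close> \<open>e < d\<close> by simp
  also have "\<dots> \<le> height b (\<gamma> a)" using mono[of a "r-e"] r \<open>0 < e\<close> \<open>a \<le> r - e\<close> by simp
  finally show ?thesis .
qed

lemma flat:
  assumes "a \<le> b" "\<phi> a = \<phi> b"
  shows "X b = X a + (b - a) * cos (\<phi> a)" "Y b = Y a + (b - a) * sin (\<phi> a)"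
proof -
  have c: "\<phi> r = \<phi> a" if "a \<le> r" "r \<le> b" for r
    using \<phi>_mono[of a r] \<phi>_mono[of r b] that assms by simp
  have d: "((\<lambda>r. X r - r * cos (\<phi> a)) has_real_derivative 0) (at r)"
    "((\<lambda>r. Y r - r * sin (\<phi> a)) has_real_derivative 0) (at r)" if "a < r" "r < b" for r
    using c[of r] that by (auto intro!: derivative_eq_intros)
  have co: "continuous_on {a..b} (\<lambda>r. X r - r * cos (\<phi> a))"
    "continuous_on {a..b} (\<lambda>r. Y r - r * sin (\<phi> a))"
    by (intro continuous_intros)+
  have "X b - b * cos (\<phi> a) = X a - a * cos (\<phi> a) \<and> Y b - b * sin (\<phi> a) = Y a - a * sin (\<phi> a)"
    using DERIV_isconst_end[OF _ co(1) d(1)] DERIV_isconst_end[OF _ co(2) d(2)] assms(1)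
    by (cases "a = b") auto
  then show "X b = X a + (b - a) * cos (\<phi> a)" "Y b = Y a + (b - a) * sin (\<phi> a)"
    by (simp_all add: algebra_simps)
qed

text \<open>Up to half a turn after \<open>s\<close> the height is followed forwards from
  \<open>s\<close>, otherwise backwards from \<open>s + l\<close>, whose tangent is the same. The
  two equalities describe straight pieces adjoining the point of tangency.\<close>

lemma height_cases:
  assumes "s \<le> r" "r \<le> s + l"
  shows "height s (\<gamma> r) > 0 \<or> \<phi> r = \<phi> s \<or> \<phi> r = \<phi> (s + l)"
proof (cases "\<phi> r - \<phi> s \<le> pi")
  case True
  then show ?thesis using height_pos_right[of s r] \<phi>_mono[of s r] assms by force
next
  case False
  then have "\<phi> (s + l) - \<phi> r \<le> pi" using \<phi>_period[of s] by simp
  then show ?thesis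
    using height_pos_left[of r "s + l"] \<phi>_mono[of r "s + l"] assms height_period_int[of s 1 "\<gamma> r"]
    by auto
qed

lemma height_flat:
  assumes "a \<le> b" "\<phi> a = \<phi> b"
  shows "height a (\<gamma> b) = 0" "height b (\<gamma> a) = 0"
  unfolding height_def \<gamma>_def fst_conv snd_conv flat[OF assms] assms(2)[symmetric]
  by (simp_all add: algebra_simps)

text \<open>After shifting \<open>r\<close> into the period that starts at \<open>s\<close>, the
  height is positive unless no turning separates the point from \<open>s\<close> or from
  \<open>s + l\<close>. Then the curve is straight in between, the height is zero and the tangents
  coincide.\<close>

lemma height_nonneg: "height s (\<gamma> r) \<ge> 0"
  and tangent_eq_of_height_zero:
    "height s (\<gamma> r) = 0 \<Longrightarrow> cos (\<phi> r) = cos (\<phi> s) \<and> sin (\<phi> r) = sin (\<phi> s)"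
proof -
  obtain n where n: "s \<le> r + of_int n * l" "r + of_int n * l < s + l" by (rule period_shift)
  define r' where "r' = r + of_int n * l"
  have r': "s \<le> r'" "r' \<le> s + l" "\<gamma> r' = \<gamma> r" "cos (\<phi> r') = cos (\<phi> r)" "sin (\<phi> r') = sin (\<phi> r)"
    using n by (auto simp: r'_def cos_sin_period_int \<gamma>_period_int)
  show "height s (\<gamma> r) \<ge> 0"
    using height_cases[OF r'(1,2)] height_flat[of s r'] height_flat[of r' "s + l"] r'
      height_period_int[of s 1 "\<gamma> r"]
    by auto
  show "cos (\<phi> r) = cos (\<phi> s) \<and> sin (\<phi> r) = sin (\<phi> s)" if "height s (\<gamma> r) = 0"
    using height_cases[OF r'(1,2)] that r' cos_sin_period_int[of s 1] by auto
qed

text \<open>A double point would have height zero, hence be joined to \<open>s\<close> or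
  \<open>s + l\<close> by a straight piece, which has distinct ends.\<close>

lemma \<gamma>_neq:
  assumes "s < r" "r < s + l"
  shows "\<gamma> r \<noteq> \<gamma> s"
proof
  assume eq: "\<gamma> r = \<gamma> s"
  have neq: False if "a < b" "\<phi> a = \<phi> b" "\<gamma> a = \<gamma> b" for a b
  proof -
    have "(b - a) * cos (\<phi> a) = 0" "(b - a) * sin (\<phi> a) = 0"
      using flat[of a b] that by (auto simp: \<gamma>_def)
    then show False using that sin_cos_squared_add[of "\<phi> a"] by auto
  qed
  have "\<phi> r = \<phi> s \<or> \<phi> r = \<phi> (s + l)" using height_cases[of s r] assms eq by auto
  then show False
    using neq[of s r] neq[of r "s + l"] assms eq \<gamma>_period_int[of s 1] by auto
qed

lemma \<gamma>_eq_iff: "\<gamma> r = \<gamma> s \<longleftrightarrow> (\<exists>n::int. r = s + of_int n * l)"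
proof
  assume eq: "\<gamma> r = \<gamma> s"
  obtain n where n: "s \<le> r + of_int n * l" "r + of_int n * l < s + l" by (rule period_shift)
  then have "r + of_int n * l = s"
    using \<gamma>_neq[of s "r + of_int n * l"] eq by (force simp: \<gamma>_period_int)
  then show "\<exists>n::int. r = s + of_int n * l" by (intro exI[of _ "-n"]) auto
qed (auto simp: \<gamma>_period_int)

lemma range_\<gamma>: "range \<gamma> = \<gamma> ` {s..s + l}"
proof -
  have "\<gamma> r \<in> \<gamma> ` {s..s + l}" for r
  proof -
    obtain n where n: "s \<le> r + of_int n * l" "r + of_int n * l < s + l" by (rule period_shift)
    then have "\<gamma> (r + of_int n * l) \<in> \<gamma> ` {s..s + l}" by (intro imageI) simp
    then show ?thesis by (simp add: \<gamma>_period_int)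
  qed
  then show ?thesis by auto
qed

lemma arc_length_param_\<gamma>: "arc_length_param \<gamma> l (range \<gamma>)"
  unfolding arc_length_param_def
proof (intro conjI allI)
  show "\<gamma> C1_differentiable_on UNIV"
    unfolding C1_differentiable_on_def
    by (rule exI[of _ "\<lambda>s. (cos (\<phi> s), sin (\<phi> s))"])
       (auto intro!: \<gamma>_deriv continuous_intros)
  show "inj_on \<gamma> {0..<l}"
    by (rule linorder_inj_onI) (use \<gamma>_neq in fastforce)+
qed (use \<gamma>_period_int[of _ 1] l_pos in \<open>auto simp: vector_derivative_\<gamma> norm_Pair\<close>)

section \<open>The region enclosed by the curve\<close>

definition inner_side :: "(real \<times> real) set" where
  "inner_side = {p. \<forall>s. height s p > 0}"

text \<open>A point on the inner side of every tangent that lies on the tangent at \<open>s\<close> is on the curve: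
  slide the point of tangency towards it; on the way the distance from the tangent cannot increase.\<close>

lemma on_curve_of_height_zero:
  assumes ge: "\<And>r. height r p \<ge> 0" and zero: "height s p = 0"
  shows "p \<in> range \<gamma>"
proof -
  define R where "R r = cos (\<phi> r) * (fst p - X r) + sin (\<phi> r) * (snd p - Y r)" for r
  have hd: "((\<lambda>r. height r p) has_real_derivative - k r * R r) (at r)" for r
    unfolding height_def R_def by (auto intro!: derivative_eq_intros simp: algebra_simps)
  \<comment> \<open>The derivative of this periodic squared distance is -2 \<open>R\<close>, so
    \<open>R\<close> vanishes in every period: somewhere the foot of the perpendicular from
    \<open>p\<close> is the point of tangency.\<close>
  define E where "E r = (fst p - X r)\<^sup>2 + (snd p - Y r)\<^sup>2" for r
  have Ed: "(E has_real_derivative - 2 * R r) (at r)" for r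
    unfolding E_def R_def by (auto intro!: derivative_eq_intros simp: algebra_simps)
  have Rc: "continuous_on A R" for A unfolding R_def by (intro continuous_intros)
  have Eper: "E (r + l) = E r" for r by (simp add: E_def X_period Y_period)
  have on: "p \<in> range \<gamma>" if "R r = 0" "height r p = 0" for r
  proof -
    have "fst p - X r = cos (\<phi> r) * R r - sin (\<phi> r) * height r p"
      and "snd p - Y r = sin (\<phi> r) * R r + cos (\<phi> r) * height r p"
      unfolding R_def height_def using sin_cos_squared_add[of "\<phi> r"] by algebra+
    then have "p = \<gamma> r" using that by (simp add: \<gamma>_def prod_eq_iff)
    then show ?thesis by simp
  qed
  have mvt: "\<exists>z. a < z \<and> z < a + l \<and> R z = 0" for a
    using MVT2[of a "a + l" E "\<lambda>r. - 2 * R r"] Ed l_pos Eper by auto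
  consider "R s = 0" | "R s > 0" | "R s < 0" by linarith
  then show ?thesis
  proof cases
    case 1
    then show ?thesis using on zero by blast
  next
    case 2
    define Z where "Z = {s..s+l} \<inter> R -` {..0}"
    have "closed Z" unfolding Z_def
      by (intro continuous_closed_preimage Rc) auto
    moreover have "Z \<noteq> {}"
    proof -
      obtain z where "s < z" "z < s + l" "R z = 0" using mvt[of s] by auto
      then have "z \<in> Z" by (simp add: Z_def)
      then show ?thesis by blast
    qed
    moreover have bb: "bdd_below Z" by (auto simp: Z_def)
    ultimately have inf: "Inf Z \<in> Z" by (intro closed_contains_Inf) auto
    define t where "t = Inf Z"
    have t: "s \<le> t" "t \<le> s + l" "R t \<le> 0" using inf by (auto simp: Z_def t_def)
    have pos: "R r > 0" if "s \<le> r" "r < t" for r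
      using cInf_lower[OF _ bb, of r] that t by (force simp: Z_def t_def)
    have "R t = 0"
    proof (rule ccontr)
      assume "R t \<noteq> 0"
      then have "R t < 0" using t by simp
      then obtain r where r: "s \<le> r" "r \<le> t" "R r = 0"
        using IVT2'[of R t 0 s] 2 t Rc by auto
      then have "r \<noteq> t" using \<open>R t \<noteq> 0\<close> by blast
      then show False using pos[of r] r by auto
    qed
    have "height t p \<le> height s p"
    proof (rule DERIV_nonpos_imp_nonincreasing[OF t(1)])
      fix x assume "s \<le> x" "x \<le> t"
      then have "R x \<ge> 0" using pos[of x] \<open>R t = 0\<close> by (cases "x = t") auto
      then show "\<exists>y. ((\<lambda>r. height r p) has_real_derivative y) (at x) \<and> y \<le> 0"
        using hd k_nonneg by (intro exI[of _ "- k x * R x"]) auto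
    qed
    then show ?thesis using on[OF \<open>R t = 0\<close>] ge[of t] zero by force
  next
    case 3
    define Z where "Z = {s-l..s} \<inter> R -` {0..}"
    have "closed Z" unfolding Z_def
      by (intro continuous_closed_preimage Rc) auto
    moreover have "Z \<noteq> {}"
    proof -
      obtain z where "s - l < z" "z < s" "R z = 0" using mvt[of "s - l"] by auto
      then have "z \<in> Z" by (simp add: Z_def)
      then show ?thesis by blast
    qed
    moreover have bb: "bdd_above Z" by (auto simp: Z_def)
    ultimately have sup: "Sup Z \<in> Z" by (intro closed_contains_Sup) auto
    define t where "t = Sup Z"
    have t: "t \<le> s" "s - l \<le> t" "R t \<ge> 0" using sup by (auto simp: Z_def t_def)
    have neg: "R r < 0" if "r \<le> s" "t < r" for r
      using cSup_upper[OF _ bb, of r] that t by (force simp: Z_def t_def)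
    have "R t = 0"
    proof (rule ccontr)
      assume "R t \<noteq> 0"
      then have "R t > 0" using t by simp
      then obtain r where r: "t \<le> r" "r \<le> s" "R r = 0"
        using IVT2'[of R s 0 t] 3 t Rc by auto
      then have "r \<noteq> t" using \<open>R t \<noteq> 0\<close> by blast
      then show False using neg[of r] r by auto
    qed
    have "height t p \<le> height s p"
    proof (rule DERIV_nonneg_imp_nondecreasing[OF t(1)])
      fix x assume "t \<le> x" "x \<le> s"
      then have "R x \<le> 0" using neg[of x] \<open>R t = 0\<close> by (cases "x = t") auto
      then have "0 \<le> - k x * R x" using k_nonneg[of x] by (simp add: mult_nonneg_nonpos)
      then show "\<exists>y. ((\<lambda>r. height r p) has_real_derivative y) (at x) \<and> 0 \<le> y"
        using hd by blast
    qed
    then show ?thesis using on[OF \<open>R t = 0\<close>] ge[of t] zero by force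
  qed
qed

text \<open>An intersection of infinitely many open half planes: by periodicity a compact interval
  of tangents suffices, and the tube lemma applies to it.\<close>

lemma open_inner_side: "open inner_side"
proof -
  have eq: "inner_side = {p. \<forall>s\<in>{0..l}. height s p > 0}"
  proof -
    have "height s p > 0" if "\<forall>s\<in>{0..l}. height s p > 0" for s p
    proof -
      obtain n where n: "0 \<le> s + of_int n * l" "s + of_int n * l < 0 + l" by (rule period_shift)
      then have "height (s + of_int n * l) p > 0" using that by auto
      then show ?thesis by (simp add: height_period_int)
    qed
    then show ?thesis by (auto simp: inner_side_def)
  qed
  have "open {p. \<forall>s\<in>{0..l}. height s p > 0}"
  proof (subst open_subopen, safe)
    fix a b assume ab: "\<forall>s\<in>{0..l}. height s (a, b) > 0"
    define W where "W = {z. 0 < height (snd z) (fst z)}"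
    have "open W" unfolding W_def height_def
      by (intro open_Collect_less continuous_intros)
    moreover have "{(a,b)} \<times> {0..l} \<subseteq> W" using ab by (auto simp: W_def)
    ultimately obtain T where T: "open T" "(a,b) \<in> T" "T \<times> {0..l} \<subseteq> W"
      using Elementary_Topology.tube_lemma[of "{0..l}" W "(a,b)"] by auto
    then show "\<exists>T. open T \<and> (a, b) \<in> T \<and> T \<subseteq> {p. \<forall>s\<in>{0..l}. 0 < height s p}"
      by (intro exI[of _ T]) (auto simp: W_def)
  qed
  then show ?thesis using eq by simp
qed

text \<open>The tangent angle makes a full turn, so four tangents have the axis directions, and
  their half planes meet in a rectangle.\<close>

lemma bounded_inner_side: "bounded inner_side"
proof -
  have ex: "\<exists>s. sin (\<phi> s) = sin t \<and> cos (\<phi> s) = cos t" for t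
  proof -
    define n where "n = \<lceil>(\<phi> 0 - t) / (2*pi)\<rceil>"
    have "(\<phi> 0 - t) / (2*pi) \<le> of_int n" "of_int n \<le> (\<phi> 0 - t) / (2*pi) + 1"
      unfolding n_def by linarith+
    then have "\<phi> 0 \<le> t + of_int n * (2*pi)" "t + of_int n * (2*pi) \<le> \<phi> (0 + l)"
      unfolding \<phi>_period by (simp_all add: field_simps)
    then have "\<exists>s\<ge>0. s \<le> 0 + l \<and> \<phi> s = t + of_int n * (2*pi)"
      using l_pos isCont_curve(1) by (intro IVT') (auto simp: continuous_at_imp_continuous_on)
    then obtain s where "\<phi> s = t + of_int n * (2*pi)" by blast
    then have "sin (\<phi> s) = sin t" "cos (\<phi> s) = cos t"
      by (simp_all only: sin.plus_of_int[where 'a=real, simplified] cos.plus_of_int[where 'a=real, simplified])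
    then show ?thesis by blast
  qed
  obtain s1 where s1: "sin (\<phi> s1) = 0" "cos (\<phi> s1) = 1" using ex[of 0] by auto
  obtain s2 where s2: "sin (\<phi> s2) = 1" "cos (\<phi> s2) = 0" using ex[of "pi/2"] by auto
  obtain s3 where s3: "sin (\<phi> s3) = 0" "cos (\<phi> s3) = -1" using ex[of pi] by auto
  obtain s4 where s4: "sin (\<phi> s4) = -1" "cos (\<phi> s4) = 0" using ex[of "-pi/2"] by auto
  note s = s1 s2 s3 s4
  have "inner_side \<subseteq> cbox (X s4, Y s1) (X s2, Y s3)"
  proof
    fix p assume "p \<in> inner_side"
    then have "height s1 p > 0" "height s2 p > 0" "height s3 p > 0" "height s4 p > 0"
      by (auto simp: inner_side_def)
    then show "p \<in> cbox (X s4, Y s1) (X s2, Y s3)"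
      using s by (cases p) (auto simp: height_def cbox_Pair_eq)
  qed
  then show ?thesis using bounded_cbox bounded_subset by blast
qed

text \<open>A frontier point has nonnegative heights, one of them zero, so it lies on the curve. A
  connected set that starts in the bounded set \<open>inner_side\<close> and avoids the curve
  therefore never leaves it.\<close>

lemma inner_side_subset_inside: "inner_side \<subseteq> inside (range \<gamma>)"
proof
  fix p assume p: "p \<in> inner_side"
  have fr: "frontier inner_side \<subseteq> range \<gamma>"
  proof
    fix q assume q: "q \<in> frontier inner_side"
    have ge: "height s q \<ge> 0" for s
    proof -
      have "closed {q. height s q \<ge> 0}" unfolding height_def
        by (intro closed_Collect_le continuous_intros)
      moreover have "inner_side \<subseteq> {q. height s q \<ge> 0}" by (auto simp: inner_side_def less_imp_le)
      ultimately have "closure inner_side \<subseteq> {q. height s q \<ge> 0}" by (rule closure_minimal[rotated])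
      then show ?thesis using q by (auto simp: frontier_def)
    qed
    have "q \<notin> inner_side" using q open_inner_side by (simp add: frontier_def interior_open)
    then obtain s where "\<not> height s q > 0" by (auto simp: inner_side_def)
    then show "q \<in> range \<gamma>" using ge[of s] on_curve_of_height_zero[OF ge, of s] by simp
  qed
  have "p \<notin> range \<gamma>" using p by (auto simp: inner_side_def) (metis height_self less_irrefl)
  moreover have "connected_component_set (- range \<gamma>) p \<subseteq> inner_side"
  proof (rule ccontr)
    let ?C = "connected_component_set (- range \<gamma>) p"
    assume "\<not> ?C \<subseteq> inner_side"
    moreover have "p \<in> ?C" using \<open>p \<notin> range \<gamma>\<close> by simp
    ultimately have "?C \<inter> inner_side \<noteq> {}" "?C - inner_side \<noteq> {}" using p by blast+
    then have "?C \<inter> frontier inner_side \<noteq> {}"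
      by (intro connected_Int_frontier) auto
    then show False using fr connected_component_subset[of "- range \<gamma>" p] by auto
  qed
  ultimately show "p \<in> inside (range \<gamma>)"
    using bounded_inner_side bounded_subset by (auto simp: inside_def)
qed

text \<open>The height is affine along the chord, so it can vanish inside the chord only over a
  tangent that contains both ends; the ends would then have equal tangent directions.\<close>

lemma open_segment_subset_inside:
  assumes "(cos (\<phi> s), sin (\<phi> s)) \<noteq> (cos (\<phi> r), sin (\<phi> r))"
  shows "open_segment (\<gamma> s) (\<gamma> r) \<subseteq> inside (range \<gamma>)"
proof -
  have "open_segment (\<gamma> s) (\<gamma> r) \<subseteq> inner_side"
  proof
    fix p assume "p \<in> open_segment (\<gamma> s) (\<gamma> r)"
    then obtain u where u: "0 < u" "u < 1" "p = (1 - u) *\<^sub>R \<gamma> s + u *\<^sub>R \<gamma> r"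
      by (auto simp: in_segment)
    have "height t p > 0" for t
    proof -
      have eq: "height t p = (1 - u) * height t (\<gamma> s) + u * height t (\<gamma> r)"
        by (simp add: u height_def \<gamma>_def algebra_simps)
      have "\<not> (height t (\<gamma> s) = 0 \<and> height t (\<gamma> r) = 0)"
        using tangent_eq_of_height_zero[of t s] tangent_eq_of_height_zero[of t r] assms by auto
      then have "height t (\<gamma> s) > 0 \<or> height t (\<gamma> r) > 0"
        using height_nonneg[of t s] height_nonneg[of t r] by linarith
      then show ?thesis unfolding eq
        using height_nonneg[of t s] height_nonneg[of t r] u
        by (auto intro: add_pos_nonneg add_nonneg_pos)
    qed
    then show "p \<in> inner_side" by (simp add: inner_side_def)
  qed
  then show ?thesis using inner_side_subset_inside by blast
qed

end

section \<open>Vectors and matrices of dimension two\<close>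

abbreviation mat2 :: "real \<Rightarrow> real \<Rightarrow> real \<Rightarrow> real \<Rightarrow> real ^ 2 ^ 2" where
  "mat2 a b c d \<equiv> vector [vector [a, b], vector [c, d]]"

lemma vec2_eq_iff: "x = y \<longleftrightarrow> x $ 1 = y $ 1 \<and> x $ 2 = (y :: real ^ 2) $ 2"
  by (simp add: vec_eq_iff forall_2)

lemma vec2_tendsto_iff:
  "(f \<longlongrightarrow> (l :: real ^ 2)) F \<longleftrightarrow> ((\<lambda>x. f x $ 1) \<longlongrightarrow> l $ 1) F \<and> ((\<lambda>x. f x $ 2) \<longlongrightarrow> l $ 2) F"
proof
  assume "((\<lambda>x. f x $ 1) \<longlongrightarrow> l $ 1) F \<and> ((\<lambda>x. f x $ 2) \<longlongrightarrow> l $ 2) F"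
  then have "\<forall>i. ((\<lambda>x. f x $ i) \<longlongrightarrow> l $ i) F" unfolding forall_2 .
  then show "(f \<longlongrightarrow> l) F" by (intro vec_tendstoI) blast
qed (auto intro: tendsto_vec_nth)

lemma mat2_vector: "mat2 a b c d *v x = vector [a * x $ 1 + b * x $ 2, c * x $ 1 + d * x $ 2]"
  by (simp add: vec2_eq_iff matrix_vector_mult_def sum_2)

lemma mat2_mult: "mat2 a b c d ** mat2 a' b' c' d' =
    mat2 (a * a' + b * c') (a * b' + b * d') (c * a' + d * c') (c * b' + d * d')"
  by (simp add: vec_eq_iff forall_2 matrix_matrix_mult_def sum_2)

lemma trace_mat2: "trace (mat2 a b c d) = a + d"
  by (simp add: trace_def sum_2)

lemma has_derivative_vector2 [derivative_intros]:
  assumes "(f has_derivative f') F" "(g has_derivative g') F"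
  shows "((\<lambda>x. vector [f x, g x] :: real ^ 2) has_derivative (\<lambda>h. vector [f' h, g' h])) F"
proof -
  have eq: "(vector [a, b] :: real ^ 2) = a *\<^sub>R axis 1 1 + b *\<^sub>R axis 2 1" for a b
    by (simp add: vec2_eq_iff axis_def)
  show ?thesis unfolding eq using assms by (intro derivative_intros)
qed

section \<open>Linearization of the billiard map\<close>

text \<open>A local branch of the n-th iterate with an exact end point \<open>y\<close>, whereas
  \<open>monodromy_matrix\<close> asks only for the same state. The exact value lets branches
  compose.\<close>

definition linearized_step ::
    "(real \<Rightarrow> real \<times> real) \<Rightarrow> nat \<Rightarrow> real ^ 2 \<Rightarrow> real ^ 2 \<Rightarrow> real ^ 2 ^ 2 \<Rightarrow> bool" where
  "linearized_step \<gamma> n x y M \<longleftrightarrow>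
     (\<exists>F. F x = y \<and> (\<forall>\<^sub>F z in nhds x. (bounce \<gamma> ^^ n) z (F z)) \<and>
          (F has_derivative (\<lambda>v. M *v v)) (at x))"

lemma linearized_step_compose:
  assumes "linearized_step \<gamma> n x y M" "linearized_step \<gamma> m y z N"
  shows "linearized_step \<gamma> (n + m) x z (N ** M)"
proof -
  obtain F where F: "F x = y" "\<forall>\<^sub>F z in nhds x. (bounce \<gamma> ^^ n) z (F z)"
    "(F has_derivative (\<lambda>v. M *v v)) (at x)"
    using assms(1) by (auto simp: linearized_step_def)
  obtain G where G: "G y = z" "\<forall>\<^sub>F w in nhds y. (bounce \<gamma> ^^ m) w (G w)"
    "(G has_derivative (\<lambda>v. N *v v)) (at y)"
    using assms(2) by (auto simp: linearized_step_def)
  have "filterlim F (nhds (F x)) (nhds x)"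
    using has_derivative_continuous[OF F(3)] by (simp only: isCont_def tendsto_at_iff_tendsto_nhds)
  then have "\<forall>\<^sub>F w in nhds x. (bounce \<gamma> ^^ m) (F w) (G (F w))"
    using G(2) F(1) filterlim_iff by blast
  with F(2) have ev: "\<forall>\<^sub>F w in nhds x. (bounce \<gamma> ^^ (n + m)) w (G (F w))"
    by eventually_elim (auto simp: relpowp_add)
  have "((G \<circ> F) has_derivative (\<lambda>v. N *v v) \<circ> (\<lambda>v. M *v v)) (at x)"
    using F G by (intro diff_chain_at) auto
  then have "((\<lambda>w. G (F w)) has_derivative (\<lambda>v. (N ** M) *v v)) (at x)"
    by (simp add: o_def matrix_vector_mul_assoc)
  then show ?thesis
    unfolding linearized_step_def using F(1) G(1) ev by (intro exI[of _ "\<lambda>w. G (F w)"]) auto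
qed

lemma linearized_step_0: "linearized_step \<gamma> 0 x x (mat2 1 0 0 1)"
proof -
  have "(*v) (mat2 1 0 0 1) = (\<lambda>v. v)" by (simp add: mat2_vector vec2_eq_iff fun_eq_iff)
  then show ?thesis unfolding linearized_step_def by (intro exI[of _ "\<lambda>w. w"]) auto
qed

lemma linearized_step_bounce:
  assumes "linearized_step \<gamma> n x y M"
  shows "(bounce \<gamma> ^^ n) x y"
proof -
  obtain F where "F x = y" "\<forall>\<^sub>F z in nhds x. (bounce \<gamma> ^^ n) z (F z)"
    using assms by (auto simp: linearized_step_def)
  then show ?thesis using eventually_nhds_x_imp_x by blast
qed

context convex_curve
begin

section \<open>The chord length as generating function of the billiard map\<close>

definition dist_curve :: "real \<Rightarrow> real \<Rightarrow> real" where
  "dist_curve s r = sqrt ((X r - X s)\<^sup>2 + (Y r - Y s)\<^sup>2)"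

definition out_cos :: "real \<Rightarrow> real \<Rightarrow> real" where
  "out_cos s r = ((X r - X s) * cos (\<phi> s) + (Y r - Y s) * sin (\<phi> s)) / dist_curve s r"

definition in_cos :: "real \<Rightarrow> real \<Rightarrow> real" where
  "in_cos s r = ((X r - X s) * cos (\<phi> r) + (Y r - Y s) * sin (\<phi> r)) / dist_curve s r"

lemma dist_curve_eq: "dist_curve s r = norm (\<gamma> r - \<gamma> s)"
  by (simp add: dist_curve_def \<gamma>_def norm_Pair)

lemma dist_curve_pos: "\<gamma> s \<noteq> \<gamma> r \<Longrightarrow> dist_curve s r > 0"
  by (simp add: dist_curve_eq)

lemma bounceI:
  assumes "\<gamma> s \<noteq> \<gamma> r" "(cos (\<phi> s), sin (\<phi> s)) \<noteq> (cos (\<phi> r), sin (\<phi> r))"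
  shows "bounce \<gamma> (vector [s, out_cos s r]) (vector [r, in_cos s r])"
proof -
  have "sgn (\<gamma> r - \<gamma> s) \<bullet> v = ((X r - X s) * fst v + (Y r - Y s) * snd v) / dist_curve s r" for v
    unfolding sgn_div_norm dist_curve_eq[symmetric]
    by (simp add: \<gamma>_def inner_prod_def divide_inverse algebra_simps)
  then show ?thesis
    unfolding bounce_def Let_def vector_2 vector_derivative_\<gamma>
    using assms open_segment_subset_inside[OF assms(2)] by (simp add: out_cos_def in_cos_def)
qed

lemmas has_derivative_curve =
  DERIV_compose_FDERIV[OF \<phi>_deriv] DERIV_compose_FDERIV[OF X_deriv] DERIV_compose_FDERIV[OF Y_deriv]
  bounded_linear.has_derivative[OF bounded_linear_vec_nth]

text \<open>The partial derivatives of the chord length are, up to sign, the Birkhoff momenta at its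
  two ends. The derivatives of \<open>out_cos\<close> and \<open>in_cos\<close> are thus its second
  derivatives up to sign, with opposite mixed entries.\<close>

lemma dist_curve_deriv:
  assumes "\<gamma> (w $ 1) \<noteq> \<gamma> (w $ 2)"
  shows "((\<lambda>w. dist_curve (w $ 1) (w $ 2)) has_derivative
    (\<lambda>h. in_cos (w $ 1) (w $ 2) * h $ 2 - out_cos (w $ 1) (w $ 2) * h $ 1)) (at (w :: real ^ 2))"
proof -
  have pos: "(X (w $ 2) - X (w $ 1))\<^sup>2 + (Y (w $ 2) - Y (w $ 1))\<^sup>2 > 0"
    using dist_curve_pos[OF assms] unfolding dist_curve_def by simp
  have "((\<lambda>w :: real ^ 2. (X (w $ 2) - X (w $ 1))\<^sup>2 + (Y (w $ 2) - Y (w $ 1))\<^sup>2) has_derivative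
    (\<lambda>h. 2 * (X (w $ 2) - X (w $ 1)) * (cos (\<phi> (w $ 2)) * h $ 2 - cos (\<phi> (w $ 1)) * h $ 1)
       + 2 * (Y (w $ 2) - Y (w $ 1)) * (sin (\<phi> (w $ 2)) * h $ 2 - sin (\<phi> (w $ 1)) * h $ 1))) (at w)"
    apply (rule has_derivative_eq_rhs)
     apply (rule derivative_intros has_derivative_curve has_derivative_ident)+
    apply (simp add: fun_eq_iff algebra_simps)
    done
  from has_derivative_real_sqrt[OF pos this] show ?thesis
    unfolding dist_curve_def[symmetric]
    by (rule has_derivative_eq_rhs)
       (use dist_curve_pos[OF assms] in \<open>simp add: fun_eq_iff in_cos_def out_cos_def field_simps\<close>)
qed

text \<open>The curvature enters because the tangent at \<open>s\<close> turns at rate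
  \<open>k s\<close> towards the inner normal, so the vector to \<open>\<gamma> r\<close>
  contributes its height.\<close>

lemma out_cos_deriv:
  assumes "\<gamma> (w $ 1) \<noteq> \<gamma> (w $ 2)"
  defines "s \<equiv> w $ 1" and "r \<equiv> w $ 2"
  shows "((\<lambda>w. out_cos (w $ 1) (w $ 2)) has_derivative
    (\<lambda>h. (- 1 + k s * height s (\<gamma> r) + (out_cos s r)\<^sup>2) / dist_curve s r * h $ 1
       + (cos (\<phi> r - \<phi> s) - out_cos s r * in_cos s r) / dist_curve s r * h $ 2))
    (at (w :: real ^ 2))"
proof -
  have pos: "dist_curve s r > 0" using dist_curve_pos assms by blast
  define N where "N w = (X (w $ 2) - X (w $ 1)) * cos (\<phi> (w $ 1))
    + (Y (w $ 2) - Y (w $ 1)) * sin (\<phi> (w $ 1))" for w :: "real ^ 2"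
  have "(N has_derivative (\<lambda>h. cos (\<phi> r - \<phi> s) * h $ 2 + (- 1 + k s * height s (\<gamma> r)) * h $ 1)) (at w)"
    unfolding N_def
    apply (rule has_derivative_eq_rhs)
     apply (rule derivative_intros has_derivative_curve has_derivative_ident)+
    apply (rule ext)
    unfolding s_def[symmetric] r_def[symmetric] height_def \<gamma>_def fst_conv snd_conv cos_diff
    using sin_cos_squared_add[of "\<phi> s"] apply algebra
    done
  from has_derivative_divide[OF this dist_curve_deriv[OF assms(1)]] pos
  have "((\<lambda>w. N w / dist_curve (w $ 1) (w $ 2)) has_derivative
    (\<lambda>h. - N w * (inverse (dist_curve s r) * (in_cos s r * h $ 2 - out_cos s r * h $ 1) *
        inverse (dist_curve s r)) +
      (cos (\<phi> r - \<phi> s) * h $ 2 + (- 1 + k s * height s (\<gamma> r)) * h $ 1) / dist_curve s r)) (at w)"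
    by (simp add: s_def r_def)
  moreover have "N w = out_cos s r * dist_curve s r"
    using pos by (simp add: N_def out_cos_def s_def r_def)
  moreover have "out_cos (w $ 1) (w $ 2) = N w / dist_curve (w $ 1) (w $ 2)" for w :: "real ^ 2"
    by (simp add: N_def out_cos_def)
  ultimately show ?thesis
    apply simp
    apply (erule has_derivative_eq_rhs)
    using pos by (auto simp: field_simps power2_eq_square)
qed

lemma in_cos_deriv:
  assumes "\<gamma> (w $ 1) \<noteq> \<gamma> (w $ 2)"
  defines "s \<equiv> w $ 1" and "r \<equiv> w $ 2"
  shows "((\<lambda>w. in_cos (w $ 1) (w $ 2)) has_derivative
    (\<lambda>h. (- cos (\<phi> r - \<phi> s) + out_cos s r * in_cos s r) / dist_curve s r * h $ 1
       + (1 - k r * height r (\<gamma> s) - (in_cos s r)\<^sup>2) / dist_curve s r * h $ 2))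
    (at (w :: real ^ 2))"
proof -
  have pos: "dist_curve s r > 0" using dist_curve_pos assms by blast
  define N where "N w = (X (w $ 2) - X (w $ 1)) * cos (\<phi> (w $ 2))
    + (Y (w $ 2) - Y (w $ 1)) * sin (\<phi> (w $ 2))" for w :: "real ^ 2"
  have "(N has_derivative (\<lambda>h. (1 - k r * height r (\<gamma> s)) * h $ 2 - cos (\<phi> r - \<phi> s) * h $ 1)) (at w)"
    unfolding N_def
    apply (rule has_derivative_eq_rhs)
     apply (rule derivative_intros has_derivative_curve has_derivative_ident)+
    apply (rule ext)
    unfolding s_def[symmetric] r_def[symmetric] height_def \<gamma>_def fst_conv snd_conv cos_diff
    using sin_cos_squared_add[of "\<phi> r"] apply algebra
    done
  from has_derivative_divide[OF this dist_curve_deriv[OF assms(1)]] pos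
  have "((\<lambda>w. N w / dist_curve (w $ 1) (w $ 2)) has_derivative
    (\<lambda>h. - N w * (inverse (dist_curve s r) * (in_cos s r * h $ 2 - out_cos s r * h $ 1) *
        inverse (dist_curve s r)) +
      ((1 - k r * height r (\<gamma> s)) * h $ 2 - cos (\<phi> r - \<phi> s) * h $ 1) / dist_curve s r)) (at w)"
    by (simp add: s_def r_def)
  moreover have "N w = in_cos s r * dist_curve s r"
    using pos by (simp add: N_def in_cos_def s_def r_def)
  moreover have "in_cos (w $ 1) (w $ 2) = N w / dist_curve (w $ 1) (w $ 2)" for w :: "real ^ 2"
    by (simp add: N_def in_cos_def)
  ultimately show ?thesis
    apply simp
    apply (erule has_derivative_eq_rhs)
    using pos by (auto simp: field_simps power2_eq_square)
qed

text \<open>\<open>\<omega>\<close> is the direction angle. The strict inequalities say that the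
  chord meets the curve transversally at both ends, pointing inwards at \<open>s\<close>; they
  exclude chords along a straight side.\<close>

definition chord :: "real \<Rightarrow> real \<Rightarrow> real \<Rightarrow> real \<Rightarrow> bool" where
  "chord s r \<omega> d \<longleftrightarrow> d > 0 \<and> X r - X s = d * cos \<omega> \<and> Y r - Y s = d * sin \<omega> \<and>
     sin (\<omega> - \<phi> s) > 0 \<and> sin (\<phi> r - \<omega>) > 0"

text \<open>The entries are built from the second derivatives \<open>A\<close>, \<open>b\<close>, \<open>C\<close> of the distance between the two
  collision points, which generates the billiard map.\<close>

definition chord_matrix :: "real \<Rightarrow> real \<Rightarrow> real \<Rightarrow> real \<Rightarrow> real ^ 2 ^ 2" where
  "chord_matrix s r \<omega> d =
     (let p = sin (\<omega> - \<phi> s); q = sin (\<phi> r - \<omega>);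
          A = p\<^sup>2 / d - k s * p; C = q\<^sup>2 / d - k r * q; b = p * q / d
      in mat2 (- A / b) (- 1 / b) (b - A * C / b) (- C / b))"

lemma chord_values:
  assumes "chord s r \<omega> d"
  shows "dist_curve s r = d" "out_cos s r = cos (\<omega> - \<phi> s)" "in_cos s r = cos (\<phi> r - \<omega>)"
    "height s (\<gamma> r) = d * sin (\<omega> - \<phi> s)" "height r (\<gamma> s) = d * sin (\<phi> r - \<omega>)"
    "\<gamma> s \<noteq> \<gamma> r" "(cos (\<phi> s), sin (\<phi> s)) \<noteq> (cos (\<phi> r), sin (\<phi> r))"
proof -
  have d: "d > 0" "X r - X s = d * cos \<omega>" "Y r - Y s = d * sin \<omega>"
    "sin (\<omega> - \<phi> s) > 0" "sin (\<phi> r - \<omega>) > 0"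
    using assms by (auto simp: chord_def)
  have "(d * cos \<omega>)\<^sup>2 + (d * sin \<omega>)\<^sup>2 = d\<^sup>2 * ((sin \<omega>)\<^sup>2 + (cos \<omega>)\<^sup>2)"
    by (simp only: power_mult_distrib ring_distribs add.commute)
  then show dist: "dist_curve s r = d" using d by (simp add: dist_curve_def)
  show "out_cos s r = cos (\<omega> - \<phi> s)" "in_cos s r = cos (\<phi> r - \<omega>)"
    unfolding out_cos_def in_cos_def dist d(2,3) using d(1) by (simp_all add: cos_diff field_simps)
  show "height s (\<gamma> r) = d * sin (\<omega> - \<phi> s)"
    unfolding height_def \<gamma>_def fst_conv snd_conv d(2,3) by (simp add: sin_diff algebra_simps)
  have "X s - X r = - (d * cos \<omega>)" "Y s - Y r = - (d * sin \<omega>)" using d by linarith+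
  note d' = this
  show "height r (\<gamma> s) = d * sin (\<phi> r - \<omega>)"
    unfolding height_def \<gamma>_def fst_conv snd_conv d' by (simp add: sin_diff algebra_simps)
  show "\<gamma> s \<noteq> \<gamma> r" using dist d(1) by (auto simp: dist_curve_eq)
  \<comment> \<open>Equal tangent directions would make the two sines opposite numbers, but both are
    positive.\<close>
  show "(cos (\<phi> s), sin (\<phi> s)) \<noteq> (cos (\<phi> r), sin (\<phi> r))"
    using d(4,5) by (auto simp: sin_diff mult.commute)
qed

lemma continuous_on_dist_curve [continuous_intros]:
  "continuous_on S f \<Longrightarrow> continuous_on S g \<Longrightarrow> continuous_on S (\<lambda>x. dist_curve (f x) (g x))"
  unfolding dist_curve_def by (intro continuous_intros)

lemma continuous_on_out_cos [continuous_intros]: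
  fixes f g :: "'a::t2_space \<Rightarrow> real"
  assumes "continuous_on S f" "continuous_on S g" "\<And>x. x \<in> S \<Longrightarrow> \<gamma> (f x) \<noteq> \<gamma> (g x)"
  shows "continuous_on S (\<lambda>x. out_cos (f x) (g x))"
  unfolding out_cos_def using assms dist_curve_pos
  by (intro continuous_intros) (auto simp: less_imp_neq[symmetric])

lemma continuous_on_in_cos [continuous_intros]:
  fixes f g :: "'a::t2_space \<Rightarrow> real"
  assumes "continuous_on S f" "continuous_on S g" "\<And>x. x \<in> S \<Longrightarrow> \<gamma> (f x) \<noteq> \<gamma> (g x)"
  shows "continuous_on S (\<lambda>x. in_cos (f x) (g x))"
  unfolding in_cos_def using assms dist_curve_pos
  by (intro continuous_intros) (auto simp: less_imp_neq[symmetric])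

text \<open>For a fixed starting point the outgoing angle is strictly monotone in the end point of the chord,
  so the end point is a function of the Birkhoff coordinates.\<close>

lemma chord_linearized_step:
  assumes ch: "chord s r \<omega> d"
  shows "linearized_step \<gamma> 1 (vector [s, cos (\<omega> - \<phi> s)]) (vector [r, cos (\<phi> r - \<omega>)])
    (chord_matrix s r \<omega> d)"
proof -
  note val = chord_values[OF ch]
  have pos: "d > 0" "sin (\<omega> - \<phi> s) > 0" "sin (\<phi> r - \<omega>) > 0" using ch by (auto simp: chord_def)
  \<comment> \<open>The derivative of the outgoing cosine in the end point of the chord; its
    negative sign is the monotonicity that determines the end point.\<close>
  define Ur where "Ur w = (cos (\<phi> (w $ 2) - \<phi> (w $ 1)) - out_cos (w $ 1) (w $ 2) * in_cos (w $ 1) (w $ 2))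
    / dist_curve (w $ 1) (w $ 2)" for w :: "real ^ 2"
  define w0 :: "real ^ 2" where "w0 = vector [s, r]"
  define z0 :: "real ^ 2" where "z0 = vector [s, cos (\<omega> - \<phi> s)]"
  define P where "P = {w :: real ^ 2. 0 < dist_curve (w $ 1) (w $ 2)}"
  \<comment> \<open>Pairs whose points and tangents differ and for which the monotonicity holds, so
    that \<open>bounceI\<close> applies to all chords near the given one.\<close>
  define Q where "Q = {w\<in>P. Ur w < 0} \<inter>
    {w. 0 < (cos (\<phi> (w $ 1)) - cos (\<phi> (w $ 2)))\<^sup>2 + (sin (\<phi> (w $ 1)) - sin (\<phi> (w $ 2)))\<^sup>2}"
  have "open P" unfolding P_def by (intro open_Collect_less continuous_intros)
  have neq: "\<gamma> (w $ 1) \<noteq> \<gamma> (w $ 2)" if "w \<in> P" for w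
    using that by (auto simp: P_def dist_curve_eq)
  have "continuous_on P Ur"
    unfolding Ur_def using neq dist_curve_pos
    by (intro continuous_intros) (auto simp: P_def)
  then have "open (P \<inter> Ur -` {..<0})"
    using \<open>open P\<close> by (intro continuous_open_preimage) auto
  moreover have "P \<inter> Ur -` {..<0} = {w\<in>P. Ur w < 0}" by auto
  moreover have "open {w :: real ^ 2. 0 < (cos (\<phi> (w $ 1)) - cos (\<phi> (w $ 2)))\<^sup>2
      + (sin (\<phi> (w $ 1)) - sin (\<phi> (w $ 2)))\<^sup>2}"
    by (intro open_Collect_less continuous_intros)
  ultimately have "open Q" unfolding Q_def by auto
  have b0: "Ur w0 = - (sin (\<omega> - \<phi> s) * sin (\<phi> r - \<omega>) / d)"
  proof -
    have "cos (\<phi> r - \<phi> s) = cos ((\<phi> r - \<omega>) + (\<omega> - \<phi> s))" by simp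
    then have "cos (\<phi> r - \<phi> s) - cos (\<omega> - \<phi> s) * cos (\<phi> r - \<omega>) = - (sin (\<omega> - \<phi> s) * sin (\<phi> r - \<omega>))"
      by (simp only: cos_add) simp
    then show ?thesis by (simp add: Ur_def w0_def val)
  qed
  have "w0 \<in> Q"
  proof -
    have "(cos (\<phi> s) - cos (\<phi> r))\<^sup>2 + (sin (\<phi> s) - sin (\<phi> r))\<^sup>2 > 0"
      using val(7) by (auto simp: sum_power2_gt_zero_iff)
    then show ?thesis using b0 pos val(1) by (simp add: Q_def P_def w0_def)
  qed
  have distinct: "\<gamma> (w $ 1) \<noteq> \<gamma> (w $ 2)"
    "(cos (\<phi> (w $ 1)), sin (\<phi> (w $ 1))) \<noteq> (cos (\<phi> (w $ 2)), sin (\<phi> (w $ 2)))" if "w \<in> Q" for w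
    using that neq by (auto simp: Q_def)
  have "open ((\<lambda>(s, r). vector [s, r] :: real ^ 2) -` Q)"
  proof (rule open_vimage[OF \<open>open Q\<close>])
    have "((\<lambda>x. vector [fst x, snd x] :: real ^ 2) has_derivative (\<lambda>h. vector [fst h, snd h])) (at x)"
      for x :: "real \<times> real" by (intro derivative_intros)
    then show "continuous_on UNIV (\<lambda>(s, r). vector [s, r] :: real ^ 2)"
      unfolding case_prod_unfold
      by (intro continuous_at_imp_continuous_on ballI) (rule has_derivative_continuous)
  qed
  moreover have "(s, r) \<in> (\<lambda>(s, r). vector [s, r]) -` Q" using \<open>w0 \<in> Q\<close> by (simp add: w0_def)
  ultimately obtain A B where AB: "open A" "open B" "s \<in> A" "r \<in> B"
    "A \<times> B \<subseteq> (\<lambda>(s, r). vector [s, r]) -` Q" by (rule open_prod_elim) blast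
  obtain e where e: "e > 0" "cball r e \<subseteq> B" using AB open_contains_cball by blast
  have inQ: "vector [s', r'] \<in> Q" if "s' \<in> A" "r' \<in> {r - e..r + e}" for s' r'
    using that AB(5) e(2) by (force simp: mem_cball dist_real_def)
  define U where "U = {z :: real ^ 2. z $ 1 \<in> A}"
  have "open U" unfolding U_def
    using AB(1) by (intro open_vimage[unfolded vimage_def] continuous_intros) auto
  have "z0 \<in> U" by (simp add: U_def z0_def AB)
  obtain V g where V: "open V" "z0 \<in> V" "V \<subseteq> U" and g: "continuous_on V g" "g z0 = r"
    "\<And>z. z \<in> V \<Longrightarrow> z $ 2 - out_cos (z $ 1) (g z) = 0" "\<And>z. z \<in> V \<Longrightarrow> r - e < g z \<and> g z < r + e"
  proof (rule monotone_implicit_function[OF \<open>open U\<close> \<open>z0 \<in> U\<close> e(1),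
      where F = "\<lambda>z r'. z $ 2 - out_cos (z $ 1) r'" and ?b0.0 = r])
    show "z0 $ 2 - out_cos (z0 $ 1) r = 0" by (simp add: z0_def val)
    show "continuous_on U (\<lambda>x. x $ 2 - out_cos (x $ 1) b)" if "b \<in> {r - e..r + e}" for b
      using distinct(1)[OF inQ[OF _ that]]
      by (intro continuous_intros) (auto simp: U_def)
    show "continuous_on {r - e..r + e} (\<lambda>b. x $ 2 - out_cos (x $ 1) b)" if "x \<in> U" for x
      using distinct(1)[OF inQ[of "x $ 1"]] that
      by (intro continuous_intros) (auto simp: U_def)
    show "x $ 2 - out_cos (x $ 1) b < x $ 2 - out_cos (x $ 1) b'"
      if "x \<in> U" "r - e \<le> b" "b < b'" "b' \<le> r + e" for x b b'
    proof (rule DERIV_pos_imp_increasing[OF that(3)])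
      fix y assume y: "b \<le> y" "y \<le> b'"
      let ?w = "vector [x $ 1, y] :: real ^ 2"
      have Q: "?w \<in> Q" using inQ[of "x $ 1" y] that y by (auto simp: U_def)
      have "((\<lambda>y. vector [x $ 1, y] :: real ^ 2) has_derivative (\<lambda>h. vector [0, h])) (at y)"
        by (intro derivative_intros)
      moreover have "((\<lambda>w. out_cos (w $ 1) (w $ 2)) has_derivative
        (\<lambda>h. (- 1 + k (x $ 1) * height (x $ 1) (\<gamma> y) + (out_cos (x $ 1) y)\<^sup>2) / dist_curve (x $ 1) y * h $ 1
         + Ur ?w * h $ 2)) (at ?w)"
        using out_cos_deriv[of ?w] distinct(1)[OF Q] by (simp add: Ur_def)
      ultimately have "((\<lambda>y. out_cos (x $ 1) y) has_derivative (\<lambda>h. Ur ?w * h)) (at y)"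
        by (auto dest: has_derivative_compose)
      then have "((\<lambda>y. out_cos (x $ 1) y) has_real_derivative Ur ?w) (at y)"
        by (simp add: has_field_derivative_def)
      then have "((\<lambda>y. x $ 2 - out_cos (x $ 1) y) has_real_derivative - Ur ?w) (at y)"
        by (auto intro!: derivative_eq_intros)
      moreover have "- Ur ?w > 0" using Q by (simp add: Q_def)
      ultimately show "\<exists>y'. ((\<lambda>y. x $ 2 - out_cos (x $ 1) y) has_real_derivative y') (at y) \<and> 0 < y'"
        by blast
    qed
  qed blast
  define G where "G z = (vector [z $ 1, g z] :: real ^ 2)" for z :: "real ^ 2"
  define p q where "p = sin (\<omega> - \<phi> s)" and "q = sin (\<phi> r - \<omega>)"
  define A' C b where "A' = p\<^sup>2 / d - k s * p" and "C = q\<^sup>2 / d - k r * q" and "b = p * q / d"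
  have "b > 0" "p > 0" "q > 0" using pos by (auto simp: b_def p_def q_def)
  have cm: "chord_matrix s r \<omega> d = mat2 (- A' / b) (- 1 / b) (b - A' * C / b) (- C / b)"
    by (simp only: chord_matrix_def Let_def A'_def C_def b_def p_def q_def)
  have G0: "G z0 = w0" by (simp add: G_def z0_def w0_def g(2)[unfolded z0_def])
  have c2: "(cos (\<omega> - \<phi> s))\<^sup>2 = 1 - p\<^sup>2" "(cos (\<phi> r - \<omega>))\<^sup>2 = 1 - q\<^sup>2"
    by (simp_all add: p_def q_def cos_squared_eq)
  have Us: "(- 1 + k s * height s (\<gamma> r) + (out_cos s r)\<^sup>2) / dist_curve s r = - A'"
    unfolding val c2 A'_def p_def using pos(1) by (simp add: field_simps power2_eq_square)
  have Vr: "(1 - k r * height r (\<gamma> s) - (in_cos s r)\<^sup>2) / dist_curve s r = C"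
    unfolding val c2 C_def q_def using pos(1) by (simp add: field_simps power2_eq_square)
  have Urb: "(cos (\<phi> r - \<phi> s) - out_cos s r * in_cos s r) / dist_curve s r = - b"
    using b0 by (simp add: Ur_def w0_def b_def p_def q_def)
  have Vs: "(- cos (\<phi> r - \<phi> s) + out_cos s r * in_cos s r) / dist_curve s r = b"
    using arg_cong[OF Urb, of uminus] unfolding minus_divide_left by (simp add: algebra_simps)
  have out': "((\<lambda>w. out_cos (w $ 1) (w $ 2)) has_derivative (\<lambda>h. - A' * h $ 1 - b * h $ 2)) (at w0)"
    using out_cos_deriv[of w0] val(6) unfolding w0_def vector_2 Us Urb by simp
  have in': "((\<lambda>w. in_cos (w $ 1) (w $ 2)) has_derivative (\<lambda>h. b * h $ 1 + C * h $ 2)) (at w0)"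
    using in_cos_deriv[of w0] val(6) unfolding w0_def vector_2 Vr Vs by simp
  \<comment> \<open>\<open>g\<close> is known only to be continuous. \<open>G\<close> inverts (s, r)
    \<mapsto> (s, outgoing cosine), whose derivative is invertible because \<open>b > 0\<close>; a
    continuous inverse of such a map is differentiable.\<close>
  have "(G has_derivative (\<lambda>h :: real ^ 2. vector [h $ 1, - (h $ 2 + A' * h $ 1) / b])) (at z0)"
  proof (rule has_derivative_inverse_basic[where f = "\<lambda>w. vector [w $ 1, out_cos (w $ 1) (w $ 2)]"])
    show "((\<lambda>w. vector [w $ 1, out_cos (w $ 1) (w $ 2)] :: real ^ 2) has_derivative
      (\<lambda>h :: real ^ 2. vector [h $ 1, - A' * h $ 1 - b * h $ 2])) (at (G z0))"
      unfolding G0 by (rule has_derivative_vector2 bounded_linear_imp_has_derivative bounded_linear_vec_nth out')+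
    show "bounded_linear (\<lambda>h :: real ^ 2. vector [h $ 1, - (h $ 2 + A' * h $ 1) / b] :: real ^ 2)"
      by (intro linear_conv_bounded_linear[THEN iffD1] linearI)
         (auto simp: vec2_eq_iff divide_inverse algebra_simps)
    show "(\<lambda>h :: real ^ 2. vector [h $ 1, - (h $ 2 + A' * h $ 1) / b] :: real ^ 2) \<circ>
      (\<lambda>h :: real ^ 2. vector [h $ 1, - A' * h $ 1 - b * h $ 2] :: real ^ 2) = (id :: real ^ 2 \<Rightarrow> real ^ 2)"
      using \<open>b > 0\<close> by (auto simp: fun_eq_iff vec2_eq_iff)
    have "isCont g z0" using g(1) V by (simp add: continuous_on_eq_continuous_at)
    then show "isCont G z0"
      unfolding G_def isCont_def vec2_tendsto_iff by (auto intro!: tendsto_intros)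
    show "vector [G z $ 1, out_cos (G z $ 1) (G z $ 2)] = z" if "z \<in> V" for z
      using g(3)[OF that] by (simp add: G_def vec2_eq_iff)
  qed (use V in auto)
  moreover have "((\<lambda>w. vector [w $ 2, in_cos (w $ 1) (w $ 2)] :: real ^ 2) has_derivative
      (\<lambda>h :: real ^ 2. vector [h $ 2, b * h $ 1 + C * h $ 2])) (at (G z0))"
    unfolding G0 by (rule has_derivative_vector2 bounded_linear_imp_has_derivative bounded_linear_vec_nth in')+
  ultimately have "((\<lambda>z. vector [G z $ 2, in_cos (G z $ 1) (G z $ 2)] :: real ^ 2) has_derivative
      (\<lambda>h :: real ^ 2. vector [- (h $ 2 + A' * h $ 1) / b, b * h $ 1 + C * (- (h $ 2 + A' * h $ 1) / b)])) (at z0)"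
    by (auto dest: has_derivative_compose)
  moreover have "(\<lambda>h :: real ^ 2. vector [- (h $ 2 + A' * h $ 1) / b,
      b * h $ 1 + C * (- (h $ 2 + A' * h $ 1) / b)]) = (\<lambda>v. chord_matrix s r \<omega> d *v v)"
    unfolding cm mat2_vector by (intro ext) (simp add: vec2_eq_iff divide_inverse algebra_simps)
  ultimately have deriv: "((\<lambda>z. vector [G z $ 2, in_cos (G z $ 1) (G z $ 2)] :: real ^ 2) has_derivative
      (\<lambda>v. chord_matrix s r \<omega> d *v v)) (at z0)" by (simp only:)
  have "bounce \<gamma> z (vector [G z $ 2, in_cos (G z $ 1) (G z $ 2)])" if "z \<in> V" for z
  proof -
    have "z $ 1 \<in> A" using that V by (auto simp: U_def)
    then have "vector [z $ 1, g z] \<in> Q" using inQ[of "z $ 1" "g z"] g(4)[OF that] by auto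
    then have "bounce \<gamma> (vector [z $ 1, out_cos (z $ 1) (g z)]) (vector [g z, in_cos (z $ 1) (g z)])"
      using distinct[of "vector [z $ 1, g z]"] by (intro bounceI) auto
    moreover have "vector [z $ 1, out_cos (z $ 1) (g z)] = z"
      using g(3)[OF that] by (simp add: vec2_eq_iff)
    ultimately show ?thesis by (simp add: G_def)
  qed
  then have "\<forall>\<^sub>F z in nhds z0. bounce \<gamma> z (vector [G z $ 2, in_cos (G z $ 1) (G z $ 2)])"
    using V eventually_nhds by blast
  moreover have "vector [G z0 $ 2, in_cos (G z0 $ 1) (G z0 $ 2)] = (vector [r, cos (\<phi> r - \<omega>)] :: real ^ 2)"
    by (simp add: G0 w0_def val)
  ultimately show ?thesis
    unfolding linearized_step_def z0_def[symmetric] relpowp_1 using deriv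
    by (intro exI[of _ "\<lambda>z. vector [G z $ 2, in_cos (G z $ 1) (G z $ 2)]"] conjI)
qed

end

text \<open>The increasing parameters record that the orbit advances around the curve. If it closes
  after exactly one perimeter, an earlier return is impossible, which gives the minimal
  period.\<close>

definition forward_steps ::
    "(real \<Rightarrow> real \<times> real) \<Rightarrow> nat \<Rightarrow> real ^ 2 \<Rightarrow> real ^ 2 \<Rightarrow> real ^ 2 ^ 2 \<Rightarrow> bool" where
  "forward_steps \<gamma> n x y M \<longleftrightarrow> linearized_step \<gamma> n x y M \<and>
     (\<exists>z. z 0 = x \<and> z n = y \<and> (\<forall>i<n. bounce \<gamma> (z i) (z (Suc i)) \<and> z i $ 1 < z (Suc i) $ 1))"

lemma forward_steps_0: "forward_steps \<gamma> 0 x x (mat2 1 0 0 1)"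
  unfolding forward_steps_def using linearized_step_0 by auto

lemma forward_steps_compose:
  assumes "forward_steps \<gamma> n x y M" "forward_steps \<gamma> m y z N"
  shows "forward_steps \<gamma> (n + m) x z (N ** M)"
proof -
  obtain f where f: "f 0 = x" "f n = y" "\<And>i. i < n \<Longrightarrow> bounce \<gamma> (f i) (f (Suc i)) \<and> f i $ 1 < f (Suc i) $ 1"
    using assms(1) unfolding forward_steps_def by blast
  obtain g where g: "g 0 = y" "g m = z" "\<And>i. i < m \<Longrightarrow> bounce \<gamma> (g i) (g (Suc i)) \<and> g i $ 1 < g (Suc i) $ 1"
    using assms(2) unfolding forward_steps_def by blast
  define u where "u i = (if i \<le> n then f i else g (i - n))" for i
  have "bounce \<gamma> (u i) (u (Suc i)) \<and> u i $ 1 < u (Suc i) $ 1" if "i < n + m" for i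
  proof (cases i n rule: linorder_cases)
    case equal
    then show ?thesis using g(3)[of 0] g(1) f(2) that by (auto simp: u_def)
  next
    case greater
    then show ?thesis using g(3)[of "i - n"] that by (auto simp: u_def Suc_diff_le)
  qed (use f(3) in \<open>auto simp: u_def\<close>)
  moreover have "u 0 = x" "u (n + m) = z" using f(1,2) g(1,2) by (auto simp: u_def)
  ultimately show ?thesis
    using assms linearized_step_compose unfolding forward_steps_def by blast
qed

context convex_curve
begin

lemma chord_forward_steps:
  assumes "chord s r \<omega> d" "s < r"
  shows "forward_steps \<gamma> 1 (vector [s, cos (\<omega> - \<phi> s)]) (vector [r, cos (\<phi> r - \<omega>)])
    (chord_matrix s r \<omega> d)"
proof -
  note st = chord_linearized_step[OF assms(1)]
  let ?z = "\<lambda>i::nat. if i = 0 then vector [s, cos (\<omega> - \<phi> s)] else vector [r, cos (\<phi> r - \<omega>)] :: real ^ 2"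
  have "bounce \<gamma> (?z 0) (?z (Suc 0))" using linearized_step_bounce[OF st] by (simp add: eq_OO)
  then show ?thesis unfolding forward_steps_def using st assms(2) by (intro conjI exI[of _ ?z]) auto
qed

lemma same_state_iff:
  "same_state \<gamma> x y \<longleftrightarrow> (\<exists>n::int. x $ 1 = y $ 1 + of_int n * l) \<and> x $ 2 = y $ 2"
  by (simp add: same_state_def \<gamma>_eq_iff)

lemma same_state_tangent:
  assumes "same_state \<gamma> x y"
  shows "cos (\<phi> (x $ 1)) = cos (\<phi> (y $ 1))" "sin (\<phi> (x $ 1)) = sin (\<phi> (y $ 1))"
  using assms cos_sin_period_int by (auto simp: same_state_iff)

text \<open>The Birkhoff momentum fixes the direction up to the sign of its normal component; by
  convexity this component is nonnegative, hence the positive root.\<close>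

lemma bounce_direction:
  assumes "bounce \<gamma> x y"
  shows "sgn (\<gamma> (y $ 1) - \<gamma> (x $ 1)) =
    (x $ 2 * cos (\<phi> (x $ 1)) - sqrt (1 - (x $ 2)\<^sup>2) * sin (\<phi> (x $ 1)),
     x $ 2 * sin (\<phi> (x $ 1)) + sqrt (1 - (x $ 2)\<^sup>2) * cos (\<phi> (x $ 1)))"
proof -
  define q where "q = \<gamma> (y $ 1) - \<gamma> (x $ 1)"
  define e1 e2 where "e1 = fst (sgn q)" and "e2 = snd (sgn q)"
  define c s u where "c = cos (\<phi> (x $ 1))" and "s = sin (\<phi> (x $ 1))" and "u = x $ 2"
  have "q \<noteq> 0" and u: "u = e1 * c + e2 * s"
    using assms by (auto simp: bounce_def Let_def q_def e1_def e2_def c_def s_def u_def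
        vector_derivative_\<gamma> inner_prod_def)
  then have "norm (e1, e2) = 1" by (simp add: e1_def e2_def norm_sgn)
  then have e: "e1\<^sup>2 + e2\<^sup>2 = 1" by (simp add: norm_Pair)
  define w where "w = - s * e1 + c * e2"
  have cs: "c\<^sup>2 + s\<^sup>2 = 1" by (simp add: c_def s_def)
  have "w = height (x $ 1) (\<gamma> (y $ 1)) / norm q"
    by (simp add: w_def e1_def e2_def sgn_div_norm height_def q_def \<gamma>_def c_def s_def divide_inverse algebra_simps)
  then have "w \<ge> 0" using height_nonneg by simp
  moreover have "w\<^sup>2 = 1 - u\<^sup>2" unfolding w_def u using e cs by algebra
  ultimately have w: "sqrt (1 - u\<^sup>2) = w" by (metis real_sqrt_unique)
  have "e1 = u * c - w * s" "e2 = u * s + w * c" unfolding w_def u using cs by algebra+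
  then show ?thesis
    unfolding c_def[symmetric] s_def[symmetric] u_def[symmetric] w q_def[symmetric]
    by (simp add: e1_def e2_def prod_eq_iff)
qed

text \<open>Equal states have the same direction of flight. Of two end points on this ray neither
  precedes the other, since the open chord avoids the curve.\<close>

lemma bounce_unique:
  assumes "bounce \<gamma> x y" "bounce \<gamma> x' y'" "same_state \<gamma> x x'"
  shows "same_state \<gamma> y y'"
proof -
  define q p p' where "q = \<gamma> (x $ 1)" and "p = \<gamma> (y $ 1)" and "p' = \<gamma> (y' $ 1)"
  have q': "\<gamma> (x' $ 1) = q" using assms(3) by (simp add: same_state_def q_def)
  have sg: "sgn (p - q) = sgn (p' - q)"
    using bounce_direction[OF assms(1)] bounce_direction[OF assms(2)] same_state_tangent[OF assms(3)]
      assms(3) unfolding p_def p'_def q_def same_state_def by simp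
  have nz: "q \<noteq> p" "q \<noteq> p'" "open_segment q p \<subseteq> inside (range \<gamma>)" "open_segment q p' \<subseteq> inside (range \<gamma>)"
    using assms q' by (auto simp: bounce_def Let_def q_def p_def p'_def)
  have le: "\<not> norm (a - q) < norm (b - q)"
    if "a \<in> range \<gamma>" "q \<noteq> a" "q \<noteq> b" "sgn (a - q) = sgn (b - q)" "open_segment q b \<subseteq> inside (range \<gamma>)" for a b
  proof
    assume lt: "norm (a - q) < norm (b - q)"
    define t where "t = norm (a - q) / norm (b - q)"
    have "norm (b - q) > 0" "norm (a - q) > 0" using that by auto
    then have t: "0 < t" "t < 1" using lt by (auto simp: t_def)
    have "a - q = norm (a - q) *\<^sub>R sgn (a - q)" using \<open>norm (a - q) > 0\<close> by (simp add: sgn_div_norm)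
    then have "a - q = norm (a - q) *\<^sub>R sgn (b - q)" using that(4) by simp
    also have "\<dots> = t *\<^sub>R (b - q)" by (simp add: sgn_div_norm t_def divide_inverse)
    finally have "a = (1 - t) *\<^sub>R q + t *\<^sub>R b" by (simp add: algebra_simps)
    then have "a \<in> open_segment q b" using t \<open>q \<noteq> b\<close> by (auto simp: in_segment)
    then show False using that inside_no_overlap[of "range \<gamma>"] by blast
  qed
  have "norm (p - q) = norm (p' - q)"
    using le[of p p'] le[of p' p] nz sg by (force simp: p_def p'_def)
  moreover have "v = norm v *\<^sub>R sgn v" for v :: "real \<times> real"
    by (cases "v = 0") (auto simp: sgn_div_norm)
  ultimately have "p - q = p' - q" using sg by metis
  then have eq: "\<gamma> (y $ 1) = \<gamma> (y' $ 1)" by (simp add: p_def p'_def)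
  then obtain n :: int where "y $ 1 = y' $ 1 + of_int n * l" unfolding \<gamma>_eq_iff by blast
  then have "vector_derivative \<gamma> (at (y $ 1)) = vector_derivative \<gamma> (at (y' $ 1))"
    by (simp add: vector_derivative_\<gamma> cos_sin_period_int)
  then have "y $ 2 = y' $ 2"
    using assms(1,2) sg q' by (simp add: bounce_def Let_def p_def p'_def q_def)
  then show ?thesis using eq by (simp add: same_state_def)
qed

lemma relpowp_bounce_unique:
  "(bounce \<gamma> ^^ n) x y \<Longrightarrow> (bounce \<gamma> ^^ n) x y' \<Longrightarrow> same_state \<gamma> y y'"
proof (induction n arbitrary: y y')
  case 0
  then show ?case by (simp add: same_state_def)
next
  case (Suc n)
  then obtain w w' where w: "(bounce \<gamma> ^^ n) x w" "bounce \<gamma> w y" "(bounce \<gamma> ^^ n) x w'" "bounce \<gamma> w' y'"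
    by (auto elim!: relcomppE)
  then show ?case using bounce_unique Suc.IH by blast
qed

text \<open>The intermediate collision parameters lie strictly between \<open>x $ 1\<close> and
  \<open>x $ 1 + l\<close>, where the curve does not revisit the initial point. So \<open>n\<close>
  is the exact period and not a multiple of it.\<close>

lemma elliptic_orbitI:
  assumes "forward_steps \<gamma> n x y M" "n > 0" "y $ 1 = x $ 1 + l" "y $ 2 = x $ 2" "\<bar>trace M / 2\<bar> < 1"
  shows "has_elliptic_periodic_orbit (range \<gamma>)"
proof -
  obtain z where z: "z 0 = x" "z n = y"
    "\<And>i. i < n \<Longrightarrow> bounce \<gamma> (z i) (z (Suc i)) \<and> z i $ 1 < z (Suc i) $ 1"
    using assms(1) unfolding forward_steps_def by blast
  have st: "linearized_step \<gamma> n x y M" using assms(1) by (simp add: forward_steps_def)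
  have xy: "same_state \<gamma> x y"
    unfolding same_state_iff using assms by (intro conjI exI[of _ "-1"]) auto
  have pw: "(bounce \<gamma> ^^ i) x (z i)" if "i \<le> n" for i
    using that by (induction i) (use z in \<open>auto intro: relcomppI\<close>)
  have mono: "z i $ 1 < z j $ 1" if "i < j" "j \<le> n" for i j
    using that
  proof (induction j)
    case (Suc j)
    then show ?case using z(3)[of j] by (cases "i = j") (auto intro: less_trans)
  qed simp
  have "\<not> returns \<gamma> i x" if i: "0 < i" "i < n" for i
  proof
    assume "returns \<gamma> i x"
    then obtain w where w: "(bounce \<gamma> ^^ i) x w" "same_state \<gamma> x w" by (auto simp: returns_def)
    then have "same_state \<gamma> w (z i)" using pw i relpowp_bounce_unique by simp
    then have "\<gamma> (z i $ 1) = \<gamma> (x $ 1)" using w by (simp add: same_state_def)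
    moreover have "x $ 1 < z i $ 1" "z i $ 1 < x $ 1 + l"
      using mono[of 0 i] mono[of i n] i z assms by auto
    ultimately show False using \<gamma>_neq by blast
  qed
  moreover have "returns \<gamma> n x"
    unfolding returns_def using xy linearized_step_bounce[OF st] by blast
  ultimately have "periodic_point \<gamma> n x" using assms(2) by (simp add: periodic_point_def)
  moreover have "monodromy_matrix \<gamma> n x M"
    using st xy unfolding monodromy_matrix_def linearized_step_def by blast
  ultimately show ?thesis
    unfolding has_elliptic_periodic_orbit_def using arc_length_param_\<gamma> assms(5) by blast
qed

end

section \<open>The boundary of the stadium\<close>

lemma eq_of_deriv_eq:
  fixes f g :: "real \<Rightarrow> real"
  assumes "continuous_on {a..b} f" "continuous_on {a..b} g" "f a = g a" "a \<le> x" "x \<le> b"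
    and "\<And>x. \<lbrakk>a < x; x < b\<rbrakk> \<Longrightarrow> (f has_real_derivative D x) (at x)"
    and "\<And>x. \<lbrakk>a < x; x < b\<rbrakk> \<Longrightarrow> (g has_real_derivative D x) (at x)"
  shows "f x = g x"
proof (cases "a = x")
  case False
  have "continuous_on {a..x} (\<lambda>y. f y - g y)"
    using assms(1,2,5) by (intro continuous_on_diff) (auto elim: continuous_on_subset)
  moreover have "((\<lambda>y. f y - g y) has_real_derivative 0) (at y)" if "a < y" "y < x" for y
    using that assms(5) DERIV_diff[OF assms(6,7)[of y]] by simp
  ultimately have "f x - g x = f a - g a"
    using False assms(4) by (intro DERIV_isconst_end) auto
  then show ?thesis using assms(3) by simp
qed (use assms in auto)

lemma antiderivative_exists:
  fixes f :: "real \<Rightarrow> real"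
  assumes "continuous_on UNIV f"
  shows "\<exists>F. F 0 = 0 \<and> (\<forall>s. (F has_real_derivative f s) (at s))"
proof -
  have "\<exists>F. \<forall>x::real. -\<infinity> < ereal x \<longrightarrow> ereal x < \<infinity> \<longrightarrow> (F has_vector_derivative f x) (at x)"
    using assms by (intro einterval_antiderivative) (auto simp: continuous_on_eq_continuous_at)
  then obtain F where "\<And>x. (F has_real_derivative f x) (at x)"
    by (auto simp: has_real_derivative_iff_has_vector_derivative)
  then have "\<And>x. ((\<lambda>x. F x - F 0) has_real_derivative f x) (at x)"
    by (auto intro!: derivative_eq_intros)
  then show ?thesis by (intro exI[of _ "\<lambda>x. F x - F 0"]) auto
qed

text \<open>Unlike an integral over \<open>{0..s}\<close> it is meaningful for negative arguments,
  as needed for a curve parametrized by the whole line.\<close>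

definition antiderivative :: "(real \<Rightarrow> real) \<Rightarrow> real \<Rightarrow> real" where
  "antiderivative f = (SOME F. F 0 = 0 \<and> (\<forall>s. (F has_real_derivative f s) (at s)))"

lemma antiderivative:
  assumes "continuous_on UNIV f"
  shows "antiderivative f 0 = 0" "(antiderivative f has_real_derivative f s) (at s)"
  using someI_ex[OF antiderivative_exists[OF assms]] unfolding antiderivative_def by blast+

lemma integral_upper_deriv:
  fixes f :: "real \<Rightarrow> real"
  assumes "continuous_on {a..b} f" "a < x" "x < b"
  shows "((\<lambda>x. integral {a..x} f) has_real_derivative f x) (at x)"
    "((\<lambda>x. integral {x..b} f) has_real_derivative - f x) (at x)"
proof -
  have i: "f integrable_on {a..b}" using assms(1) by (rule integrable_continuous_real)
  have "((\<lambda>x. integral {a..x} f) has_real_derivative f x) (at x within {a..b})"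
    using assms by (intro integral_has_real_derivative) auto
  then show d: "((\<lambda>x. integral {a..x} f) has_real_derivative f x) (at x)"
    using assms(2,3) by (simp add: at_within_Icc_at)
  have "((\<lambda>x. integral {a..b} f - integral {a..x} f) has_real_derivative - f x) (at x)"
    using d by (auto intro!: derivative_eq_intros)
  moreover have "\<forall>\<^sub>F y in nhds x. integral {a..b} f - integral {a..y} f = integral {y..b} f"
  proof -
    have "\<forall>\<^sub>F y in nhds x. y \<in> {a<..<b}" using assms by (intro eventually_nhds_in_open) auto
    then show ?thesis
      by eventually_elim
         (use Henstock_Kurzweil_Integration.integral_combine[OF _ _ i] in \<open>smt (verit) greaterThanLessThan_iff\<close>)
  qed
  ultimately show "((\<lambda>x. integral {x..b} f) has_real_derivative - f x) (at x)"
    by (subst DERIV_cong_ev[OF refl, symmetric, rotated]) auto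
qed

lemma continuous_on_integral:
  fixes f :: "real \<Rightarrow> real"
  assumes "continuous_on {a..b} f"
  shows "continuous_on {a..b} (\<lambda>x. integral {a..x} f)" "continuous_on {a..b} (\<lambda>x. integral {x..b} f)"
  using indefinite_integral_continuous_1[OF integrable_continuous_real[OF assms]]
    indefinite_integral_continuous_1'[OF integrable_continuous_real[OF assms]] by auto

locale stadium =
  fixes \<rho> \<alpha> L :: real and h :: "real \<Rightarrow> real"
  assumes \<rho>_pos: "\<rho> > 0" and \<alpha>_pos: "\<alpha> > 0" and \<alpha>_less: "\<alpha> < pi / 2" and L_nonneg: "L \<ge> 0"
    and h_cont: "continuous_on {0..1} h"
    and h_nonneg: "\<And>\<zeta>. \<zeta> \<in> {0..1} \<Longrightarrow> h \<zeta> \<ge> 0"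
    and h0: "h 0 = 1" and h1: "h 1 = 0"
    and H_pos: "integral {0..1} h > 0"
begin

definition H :: real where "H = integral {0..1} h"
definition arc_len :: real where "arc_len = \<rho> * (pi / 2 - \<alpha>)"
definition seg_len :: real where "seg_len = \<rho> * \<alpha> / H"
text \<open>Half of the perimeter: the length from the right vertex to the left one.\<close>

definition P :: real where "P = 2 * (arc_len + seg_len) + L"

text \<open>The arc length parameter starts at the right vertex, so the table is symmetric in \<open>0\<close> and in
  \<open>P / 2\<close>; \<open>fold_param s\<close> is the distance from \<open>s\<close> to the nearest multiple of \<open>P\<close>.\<close>

definition fold_param :: "real \<Rightarrow> real" where
  "fold_param s = P / (2 * pi) * arccos (cos (2 * pi * s / P))"

text \<open>The clamped argument is 0 on the arc, \<zeta> on the smoothened segment and 1 on the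
  straight side. As h 0 = 1 and h 1 = 0, one formula gives the curvature of all pieces together with
  its continuity.\<close>

definition k :: "real \<Rightarrow> real" where
  "k s = h (max 0 (min 1 ((fold_param s - arc_len) / seg_len))) / \<rho>"

text \<open>The curvature is integrated from the right vertex, where the tangent is vertical. The
  formulas for arc, segment and side are recovered afterwards on one quarter and extended by
  symmetry.\<close>

definition \<phi> :: "real \<Rightarrow> real" where "\<phi> s = pi / 2 + antiderivative k s"
definition X :: "real \<Rightarrow> real" where
  "X s = arc_centre \<rho> h \<alpha> + \<rho> + antiderivative (\<lambda>s. cos (\<phi> s)) s"
definition Y :: "real \<Rightarrow> real" where "Y s = antiderivative (\<lambda>s. sin (\<phi> s)) s"

lemma basic_pos: "H > 0" "arc_len > 0" "seg_len > 0" "P > 0"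
proof -
  show "H > 0" using H_pos by (simp add: H_def)
  then show "arc_len > 0" "seg_len > 0" using \<rho>_pos \<alpha>_pos \<alpha>_less by (simp_all add: arc_len_def seg_len_def)
  then show "P > 0" using L_nonneg by (simp add: P_def)
qed

lemma P_half: "arc_len + seg_len \<le> P / 2" "P / 2 = arc_len + seg_len + L / 2"
  using L_nonneg by (auto simp: P_def)

lemma fold_param_eq: "0 \<le> s \<Longrightarrow> s \<le> P / 2 \<Longrightarrow> fold_param s = s"
  unfolding fold_param_def using basic_pos(4)
  by (subst arccos_cos) (auto simp: field_simps)

lemma fold_param_sym: "fold_param (- s) = fold_param s" "fold_param (P - s) = fold_param s"
proof -
  show "fold_param (- s) = fold_param s" by (simp add: fold_param_def)
  have "2 * pi * (P - s) / P = 2 * pi - 2 * pi * s / P" using basic_pos(4) by (simp add: field_simps)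
  then show "fold_param (P - s) = fold_param s" by (simp add: fold_param_def cos_diff)
qed

lemma k_cont: "continuous_on S k"
proof -
  have f: "continuous_on UNIV fold_param" unfolding fold_param_def using basic_pos(4)
    by (intro continuous_intros) auto
  have "continuous_on UNIV (\<lambda>s. h (max 0 (min 1 ((fold_param s - arc_len) / seg_len))))"
    using basic_pos by (intro continuous_on_compose2[OF h_cont] continuous_intros f) auto
  then show ?thesis unfolding k_def using \<rho>_pos
    by (intro continuous_on_divide continuous_intros) (auto elim: continuous_on_subset)
qed

lemma k_nonneg: "k s \<ge> 0"
  unfolding k_def using \<rho>_pos by (intro divide_nonneg_pos h_nonneg) auto

lemma k_arc: "0 \<le> s \<Longrightarrow> s \<le> arc_len \<Longrightarrow> k s = 1 / \<rho>"
proof -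
  assume s: "0 \<le> s" "s \<le> arc_len"
  then have "(fold_param s - arc_len) / seg_len \<le> 0"
    using P_half basic_pos by (simp add: fold_param_eq divide_nonpos_pos)
  then have "max 0 (min 1 ((fold_param s - arc_len) / seg_len)) = 0" by simp
  then show "k s = 1 / \<rho>" unfolding k_def h0[symmetric] by simp
qed

lemma k_seg: "0 \<le> \<zeta> \<Longrightarrow> \<zeta> \<le> 1 \<Longrightarrow> k (arc_len + seg_len * \<zeta>) = h \<zeta> / \<rho>"
proof -
  assume z: "0 \<le> \<zeta>" "\<zeta> \<le> 1"
  then have "seg_len * \<zeta> \<le> seg_len" "0 \<le> seg_len * \<zeta>"
    using basic_pos mult_left_mono[of \<zeta> 1 seg_len] by auto
  then have "fold_param (arc_len + seg_len * \<zeta>) = arc_len + seg_len * \<zeta>"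
    using P_half basic_pos by (intro fold_param_eq) linarith+
  then show ?thesis unfolding k_def using z basic_pos by simp
qed

lemma k_flat: "arc_len + seg_len \<le> s \<Longrightarrow> s \<le> P / 2 \<Longrightarrow> k s = 0"
proof -
  assume s: "arc_len + seg_len \<le> s" "s \<le> P / 2"
  then have "1 \<le> (fold_param s - arc_len) / seg_len"
    using P_half basic_pos by (simp add: fold_param_eq)
  then have "max 0 (min 1 ((fold_param s - arc_len) / seg_len)) = 1" by simp
  then show "k s = 0" unfolding k_def using h1 by simp
qed

lemma k_sym: "k (- s) = k s" "k (P - s) = k s"
  by (simp_all add: k_def fold_param_sym)

lemma \<phi>_deriv: "(\<phi> has_real_derivative k s) (at s)"
  unfolding \<phi>_def using antiderivative(2)[OF k_cont]
  by (auto intro!: derivative_eq_intros)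

lemma \<phi>_cont [continuous_intros]: "continuous_on S f \<Longrightarrow> continuous_on S (\<lambda>x. \<phi> (f x))"
  by (rule continuous_on_compose2[where t=UNIV])
     (auto intro!: continuous_at_imp_continuous_on DERIV_isCont \<phi>_deriv)

lemma X_deriv: "(X has_real_derivative cos (\<phi> s)) (at s)"
  unfolding X_def[abs_def]
  by (auto intro!: derivative_eq_intros antiderivative(2) continuous_intros)

lemma Y_deriv: "(Y has_real_derivative sin (\<phi> s)) (at s)"
  unfolding Y_def[abs_def]
  by (auto intro!: antiderivative(2) continuous_intros)

lemma XY_cont [continuous_intros]:
  "continuous_on S f \<Longrightarrow> continuous_on S (\<lambda>x. X (f x))"
  "continuous_on S f \<Longrightarrow> continuous_on S (\<lambda>x. Y (f x))"
  by (rule continuous_on_compose2[where t=UNIV];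
      auto intro!: continuous_at_imp_continuous_on DERIV_isCont X_deriv Y_deriv)+

lemma deriv_eqI:
  "k s = c \<Longrightarrow> (\<phi> has_real_derivative c) (at s)"
  "cos (\<phi> s) = c \<Longrightarrow> (X has_real_derivative c) (at s)"
  "sin (\<phi> s) = c \<Longrightarrow> (Y has_real_derivative c) (at s)"
  using \<phi>_deriv X_deriv Y_deriv by auto

lemmas derivs = DERIV_chain2[OF \<phi>_deriv] DERIV_chain2[OF X_deriv] DERIV_chain2[OF Y_deriv]

lemma start: "\<phi> 0 = pi / 2" "X 0 = arc_centre \<rho> h \<alpha> + \<rho>" "Y 0 = 0"
  by (simp add: \<phi>_def antiderivative(1)[OF k_cont])
     (simp_all add: X_def Y_def antiderivative(1) continuous_intros)

lemma const_of_deriv_zero: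
  assumes "\<And>s. (f has_real_derivative 0) (at s)"
  shows "f s = f (t :: real)"
  using DERIV_isconst_all assms by blast

section \<open>Symmetry in the x-axis\<close>

lemma \<phi>_reflect: "\<phi> (- s) = pi - \<phi> s"
proof -
  have "\<phi> (- s) + \<phi> s = \<phi> (- 0) + \<phi> 0"
    by (rule const_of_deriv_zero[where f = "\<lambda>s. \<phi> (- s) + \<phi> s"])
       (auto intro!: derivative_eq_intros derivs simp: k_sym)
  then show ?thesis by (simp add: start)
qed

lemma X_reflect: "X (- s) = X s"
proof -
  have "X (- s) - X s = X (- 0) - X 0"
    by (rule const_of_deriv_zero[where f = "\<lambda>s. X (- s) - X s"])
       (auto intro!: derivative_eq_intros derivs simp: \<phi>_reflect)
  then show ?thesis by simp
qed

lemma Y_reflect: "Y (- s) = - Y s"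
proof -
  have "Y (- s) + Y s = Y (- 0) + Y 0"
    by (rule const_of_deriv_zero[where f = "\<lambda>s. Y (- s) + Y s"])
       (auto intro!: derivative_eq_intros derivs simp: \<phi>_reflect)
  then show ?thesis by (simp add: start)
qed

section \<open>The quarter from the right vertex to the middle of the upper side\<close>

lemma \<phi>_arc: "0 \<le> s \<Longrightarrow> s \<le> arc_len \<Longrightarrow> \<phi> s = pi / 2 + s / \<rho>"
  by (rule eq_of_deriv_eq[where f = \<phi> and a = 0 and b = arc_len and D = k])
     (use \<rho>_pos in \<open>auto intro!: continuous_intros derivative_eq_intros deriv_eqI simp: k_arc start\<close>)

lemma X_arc: "0 \<le> s \<Longrightarrow> s \<le> arc_len \<Longrightarrow> X s = arc_centre \<rho> h \<alpha> + \<rho> * cos (s / \<rho>)"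
  by (rule eq_of_deriv_eq[where f = X and a = 0 and b = arc_len and D = "\<lambda>s. cos (\<phi> s)"])
     (use \<rho>_pos in \<open>auto intro!: continuous_intros derivative_eq_intros deriv_eqI simp: \<phi>_arc start cos_add\<close>)

lemma Y_arc: "0 \<le> s \<Longrightarrow> s \<le> arc_len \<Longrightarrow> Y s = \<rho> * sin (s / \<rho>)"
  by (rule eq_of_deriv_eq[where f = Y and a = 0 and b = arc_len and D = "\<lambda>s. sin (\<phi> s)"])
     (use \<rho>_pos in \<open>auto intro!: continuous_intros derivative_eq_intros deriv_eqI simp: \<phi>_arc start sin_add\<close>)

lemma arc_div: "arc_len / \<rho> = pi / 2 - \<alpha>"
  using \<rho>_pos by (simp add: arc_len_def)

lemma Theta_01: "Theta h 0 = 1" "Theta h 1 = 0"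
  using H_pos by (auto simp: Theta_def)

lemma Theta_cont: "continuous_on {0..1} (Theta h)"
  unfolding Theta_def using H_pos
  by (intro continuous_on_divide continuous_on_integral[OF h_cont] continuous_intros) auto

lemma Theta_deriv: "0 < \<zeta> \<Longrightarrow> \<zeta> < 1 \<Longrightarrow> (Theta h has_real_derivative - h \<zeta> / H) (at \<zeta>)"
  unfolding Theta_def[abs_def] H_def[symmetric]
  by (intro DERIV_cdivide integral_upper_deriv(2)[OF h_cont])

text \<open>In terms of \<zeta> the segment is run through at speed \<open>seg_len\<close>, so
  \<phi> grows at the rate \<open>seg_len\<close> times h / \<rho>, which is \<alpha> h / H; the arc
  ends with tangent angle pi - \<alpha>.\<close>

lemma \<phi>_seg: "0 \<le> \<zeta> \<Longrightarrow> \<zeta> \<le> 1 \<Longrightarrow> \<phi> (arc_len + seg_len * \<zeta>) = pi - \<alpha> * Theta h \<zeta>"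
proof (rule eq_of_deriv_eq[where f = "\<lambda>\<zeta>. \<phi> (arc_len + seg_len * \<zeta>)" and g = "\<lambda>\<zeta>. pi - \<alpha> * Theta h \<zeta>"
      and a = 0 and b = 1 and D = "\<lambda>\<zeta>. \<alpha> * h \<zeta> / H"])
  show "((\<lambda>x. \<phi> (arc_len + seg_len * x)) has_real_derivative \<alpha> * h x / H) (at x)" if "0 < x" "x < 1" for x
  proof -
    have "((\<lambda>x. \<phi> (arc_len + seg_len * x)) has_real_derivative k (arc_len + seg_len * x) * seg_len) (at x)"
      by (rule derivs) (auto intro!: derivative_eq_intros)
    then show ?thesis using that \<rho>_pos by (simp add: k_seg) (simp add: seg_len_def mult.commute)
  qed
  show "((\<lambda>x. pi - \<alpha> * Theta h x) has_real_derivative \<alpha> * h x / H) (at x)" if "0 < x" "x < 1" for x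
    using that by (auto intro!: derivative_eq_intros Theta_deriv)
qed (use basic_pos in \<open>auto intro!: continuous_intros Theta_cont simp: \<phi>_arc arc_div Theta_01\<close>)

lemma cos_sin_Theta_cont:
  "continuous_on {0..1} (\<lambda>\<xi>. cos (\<alpha> * Theta h \<xi>))" "continuous_on {0..1} (\<lambda>\<xi>. sin (\<alpha> * Theta h \<xi>))"
  by (intro continuous_intros Theta_cont)+

lemma X_seg: "0 \<le> \<zeta> \<Longrightarrow> \<zeta> \<le> 1 \<Longrightarrow> X (arc_len + seg_len * \<zeta>) = Gamma_x \<rho> h \<alpha> \<zeta>"
proof (rule eq_of_deriv_eq[where f = "\<lambda>\<zeta>. X (arc_len + seg_len * \<zeta>)" and g = "Gamma_x \<rho> h \<alpha>"
      and a = 0 and b = 1 and D = "\<lambda>\<zeta>. - seg_len * cos (\<alpha> * Theta h \<zeta>)"])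
  show "((\<lambda>x. X (arc_len + seg_len * x)) has_real_derivative - seg_len * cos (\<alpha> * Theta h x)) (at x)" if "0 < x" "x < 1" for x
  proof -
    have "((\<lambda>x. X (arc_len + seg_len * x)) has_real_derivative cos (\<phi> (arc_len + seg_len * x)) * seg_len) (at x)"
      by (rule derivs) (auto intro!: derivative_eq_intros)
    then show ?thesis
      unfolding \<phi>_seg[OF less_imp_le less_imp_le, OF that] by (simp add: mult.commute)
  qed
  show "(Gamma_x \<rho> h \<alpha> has_real_derivative - seg_len * cos (\<alpha> * Theta h x)) (at x)" if "0 < x" "x < 1" for x
    unfolding Gamma_x_def[abs_def] H_def[symmetric]
    by (rule DERIV_cong, (rule DERIV_cmult DERIV_cdivide integral_upper_deriv(2)[OF cos_sin_Theta_cont(1) that])+)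
       (simp add: seg_len_def)
  show "X (arc_len + seg_len * 0) = Gamma_x \<rho> h \<alpha> 0"
    using basic_pos by (simp add: X_arc arc_div arc_centre_def cos_diff)
  show "continuous_on {0..1} (Gamma_x \<rho> h \<alpha>)"
    unfolding Gamma_x_def[abs_def] using H_pos
    by (intro continuous_intros continuous_on_integral cos_sin_Theta_cont) auto
qed (auto intro!: continuous_intros)

lemma Y_seg: "0 \<le> \<zeta> \<Longrightarrow> \<zeta> \<le> 1 \<Longrightarrow> Y (arc_len + seg_len * \<zeta>) = Gamma_y \<rho> h \<alpha> \<zeta>"
proof (rule eq_of_deriv_eq[where f = "\<lambda>\<zeta>. Y (arc_len + seg_len * \<zeta>)" and g = "Gamma_y \<rho> h \<alpha>"
      and a = 0 and b = 1 and D = "\<lambda>\<zeta>. seg_len * sin (\<alpha> * Theta h \<zeta>)"])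
  show "((\<lambda>x. Y (arc_len + seg_len * x)) has_real_derivative seg_len * sin (\<alpha> * Theta h x)) (at x)" if "0 < x" "x < 1" for x
  proof -
    have "((\<lambda>x. Y (arc_len + seg_len * x)) has_real_derivative sin (\<phi> (arc_len + seg_len * x)) * seg_len) (at x)"
      by (rule derivs) (auto intro!: derivative_eq_intros)
    then show ?thesis
      unfolding \<phi>_seg[OF less_imp_le less_imp_le, OF that] by (simp add: mult.commute)
  qed
  show "(Gamma_y \<rho> h \<alpha> has_real_derivative seg_len * sin (\<alpha> * Theta h x)) (at x)" if "0 < x" "x < 1" for x
    unfolding Gamma_y_def[abs_def] H_def[symmetric]
    by (rule DERIV_cong, (rule DERIV_cmult DERIV_cdivide DERIV_add[OF DERIV_const]
          integral_upper_deriv(1)[OF cos_sin_Theta_cont(2) that])+) (simp add: seg_len_def)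
  show "Y (arc_len + seg_len * 0) = Gamma_y \<rho> h \<alpha> 0"
    using basic_pos by (simp add: Y_arc arc_div Gamma_y_def sin_diff)
  show "continuous_on {0..1} (Gamma_y \<rho> h \<alpha>)"
    unfolding Gamma_y_def[abs_def] using H_pos
    by (intro continuous_intros continuous_on_integral cos_sin_Theta_cont) auto
qed (auto intro!: continuous_intros)

lemma end_seg: "\<phi> (arc_len + seg_len) = pi" "X (arc_len + seg_len) = 0" "Y (arc_len + seg_len) = Gamma_y \<rho> h \<alpha> 1"
  using \<phi>_seg[of 1] X_seg[of 1] Y_seg[of 1] by (auto simp: Theta_01 Gamma_x_def)

lemma \<phi>_flat: "arc_len + seg_len \<le> s \<Longrightarrow> s \<le> P / 2 \<Longrightarrow> \<phi> s = pi"
  by (rule eq_of_deriv_eq[where f = \<phi> and a = "arc_len + seg_len" and b = "P / 2" and D = "k"])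
     (auto intro!: continuous_intros derivative_eq_intros deriv_eqI simp: k_flat end_seg)

lemma X_flat: "arc_len + seg_len \<le> s \<Longrightarrow> s \<le> P / 2 \<Longrightarrow> X s = arc_len + seg_len - s"
  by (rule eq_of_deriv_eq[where f = X and a = "arc_len + seg_len" and b = "P / 2" and D = "\<lambda>s. cos (\<phi> s)"])
     (auto intro!: continuous_intros derivative_eq_intros deriv_eqI simp: \<phi>_flat end_seg)

lemma Y_flat: "arc_len + seg_len \<le> s \<Longrightarrow> s \<le> P / 2 \<Longrightarrow> Y s = Gamma_y \<rho> h \<alpha> 1"
  by (rule eq_of_deriv_eq[where f = Y and a = "arc_len + seg_len" and b = "P / 2" and D = "\<lambda>s. sin (\<phi> s)"])
     (auto intro!: continuous_intros derivative_eq_intros deriv_eqI simp: \<phi>_flat end_seg)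

lemma half: "\<phi> (P / 2) = pi" "X (P / 2) = - L / 2"
proof -
  have "arc_len + seg_len - P / 2 = - L / 2" using P_half(2) by linarith
  then show "\<phi> (P / 2) = pi" "X (P / 2) = - L / 2"
    using \<phi>_flat[OF P_half(1)] X_flat[OF P_half(1)] by auto
qed

section \<open>Symmetry in the vertical axis, and the half turn\<close>

lemma \<phi>_mirror: "\<phi> (P - s) = 2 * pi - \<phi> s"
proof -
  have "\<phi> (P - s) + \<phi> s = \<phi> (P - P / 2) + \<phi> (P / 2)"
    by (rule const_of_deriv_zero[where f = "\<lambda>s. \<phi> (P - s) + \<phi> s"])
       (auto intro!: derivative_eq_intros derivs simp: k_sym)
  then show ?thesis by (simp add: half)
qed

lemma X_mirror: "X (P - s) = - L - X s"
proof -
  have "X (P - s) + X s = X (P - P / 2) + X (P / 2)"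
    by (rule const_of_deriv_zero[where f = "\<lambda>s. X (P - s) + X s"])
       (auto intro!: derivative_eq_intros derivs simp: \<phi>_mirror)
  then show ?thesis by (simp add: half)
qed

lemma Y_mirror: "Y (P - s) = Y s"
proof -
  have "Y (P - s) - Y s = Y (P - P / 2) - Y (P / 2)"
    by (rule const_of_deriv_zero[where f = "\<lambda>s. Y (P - s) - Y s"])
       (auto intro!: derivative_eq_intros derivs simp: \<phi>_mirror)
  then show ?thesis by simp
qed

text \<open>The two reflections compose to the half turn about the centre of the table. It yields
  the period 2 P and carries chords of the right component to the left one.\<close>

lemma rotate: "\<phi> (s + P) = \<phi> s + pi" "X (s + P) = - L - X s" "Y (s + P) = - Y s" "k (s + P) = k s"
  using \<phi>_mirror[of "- s"] X_mirror[of "- s"] Y_mirror[of "- s"] k_sym(2)[of "- s"]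
  by (simp_all add: \<phi>_reflect X_reflect Y_reflect k_sym add.commute)

sublocale convex_curve k \<phi> X Y "2 * P"
proof
  show "\<phi> (s + 2 * P) = \<phi> s + 2 * pi" "X (s + 2 * P) = X s" "Y (s + 2 * P) = Y s" for s
    using rotate[of s] rotate[of "s + P"] by (simp_all add: algebra_simps)
qed (use basic_pos k_cont k_nonneg \<phi>_deriv X_deriv Y_deriv in auto)

section \<open>The curve as a point set\<close>

abbreviation flip_x :: "real \<times> real \<Rightarrow> real \<times> real" where "flip_x \<equiv> \<lambda>(x, y). (- L - x, y)"
abbreviation flip_y :: "real \<times> real \<Rightarrow> real \<times> real" where "flip_y \<equiv> \<lambda>(x, y). (x, - y)"

lemma \<gamma>_reflect: "\<gamma> (- s) = flip_y (\<gamma> s)" "\<gamma> (P - s) = flip_x (\<gamma> s)"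
  by (simp_all add: \<gamma>_def X_reflect Y_reflect X_mirror Y_mirror)

lemma range_quarter:
  "range \<gamma> = (let Q = \<gamma> ` {0..P / 2} in Q \<union> flip_y ` Q \<union> flip_x ` (Q \<union> flip_y ` Q))"
    (is "_ = (let Q = ?Q in _)")
proof -
  have "\<gamma> s \<in> ?Q \<union> flip_x ` ?Q" if "0 \<le> s" "s \<le> P" for s
  proof (cases "s \<le> P / 2")
    case False
    then have "\<gamma> (P - s) \<in> ?Q" using that by (intro imageI) auto
    then have "flip_x (\<gamma> (P - s)) \<in> flip_x ` ?Q" by (rule imageI)
    then show ?thesis using \<gamma>_reflect(2)[of "P - s"] by simp
  qed (use that in auto)
  note 1 = this
  have "\<gamma> s \<in> (?Q \<union> flip_x ` ?Q) \<union> flip_y ` (?Q \<union> flip_x ` ?Q)" if "- P \<le> s" "s \<le> P" for s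
  proof (cases "0 \<le> s")
    case False
    then have "flip_y (\<gamma> (- s)) \<in> flip_y ` (?Q \<union> flip_x ` ?Q)" using 1[of "- s"] that by (intro imageI) auto
    then show ?thesis using \<gamma>_reflect(1)[of "- s"] by simp
  qed (use 1[of s] that in auto)
  then have sub: "range \<gamma> \<subseteq> (?Q \<union> flip_x ` ?Q) \<union> flip_y ` (?Q \<union> flip_x ` ?Q)"
    unfolding range_\<gamma>[of "- P"] by (intro image_subsetI) auto
  have comm: "flip_y ` flip_x ` A = flip_x ` flip_y ` A" for A :: "(real \<times> real) set"
    by (auto simp: image_image case_prod_unfold)
  have "flip_x p \<in> range \<gamma> \<and> flip_y p \<in> range \<gamma>" if "p \<in> range \<gamma>" for p
    using that \<gamma>_reflect[symmetric] by (elim rangeE) (simp only: rangeI)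
  then have flip: "flip_x ` A \<subseteq> range \<gamma>" "flip_y ` A \<subseteq> range \<gamma>" if "A \<subseteq> range \<gamma>" for A
    using that by blast+
  show ?thesis unfolding Let_def image_Un
  proof (rule equalityI)
    show "range \<gamma> \<subseteq> ?Q \<union> flip_y ` ?Q \<union> (flip_x ` ?Q \<union> flip_x ` flip_y ` ?Q)"
      using sub unfolding image_Un comm by (simp only: Un_ac)
    show "?Q \<union> flip_y ` ?Q \<union> (flip_x ` ?Q \<union> flip_x ` flip_y ` ?Q) \<subseteq> range \<gamma>"
      by (intro Un_least flip image_mono subset_UNIV)
  qed
qed

lemma circular_arc_eq: "circular_arc \<rho> h \<alpha> = \<gamma> ` {0..arc_len} \<union> flip_y ` \<gamma> ` {0..arc_len}"
proof -
  have eq: "\<gamma> s = (arc_centre \<rho> h \<alpha> + \<rho> * cos (s / \<rho>), \<rho> * sin (s / \<rho>))" if "0 \<le> s" "s \<le> arc_len" for s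
    using that by (simp add: \<gamma>_def X_arc Y_arc)
  have le: "\<bar>s / \<rho>\<bar> \<le> pi / 2 - \<alpha>" if "0 \<le> s" "s \<le> arc_len" for s
    using that divide_right_mono[OF that(2), of \<rho>] \<rho>_pos arc_div by simp
  show ?thesis
  proof (intro equalityI subsetI)
    fix p assume "p \<in> circular_arc \<rho> h \<alpha>"
    then obtain \<psi> where \<psi>: "p = (arc_centre \<rho> h \<alpha> + \<rho> * cos \<psi>, \<rho> * sin \<psi>)" "\<bar>\<psi>\<bar> \<le> pi / 2 - \<alpha>"
      unfolding circular_arc_def by blast
    have s: "0 \<le> \<rho> * \<bar>\<psi>\<bar>" "\<rho> * \<bar>\<psi>\<bar> \<le> arc_len" 
      using mult_left_mono[OF \<psi>(2), of \<rho>] \<rho>_pos by (simp_all add: arc_len_def)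
    have "\<gamma> (\<rho> * \<bar>\<psi>\<bar>) = (arc_centre \<rho> h \<alpha> + \<rho> * cos \<psi>, \<rho> * sin \<bar>\<psi>\<bar>)"
      using eq[OF s] \<rho>_pos by simp
    then have "p = \<gamma> (\<rho> * \<bar>\<psi>\<bar>) \<or> p = flip_y (\<gamma> (\<rho> * \<bar>\<psi>\<bar>))" using \<psi>(1) by (cases "\<psi> \<ge> 0") simp_all
    moreover have "\<gamma> (\<rho> * \<bar>\<psi>\<bar>) \<in> \<gamma> ` {0..arc_len}" using s by simp
    ultimately show "p \<in> \<gamma> ` {0..arc_len} \<union> flip_y ` \<gamma> ` {0..arc_len}"
      by (elim disjE) (simp_all only: UnI1 UnI2 imageI)
  next
    fix p assume "p \<in> \<gamma> ` {0..arc_len} \<union> flip_y ` \<gamma> ` {0..arc_len}"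
    then have "\<exists>s\<in>{0..arc_len}. p = \<gamma> s \<or> p = flip_y (\<gamma> s)" unfolding image_image by blast
    then obtain s where "s \<in> {0..arc_len}" and s3: "p = \<gamma> s \<or> p = flip_y (\<gamma> s)"
      by (rule bexE)
    then have s: "0 \<le> s" "s \<le> arc_len" by simp_all
    then have "\<exists>\<psi>. p = (arc_centre \<rho> h \<alpha> + \<rho> * cos \<psi>, \<rho> * sin \<psi>) \<and> \<bar>\<psi>\<bar> \<le> pi / 2 - \<alpha>"
    proof (cases "p = \<gamma> s")
      case True
      then show ?thesis using eq[OF s(1,2)] le[OF s(1,2)] by blast
    next
      case False
      then have "p = (arc_centre \<rho> h \<alpha> + \<rho> * cos (- (s / \<rho>)), \<rho> * sin (- (s / \<rho>)))"
        using eq[OF s(1,2)] s3 by simp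
      moreover have "\<bar>- (s / \<rho>)\<bar> \<le> pi / 2 - \<alpha>" using le[OF s(1,2)] by simp
      ultimately show ?thesis by blast
    qed
    then show "p \<in> circular_arc \<rho> h \<alpha>" unfolding circular_arc_def by blast
  qed
qed

lemma smoothened_segment_eq: "smoothened_segment \<rho> h \<alpha> = \<gamma> ` {arc_len..arc_len + seg_len}"
proof -
  have "(\<lambda>\<zeta>. arc_len + seg_len * \<zeta>) ` {0..1} = {arc_len..arc_len + seg_len}"
  proof (intro equalityI subsetI)
    fix s assume s: "s \<in> {arc_len..arc_len + seg_len}"
    then have "s = arc_len + seg_len * ((s - arc_len) / seg_len)" "(s - arc_len) / seg_len \<in> {0..1}"
      using basic_pos by (auto simp: field_simps)
    then show "s \<in> (\<lambda>\<zeta>. arc_len + seg_len * \<zeta>) ` {0..1}" by blast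
  qed (use basic_pos in \<open>auto simp: mult_le_cancel_left1\<close>)
  then have "\<gamma> ` {arc_len..arc_len + seg_len} = (\<lambda>\<zeta>. \<gamma> (arc_len + seg_len * \<zeta>)) ` {0..1}"
    by (metis image_image)
  also have "\<dots> = smoothened_segment \<rho> h \<alpha>"
    unfolding smoothened_segment_def by (intro image_cong) (auto simp: \<gamma>_def X_seg Y_seg)
  finally show ?thesis by simp
qed

lemma closed_segment_horizontal:
  "a \<le> b \<Longrightarrow> closed_segment (a, y) (b, y) = {a..b} \<times> {y :: real}" for a b :: real
proof -
  assume "a \<le> b"
  have "closed_segment (a, y) (b, y) = (\<lambda>x. (x, y)) ` closed_segment a b"
    unfolding closed_segment_def by (force simp: algebra_simps)
  also have "\<dots> = {a..b} \<times> {y}" using \<open>a \<le> b\<close> by (auto simp: closed_segment_eq_real_ivl)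
  finally show ?thesis .
qed

lemma flat_eq:
  "closed_segment (- L, Gamma_y \<rho> h \<alpha> 1) (0, Gamma_y \<rho> h \<alpha> 1) =
    \<gamma> ` {arc_len + seg_len..P / 2} \<union> flip_x ` \<gamma> ` {arc_len + seg_len..P / 2}"
proof -
  have eq: "\<gamma> ` {arc_len + seg_len..P / 2} = {- L / 2..0} \<times> {Gamma_y \<rho> h \<alpha> 1}"
  proof (intro equalityI subsetI)
    fix p assume "p \<in> {- L / 2..0} \<times> {Gamma_y \<rho> h \<alpha> 1}"
    then obtain x where x: "p = (x, Gamma_y \<rho> h \<alpha> 1)" "- L / 2 \<le> x" "x \<le> 0" by auto
    then have "p = \<gamma> (arc_len + seg_len - x)" "arc_len + seg_len - x \<in> {arc_len + seg_len..P / 2}"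
      using P_half by (auto simp: \<gamma>_def X_flat Y_flat)
    then show "p \<in> \<gamma> ` {arc_len + seg_len..P / 2}" by blast
  qed (use P_half in \<open>auto simp: \<gamma>_def X_flat Y_flat\<close>)
  have "flip_x ` ({- L / 2..0} \<times> {Gamma_y \<rho> h \<alpha> 1}) = {- L..- L / 2} \<times> {Gamma_y \<rho> h \<alpha> 1}"
  proof (intro equalityI subsetI)
    fix p assume "p \<in> {- L..- L / 2} \<times> {Gamma_y \<rho> h \<alpha> 1}"
    then obtain x where "p = (x, Gamma_y \<rho> h \<alpha> 1)" "- L \<le> x" "x \<le> - L / 2" by auto
    then have "p = flip_x (- L - x, Gamma_y \<rho> h \<alpha> 1)" "- L - x \<in> {- L / 2..0}" by auto
    then show "p \<in> flip_x ` ({- L / 2..0} \<times> {Gamma_y \<rho> h \<alpha> 1})" by blast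
  qed auto
  then show ?thesis unfolding eq using L_nonneg by (auto simp: closed_segment_horizontal)
qed

lemma flat_eq': "closed_segment (- L, - y) (0, - y) = flip_y ` closed_segment (- L, y) (0, y)"
  using L_nonneg by (auto simp: closed_segment_horizontal)

text \<open>Both sides are the images of one quarter, cut into arc, segment and half of the straight
  side, under the two reflections.\<close>

theorem range_\<gamma>_eq_stadium_boundary: "range \<gamma> = stadium_boundary \<rho> h \<alpha> L"
proof -
  have split: "\<gamma> ` {0..P / 2} = \<gamma> ` {0..arc_len} \<union> \<gamma> ` {arc_len..arc_len + seg_len} \<union> \<gamma> ` {arc_len + seg_len..P / 2}"
    unfolding image_Un[symmetric] using basic_pos P_half
    by (intro arg_cong[of _ _ "image \<gamma>"]) auto
  have comm: "flip_y ` flip_x ` A = flip_x ` flip_y ` A" for A :: "(real \<times> real) set"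
    by (auto simp: image_image case_prod_unfold)
  show ?thesis
    unfolding range_quarter Let_def split stadium_boundary_def curved_component_def circular_arc_eq
      smoothened_segment_eq flat_eq' flat_eq image_Un comm
    by (simp only: Un_ac)
qed

end

section \<open>Orbits along the curved components\<close>

text \<open>The factors are, from right to left, the chord to the arc, 2 n chords of the circle and
  the chord leaving the arc. \<open>A\<close> belongs to the end on the smoothened segment (sine
  \<open>D\<close>, curvature \<open>K\<close>), \<open>C\<close> to the end on the arc (sine
  \<open>S\<close>, curvature 1 / \<rho>), and \<open>d\<close> is the length of the two outer
  chords.\<close>

definition half_orbit_matrix :: "real \<Rightarrow> nat \<Rightarrow> real \<Rightarrow> real \<Rightarrow> real \<Rightarrow> real \<Rightarrow> real ^ 2 ^ 2" where
  "half_orbit_matrix \<rho> n S D d K =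
     (let A = D\<^sup>2 / d - K * D; C = S\<^sup>2 / d - S / \<rho>; b = S * D / d
      in mat2 (- C / b) (- 1 / b) (b - A * C / b) (- A / b) **
        (mat2 1 (- real (2 * n) * (2 * \<rho> / S)) 0 1 ** mat2 (- A / b) (- 1 / b) (b - A * C / b) (- C / b)))"

context stadium
begin

lemma arc_sym:
  assumes "\<bar>s\<bar> \<le> arc_len"
  shows "\<phi> s = pi / 2 + s / \<rho>" "X s = arc_centre \<rho> h \<alpha> + \<rho> * cos (s / \<rho>)" "Y s = \<rho> * sin (s / \<rho>)"
    "k s = 1 / \<rho>"
proof -
  have "\<phi> s = pi / 2 + s / \<rho> \<and> X s = arc_centre \<rho> h \<alpha> + \<rho> * cos (s / \<rho>) \<and> Y s = \<rho> * sin (s / \<rho>)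
    \<and> k s = 1 / \<rho>"
  proof (cases "s \<ge> 0")
    case True
    then show ?thesis using \<phi>_arc[of s] X_arc[of s] Y_arc[of s] k_arc[of s] assms by auto
  next
    case False
    then have "0 \<le> - s" "- s \<le> arc_len" using assms by auto
    then show ?thesis
      using \<phi>_arc[of "-s"] X_arc[of "-s"] Y_arc[of "-s"] k_arc[of "-s"]
        \<phi>_reflect[of s] X_reflect[of s] Y_reflect[of s] k_sym(1)[of s] by auto
  qed
  then show "\<phi> s = pi / 2 + s / \<rho>" "X s = arc_centre \<rho> h \<alpha> + \<rho> * cos (s / \<rho>)" "Y s = \<rho> * sin (s / \<rho>)"
    "k s = 1 / \<rho>" by auto
qed

lemma rotate_chord: "chord s r \<omega> d \<Longrightarrow> chord (s + P) (r + P) (\<omega> + pi) d"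
  by (simp add: chord_def rotate)

text \<open>The half turn preserves the angles at both ends, so a chord and its rotated copy have
  the same Birkhoff momenta and the same matrix; \<open>z\<close> selects the copy.\<close>

lemma chord_forward_steps_shift:
  assumes "chord s r \<omega> d" "s < r" "z \<in> {0, P}"
  shows "forward_steps \<gamma> 1 (vector [s + z, cos (\<omega> - \<phi> s)]) (vector [r + z, cos (\<phi> r - \<omega>)])
    (chord_matrix s r \<omega> d)"
proof (cases "z = 0")
  case False
  then have "z = P" using assms(3) by simp
  moreover have "chord_matrix (s + P) (r + P) (\<omega> + pi) d = chord_matrix s r \<omega> d"
    by (simp add: chord_matrix_def rotate)
  ultimately show ?thesis
    using chord_forward_steps[OF rotate_chord[OF assms(1)]] assms(2) by (simp add: rotate)
qed (use chord_forward_steps[OF assms(1,2)] in simp)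

text \<open>A central angle \<beta> gives the angle \<beta> / 2 with both tangents. Then A = C = - b
  in \<open>chord_matrix\<close>, so the linearization is a shear: on a circle the angle of
  incidence is conserved.\<close>

lemma circle_chord:
  assumes "0 < \<beta>" "\<beta> < 2 * pi" "\<bar>s\<bar> \<le> arc_len" "\<bar>s + \<rho> * \<beta>\<bar> \<le> arc_len"
  shows "chord s (s + \<rho> * \<beta>) (\<phi> s + \<beta> / 2) (2 * \<rho> * sin (\<beta> / 2))"
    "\<phi> (s + \<rho> * \<beta>) = \<phi> s + \<beta>"
    "chord_matrix s (s + \<rho> * \<beta>) (\<phi> s + \<beta> / 2) (2 * \<rho> * sin (\<beta> / 2)) = mat2 1 (- (2 * \<rho> / sin (\<beta> / 2))) 0 1"
proof -
  have S: "sin (\<beta> / 2) > 0" using assms by (intro sin_gt_zero) auto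
  have div: "(s + \<rho> * \<beta>) / \<rho> = s / \<rho> + \<beta>" using \<rho>_pos by (simp add: field_simps)
  show phi: "\<phi> (s + \<rho> * \<beta>) = \<phi> s + \<beta>"
    using arc_sym[OF assms(3)] arc_sym[OF assms(4)] div by simp
  define u v where "u = s / \<rho> + \<beta> / 2" and "v = \<beta> / 2"
  have uv: "s / \<rho> = u - v" "s / \<rho> + \<beta> = u + v" "\<phi> s + \<beta> / 2 = pi / 2 + u" "\<beta> / 2 = v"
    using arc_sym[OF assms(3)] by (auto simp: u_def v_def)
  have "X (s + \<rho> * \<beta>) - X s = 2 * \<rho> * sin (\<beta> / 2) * cos (\<phi> s + \<beta> / 2)"
    "Y (s + \<rho> * \<beta>) - Y s = 2 * \<rho> * sin (\<beta> / 2) * sin (\<phi> s + \<beta> / 2)"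
    unfolding arc_sym(2,3)[OF assms(3)] arc_sym(2,3)[OF assms(4)] div
    unfolding uv(3) unfolding uv(2) unfolding uv(1,4)
    by (simp_all add: cos_add sin_add cos_diff sin_diff algebra_simps)
  then show "chord s (s + \<rho> * \<beta>) (\<phi> s + \<beta> / 2) (2 * \<rho> * sin (\<beta> / 2))"
    unfolding chord_def phi using S \<rho>_pos by simp
  show "chord_matrix s (s + \<rho> * \<beta>) (\<phi> s + \<beta> / 2) (2 * \<rho> * sin (\<beta> / 2)) = mat2 1 (- (2 * \<rho> / sin (\<beta> / 2))) 0 1"
    unfolding chord_matrix_def Let_def phi arc_sym(4)[OF assms(3)] arc_sym(4)[OF assms(4)]
    using S \<rho>_pos by (simp add: vec_eq_iff forall_2 field_simps power2_eq_square)
qed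

lemma circle_forward_steps:
  assumes "0 < \<beta>" "\<beta> < 2 * pi" "- arc_len \<le> s" "s + real j * (\<rho> * \<beta>) \<le> arc_len" "z \<in> {0, P}"
  shows "forward_steps \<gamma> j (vector [s + z, cos (\<beta> / 2)]) (vector [s + real j * (\<rho> * \<beta>) + z, cos (\<beta> / 2)])
    (mat2 1 (- real j * (2 * \<rho> / sin (\<beta> / 2))) 0 1)"
  using assms(4)
proof (induction j)
  case 0
  then show ?case using forward_steps_0 by simp
next
  case (Suc j)
  define r where "r = s + real j * (\<rho> * \<beta>)"
  have rb: "\<rho> * \<beta> > 0" using \<rho>_pos assms by simp
  have Sr: "s + real (Suc j) * (\<rho> * \<beta>) = r + \<rho> * \<beta>" by (simp add: r_def algebra_simps)
  have "s \<le> r" "r \<le> arc_len" "r + \<rho> * \<beta> \<le> arc_len" using rb Suc.prems Sr by (auto simp: r_def)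
  then have r: "\<bar>r\<bar> \<le> arc_len" "\<bar>r + \<rho> * \<beta>\<bar> \<le> arc_len" using assms(3) rb by auto
  note c = circle_chord[OF assms(1,2) r]
  have "forward_steps \<gamma> 1 (vector [r + z, cos (\<beta> / 2)]) (vector [r + \<rho> * \<beta> + z, cos (\<beta> / 2)])
    (mat2 1 (- (2 * \<rho> / sin (\<beta> / 2))) 0 1)"
    using chord_forward_steps_shift[OF c(1) _ assms(5)] rb c(2,3) by simp
  moreover have "forward_steps \<gamma> j (vector [s + z, cos (\<beta> / 2)]) (vector [r + z, cos (\<beta> / 2)])
    (mat2 1 (- real j * (2 * \<rho> / sin (\<beta> / 2))) 0 1)"
    using Suc.IH \<open>r \<le> arc_len\<close> by (simp add: r_def)
  ultimately have "forward_steps \<gamma> (j + 1) (vector [s + z, cos (\<beta> / 2)]) (vector [r + \<rho> * \<beta> + z, cos (\<beta> / 2)])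
    (mat2 1 (- (2 * \<rho> / sin (\<beta> / 2))) 0 1 ** mat2 1 (- real j * (2 * \<rho> / sin (\<beta> / 2))) 0 1)"
    by (rule forward_steps_compose[rotated])
  moreover have "mat2 1 (- w) 0 1 ** mat2 1 (- real j * w) 0 1 = mat2 1 (- real (Suc j) * w) 0 1" for w
    unfolding mat2_mult by (simp add: algebra_simps)
  ultimately show ?case by (simp only: Sr Suc_eq_plus1[symmetric])
qed

text \<open>The reflection in the x-axis reverses the orientation of the curve, so the mirror image
  is a chord with its ends exchanged.\<close>

lemma reflect_chord:
  assumes "chord s r \<omega> d"
  shows "chord (- r) (- s) (pi - \<omega>) d"
  using assms by (simp add: chord_def X_reflect Y_reflect \<phi>_reflect)

text \<open>The bounces on the arc lie at the central angles j \<beta> with |j| \<le> n.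
  \<open>line\<close> says that the point at \<open>s\<close> lies on the line of the circle chord
  of central angle \<beta> that starts at n \<beta>: its normal angle is \<nu> \<beta>, its distance
  from the centre \<rho> cos (\<beta> / 2). That point need not lie on the circle, so the last chord
  has its own length \<open>d\<close>; the first chord is its mirror image.\<close>

lemma half_orbit:
  fixes n :: nat
  defines "\<nu> \<equiv> real n + 1 / 2"
  assumes \<beta>: "0 < \<beta>" "\<beta> < 2 * pi" and n: "real n * (\<rho> * \<beta>) \<le> arc_len" "real n * (\<rho> * \<beta>) < s"
    and line: "(X s - arc_centre \<rho> h \<alpha>) * cos (\<nu> * \<beta>) + Y s * sin (\<nu> * \<beta>) = \<rho> * cos (\<beta> / 2)"
    and d: "d = - (X s - arc_centre \<rho> h \<alpha> - \<rho> * cos (real n * \<beta>)) * sin (\<nu> * \<beta>)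
      + (Y s - \<rho> * sin (real n * \<beta>)) * cos (\<nu> * \<beta>)"
    and "d > 0" "sin (\<phi> s - pi / 2 - \<nu> * \<beta>) > 0" and z: "z \<in> {0, P}"
  shows "forward_steps \<gamma> (2 * n + 2) (vector [- s + z, cos (\<phi> s - pi / 2 - \<nu> * \<beta>)])
    (vector [s + z, cos (\<phi> s - pi / 2 - \<nu> * \<beta>)])
    (half_orbit_matrix \<rho> n (sin (\<beta> / 2)) (sin (\<phi> s - pi / 2 - \<nu> * \<beta>)) d (k s))"
proof -
  define r where "r = real n * (\<rho> * \<beta>)"
  define \<omega> where "\<omega> = pi / 2 + \<nu> * \<beta>"
  have S: "sin (\<beta> / 2) > 0" using \<beta> by (intro sin_gt_zero) auto
  have "0 \<le> r" using \<rho>_pos \<beta> by (simp add: r_def)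
  then have r: "\<bar>r\<bar> \<le> arc_len" using n by (simp add: r_def)
  have rdiv: "r / \<rho> = real n * \<beta>" using \<rho>_pos by (simp add: r_def)
  have angle: "\<omega> - \<phi> r = \<beta> / 2"
    unfolding arc_sym(1)[OF r] rdiv \<omega>_def \<nu>_def by (simp add: algebra_simps)
  define x y where "x = X s - X r" and "y = Y s - Y r"
  have x: "x = X s - arc_centre \<rho> h \<alpha> - \<rho> * cos (real n * \<beta>)" and y: "y = Y s - \<rho> * sin (real n * \<beta>)"
    unfolding x_def y_def arc_sym[OF r] rdiv by simp_all
  have "cos (real n * \<beta>) * cos (\<nu> * \<beta>) + sin (real n * \<beta>) * sin (\<nu> * \<beta>) = cos (\<nu> * \<beta> - real n * \<beta>)"
    by (simp add: cos_diff algebra_simps)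
  also have "\<nu> * \<beta> - real n * \<beta> = \<beta> / 2" by (simp add: \<nu>_def algebra_simps)
  finally have "x * cos (\<nu> * \<beta>) + y * sin (\<nu> * \<beta>) = 0"
    unfolding x y using line by (simp add: algebra_simps) (metis distrib_left mult.commute mult.left_commute)
  moreover have "d = - x * sin (\<nu> * \<beta>) + y * cos (\<nu> * \<beta>)" unfolding d x y ..
  ultimately have "x = - d * sin (\<nu> * \<beta>)" "y = d * cos (\<nu> * \<beta>)"
    using sin_cos_squared_add[of "\<nu> * \<beta>"] by algebra+
  then have ch: "chord r s \<omega> d"
    unfolding chord_def x_def[symmetric] y_def[symmetric] angle
    using \<open>d > 0\<close> S assms(9) by (simp add: \<omega>_def cos_add sin_add algebra_simps)
  have a2: "\<phi> s - \<omega> = \<phi> s - pi / 2 - \<nu> * \<beta>" by (simp add: \<omega>_def)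
  have st3: "forward_steps \<gamma> 1 (vector [r + z, cos (\<beta> / 2)])
      (vector [s + z, cos (\<phi> s - pi / 2 - \<nu> * \<beta>)]) (chord_matrix r s \<omega> d)"
    using chord_forward_steps_shift[OF ch _ z] n unfolding angle a2 by (simp add: r_def)
  have angles: "pi - \<omega> - \<phi> (- s) = \<phi> s - pi / 2 - \<nu> * \<beta>" "\<phi> (- r) - (pi - \<omega>) = \<beta> / 2"
    using angle a2 by (simp_all add: \<phi>_reflect)
  have st1: "forward_steps \<gamma> 1 (vector [- s + z, cos (\<phi> s - pi / 2 - \<nu> * \<beta>)])
      (vector [- r + z, cos (\<beta> / 2)]) (chord_matrix (- s) (- r) (pi - \<omega>) d)"
    using chord_forward_steps_shift[OF reflect_chord[OF ch] _ z] n unfolding angles by (simp add: r_def)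
  have st2: "forward_steps \<gamma> (2 * n) (vector [- r + z, cos (\<beta> / 2)]) (vector [r + z, cos (\<beta> / 2)])
      (mat2 1 (- real (2 * n) * (2 * \<rho> / sin (\<beta> / 2))) 0 1)"
  proof -
    have eq: "- r + real (2 * n) * (\<rho> * \<beta>) = r" by (simp add: r_def)
    show ?thesis
      by (rule circle_forward_steps[OF \<beta>, of "- r" "2 * n" z, unfolded eq]) (use r z in auto)
  qed
  have m3: "chord_matrix r s \<omega> d = (let S = sin (\<beta> / 2); D = sin (\<phi> s - pi / 2 - \<nu> * \<beta>);
      A = D\<^sup>2 / d - k s * D; C = S\<^sup>2 / d - S / \<rho>; b = S * D / d
      in mat2 (- C / b) (- 1 / b) (b - A * C / b) (- A / b))"
    unfolding chord_matrix_def Let_def angle a2 arc_sym(4)[OF r] by (simp add: mult.commute)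
  have m1: "chord_matrix (- s) (- r) (pi - \<omega>) d = (let S = sin (\<beta> / 2); D = sin (\<phi> s - pi / 2 - \<nu> * \<beta>);
      A = D\<^sup>2 / d - k s * D; C = S\<^sup>2 / d - S / \<rho>; b = S * D / d
      in mat2 (- A / b) (- 1 / b) (b - A * C / b) (- C / b))"
    unfolding chord_matrix_def Let_def angles k_sym arc_sym(4)[OF r] by (simp add: mult.commute)
  have "forward_steps \<gamma> (1 + 2 * n + 1) (vector [- s + z, cos (\<phi> s - pi / 2 - \<nu> * \<beta>)])
    (vector [s + z, cos (\<phi> s - pi / 2 - \<nu> * \<beta>)])
    (chord_matrix r s \<omega> d ** (mat2 1 (- real (2 * n) * (2 * \<rho> / sin (\<beta> / 2))) 0 1
      ** chord_matrix (- s) (- r) (pi - \<omega>) d))"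
    using forward_steps_compose[OF forward_steps_compose[OF st1 st2] st3] .
  then show ?thesis unfolding m1 m3 half_orbit_matrix_def Let_def by simp
qed

text \<open>Primed quantities belong to the left half of the orbit, carried to the right circle by
  the half turn; there it ends at the parameter P - s. \<open>reflection\<close> makes both halves
  meet the boundary at \<Gamma>(\<zeta>) under the angle pi / 2 - (\<nu> \<beta> + t). Joined, they
  lead from - s to (P - s) + P = - s + 2 P, one perimeter further.\<close>

theorem elliptic_of_reflection_law:
  fixes n :: nat and \<zeta> \<beta> \<beta>' :: real
  defines "\<nu> \<equiv> real n + 1 / 2" and "c \<equiv> arc_centre \<rho> h \<alpha>"
  defines "x \<equiv> Gamma_x \<rho> h \<alpha> \<zeta> - c" and "x' \<equiv> - L - Gamma_x \<rho> h \<alpha> \<zeta> - c"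
    and "y \<equiv> Gamma_y \<rho> h \<alpha> \<zeta>" and "t \<equiv> \<alpha> * Theta h \<zeta>"
  defines "d \<equiv> - (x - \<rho> * cos (real n * \<beta>)) * sin (\<nu> * \<beta>) + (y - \<rho> * sin (real n * \<beta>)) * cos (\<nu> * \<beta>)"
    and "d' \<equiv> - (x' - \<rho> * cos (real n * \<beta>')) * sin (\<nu> * \<beta>') + (y - \<rho> * sin (real n * \<beta>')) * cos (\<nu> * \<beta>')"
    and "D \<equiv> cos (\<nu> * \<beta> + t)"
  assumes \<zeta>: "0 \<le> \<zeta>" "\<zeta> \<le> 1"
    and line: "x * cos (\<nu> * \<beta>) + y * sin (\<nu> * \<beta>) = \<rho> * cos (\<beta> / 2)"
    and line': "x' * cos (\<nu> * \<beta>') + y * sin (\<nu> * \<beta>') = \<rho> * cos (\<beta>' / 2)"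
    and reflection: "\<nu> * \<beta>' = \<nu> * \<beta> + 2 * t"
    and \<beta>: "0 < \<beta>" "\<beta> < 2 * pi" "real n * \<beta> < pi / 2 - \<alpha>"
    and \<beta>': "0 < \<beta>'" "\<beta>' < 2 * pi" "real n * \<beta>' < pi / 2 - \<alpha>"
    and pos: "d > 0" "d' > 0" "D > 0"
    and tr: "\<bar>trace (half_orbit_matrix \<rho> n (sin (\<beta>' / 2)) D d' (h \<zeta> / \<rho>) **
      half_orbit_matrix \<rho> n (sin (\<beta> / 2)) D d (h \<zeta> / \<rho>)) / 2\<bar> < 1"
  shows "has_elliptic_periodic_orbit (stadium_boundary \<rho> h \<alpha> L)"
proof -
  define s where "s = arc_len + seg_len * \<zeta>"
  have s: "arc_len \<le> s" "s \<le> arc_len + seg_len"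
    using \<zeta> basic_pos mult_left_mono[of \<zeta> 1 seg_len] by (auto simp: s_def)
  have n: "real n * (\<rho> * \<beta>) < arc_len" "real n * (\<rho> * \<beta>') < arc_len"
    using mult_strict_left_mono[OF \<beta>(3) \<rho>_pos] mult_strict_left_mono[OF \<beta>'(3) \<rho>_pos]
    by (simp_all add: arc_len_def algebra_simps)
  have D1: "\<phi> s - pi / 2 - \<nu> * \<beta> = pi / 2 - (\<nu> * \<beta> + t)"
    unfolding s_def t_def \<phi>_seg[OF \<zeta>] by simp
  have D2: "\<phi> (P - s) - pi / 2 - \<nu> * \<beta>' = pi / 2 - (\<nu> * \<beta> + t)"
    unfolding s_def t_def \<phi>_mirror \<phi>_seg[OF \<zeta>] reflection by (simp add: t_def)
  have XY: "X s - c = x" "Y s = y" "X (P - s) - c = x'" "Y (P - s) = y"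
    unfolding s_def X_mirror Y_mirror x_def y_def x'_def X_seg[OF \<zeta>] Y_seg[OF \<zeta>] by simp_all
  have kh: "k s = h \<zeta> / \<rho>" "k (P - s) = h \<zeta> / \<rho>"
    unfolding s_def k_sym k_seg[OF \<zeta>] by simp_all
  define u where "u = cos (pi / 2 - (\<nu> * \<beta> + t))"
  have sD: "sin (pi / 2 - (\<nu> * \<beta> + t)) = D" unfolding D_def by (simp add: sin_diff)
  have right: "forward_steps \<gamma> (2 * n + 2) (vector [- s + 0, u]) (vector [s + 0, u])
    (half_orbit_matrix \<rho> n (sin (\<beta> / 2)) D d (h \<zeta> / \<rho>))"
    using half_orbit[of \<beta> n s d 0, folded \<nu>_def c_def, unfolded XY D1 kh sD, folded u_def]
      \<beta> n line pos s by (simp add: d_def)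
  have "real n * (\<rho> * \<beta>') < P - s" using n(2) s P_half basic_pos L_nonneg by linarith
  then have left: "forward_steps \<gamma> (2 * n + 2) (vector [- (P - s) + P, u]) (vector [(P - s) + P, u])
    (half_orbit_matrix \<rho> n (sin (\<beta>' / 2)) D d' (h \<zeta> / \<rho>))"
    using half_orbit[of \<beta>' n "P - s" d' P, folded \<nu>_def c_def, unfolded XY D2 kh sD, folded u_def]
      \<beta>' n line' pos by (simp add: d'_def)
  have "forward_steps \<gamma> ((2 * n + 2) + (2 * n + 2)) (vector [- s + 0, u]) (vector [(P - s) + P, u])
    (half_orbit_matrix \<rho> n (sin (\<beta>' / 2)) D d' (h \<zeta> / \<rho>) ** half_orbit_matrix \<rho> n (sin (\<beta> / 2)) D d (h \<zeta> / \<rho>))"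
    using left by (intro forward_steps_compose[OF right]) simp
  then show ?thesis
    unfolding range_\<gamma>_eq_stadium_boundary[symmetric]
    by (rule elliptic_orbitI) (use tr in auto)
qed

end

section \<open>Small angles\<close>

text \<open>The product is multiplied out but not simplified, so that its entries are polynomials in
  the five quantities whose limits are computed.\<close>

lemma half_orbit_matrix_eq:
  fixes S D d K \<rho> :: real and n :: nat
  defines "A \<equiv> D\<^sup>2 / d - K * D" and "C \<equiv> S\<^sup>2 / d - S / \<rho>" and "b \<equiv> S * D / d"
  defines "a \<equiv> - A / b" and "w \<equiv> 1 / b" and "r \<equiv> b - A * C / b" and "c \<equiv> - C / b"
    and "s \<equiv> - real (2 * n) * (2 * \<rho> / S)"
  shows "half_orbit_matrix \<rho> n S D d K =
    mat2 (c * (a + s * r) - w * r) (c * (- w + s * c) - w * c) (r * (a + s * r) + a * r) (r * (- w + s * c) + a * c)"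
proof -
  have "- 1 / b = - w" by (simp add: w_def)
  then show ?thesis
    unfolding half_orbit_matrix_def Let_def A_def[symmetric] C_def[symmetric] b_def[symmetric]
      a_def[symmetric] c_def[symmetric] r_def[symmetric] s_def[symmetric] mat2_mult
    by simp
qed

text \<open>The limit is \<open>4 e\<^sup>2 - 2\<close>, where \<open>2 e\<close> is the trace of the matrix of half an orbit.\<close>

lemma trace_tendsto:
  fixes S S' D d d' K :: "'a \<Rightarrow> real" and \<rho> \<sigma> g :: real and n :: nat
  assumes "\<rho> > 0" "\<sigma> > 0" "(S \<longlongrightarrow> \<sigma>) F" "(S' \<longlongrightarrow> \<sigma>) F" "(D \<longlongrightarrow> \<sigma>) F"
    "(d \<longlongrightarrow> 2 * \<rho> * \<sigma>) F" "(d' \<longlongrightarrow> 2 * \<rho> * \<sigma>) F" "(K \<longlongrightarrow> g / \<rho>) F"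
  shows "((\<lambda>x. trace (half_orbit_matrix \<rho> n (S' x) (D x) (d' x) (K x) **
      half_orbit_matrix \<rho> n (S x) (D x) (d x) (K x))) \<longlongrightarrow> 4 * (1 - 4 * (real n + 1) * (1 - g))\<^sup>2 - 2) F"
proof -
  define A where "A S D d K = D\<^sup>2 / d - K * D" for S D d K :: real
  define C where "C S D d K = S\<^sup>2 / d - S / \<rho>" for S D d K :: real
  define b where "b S D d K = S * D / d" for S D d K :: real
  define a where "a S D d K = - A S D d K / b S D d K" for S D d K
  define w where "w S D d K = 1 / b S D d K" for S D d K
  define r where "r S D d K = b S D d K - A S D d K * C S D d K / b S D d K" for S D d K
  define c where "c S D d K = - C S D d K / b S D d K" for S D d K
  define s where "s S D d K = - real (2 * n) * (2 * \<rho> / S)" for S D d K :: real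
  \<comment> \<open>All chords become sides of the regular polygon, and - \<omega> is the limit of
    the shear entry of one side.\<close>
  define \<omega> where "\<omega> = 2 * \<rho> / \<sigma>"
  have "\<omega> \<noteq> 0" using assms by (simp add: \<omega>_def)
  have lim: "((\<lambda>x. a (S x) (D x) (d x) (K x)) \<longlongrightarrow> 2 * g - 1) F"
    "((\<lambda>x. w (S x) (D x) (d x) (K x)) \<longlongrightarrow> \<omega>) F" "((\<lambda>x. r (S x) (D x) (d x) (K x)) \<longlongrightarrow> (2 - 2 * g) / \<omega>) F"
    "((\<lambda>x. c (S x) (D x) (d x) (K x)) \<longlongrightarrow> 1) F" "((\<lambda>x. s (S x) (D x) (d x) (K x)) \<longlongrightarrow> - 2 * real n * \<omega>) F"
    if "(S \<longlongrightarrow> \<sigma>) F" "(d \<longlongrightarrow> 2 * \<rho> * \<sigma>) F" for S d :: "'a \<Rightarrow> real"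
  proof -
    have dd: "2 * \<rho> * \<sigma> \<noteq> 0" using assms by simp
    have "((\<lambda>x. A (S x) (D x) (d x) (K x)) \<longlongrightarrow> \<sigma>\<^sup>2 / (2 * \<rho> * \<sigma>) - g / \<rho> * \<sigma>) F"
      "((\<lambda>x. C (S x) (D x) (d x) (K x)) \<longlongrightarrow> \<sigma>\<^sup>2 / (2 * \<rho> * \<sigma>) - \<sigma> / \<rho>) F"
      "((\<lambda>x. b (S x) (D x) (d x) (K x)) \<longlongrightarrow> \<sigma> * \<sigma> / (2 * \<rho> * \<sigma>)) F"
      unfolding A_def C_def b_def using assms(1)
      by (intro tendsto_diff tendsto_divide tendsto_mult tendsto_power tendsto_const that assms dd; simp)+
    moreover have "\<sigma>\<^sup>2 / (2 * \<rho> * \<sigma>) - g / \<rho> * \<sigma> = (1 - 2 * g) / \<omega>" "\<sigma>\<^sup>2 / (2 * \<rho> * \<sigma>) - \<sigma> / \<rho> = - 1 / \<omega>"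
      "\<sigma> * \<sigma> / (2 * \<rho> * \<sigma>) = 1 / \<omega>"
      using assms(1,2) by (simp_all add: \<omega>_def field_simps power2_eq_square)
    ultimately have ABC: "((\<lambda>x. A (S x) (D x) (d x) (K x)) \<longlongrightarrow> (1 - 2 * g) / \<omega>) F"
      "((\<lambda>x. C (S x) (D x) (d x) (K x)) \<longlongrightarrow> - 1 / \<omega>) F"
      "((\<lambda>x. b (S x) (D x) (d x) (K x)) \<longlongrightarrow> 1 / \<omega>) F" by simp_all
    have nz: "1 / \<omega> \<noteq> 0" using \<open>\<omega> \<noteq> 0\<close> by simp
    show "((\<lambda>x. a (S x) (D x) (d x) (K x)) \<longlongrightarrow> 2 * g - 1) F"
      unfolding a_def using \<open>\<omega> \<noteq> 0\<close>
      by (rule_tac tendsto_eq_rhs[OF tendsto_divide[OF tendsto_minus[OF ABC(1)] ABC(3) nz]]) (simp add: field_simps)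
    show "((\<lambda>x. w (S x) (D x) (d x) (K x)) \<longlongrightarrow> \<omega>) F"
      unfolding w_def using tendsto_divide[OF tendsto_const ABC(3) nz, of 1] by simp
    show "((\<lambda>x. r (S x) (D x) (d x) (K x)) \<longlongrightarrow> (2 - 2 * g) / \<omega>) F"
      unfolding r_def using \<open>\<omega> \<noteq> 0\<close>
      by (rule_tac tendsto_eq_rhs[OF tendsto_diff[OF ABC(3) tendsto_divide[OF tendsto_mult[OF ABC(1,2)] ABC(3) nz]]])
        (simp add: field_simps)
    show "((\<lambda>x. c (S x) (D x) (d x) (K x)) \<longlongrightarrow> 1) F"
      unfolding c_def using \<open>\<omega> \<noteq> 0\<close>
      by (rule_tac tendsto_eq_rhs[OF tendsto_divide[OF tendsto_minus[OF ABC(2)] ABC(3) nz]]) simp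
    have "((\<lambda>x. - real (2 * n) * (2 * \<rho> / S x)) \<longlongrightarrow> - real (2 * n) * (2 * \<rho> / \<sigma>)) F"
      using assms(2) by (intro tendsto_intros that) auto
    then show "((\<lambda>x. s (S x) (D x) (d x) (K x)) \<longlongrightarrow> - 2 * real n * \<omega>) F"
      unfolding s_def by (simp add: \<omega>_def)
  qed
  have eq: "half_orbit_matrix \<rho> n S D d K =
    mat2 (c S D d K * (a S D d K + s S D d K * r S D d K) - w S D d K * r S D d K)
      (c S D d K * (- w S D d K + s S D d K * c S D d K) - w S D d K * c S D d K)
      (r S D d K * (a S D d K + s S D d K * r S D d K) + a S D d K * r S D d K)
      (r S D d K * (- w S D d K + s S D d K * c S D d K) + a S D d K * c S D d K)" for S D d K
    unfolding half_orbit_matrix_eq A_def C_def b_def a_def w_def r_def c_def s_def by (rule refl)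
  \<comment> \<open>The limits of the four entries, kept in the shape in which the limit rules
    produce them.\<close>
  define e1 where "e1 = 1 * ((2 * g - 1) + (- 2 * real n * \<omega>) * ((2 - 2 * g) / \<omega>)) - \<omega> * ((2 - 2 * g) / \<omega>)"
  define e2 where "e2 = 1 * (- \<omega> + (- 2 * real n * \<omega>) * 1) - \<omega> * 1"
  define e3 where "e3 = (2 - 2 * g) / \<omega> * ((2 * g - 1) + (- 2 * real n * \<omega>) * ((2 - 2 * g) / \<omega>)) + (2 * g - 1) * ((2 - 2 * g) / \<omega>)"
  define e4 where "e4 = (2 - 2 * g) / \<omega> * (- \<omega> + (- 2 * real n * \<omega>) * 1) + (2 * g - 1) * 1"
  have "((\<lambda>x. trace (half_orbit_matrix \<rho> n (S' x) (D x) (d' x) (K x) **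
      half_orbit_matrix \<rho> n (S x) (D x) (d x) (K x))) \<longlongrightarrow> e1 * e1 + e2 * e3 + (e3 * e2 + e4 * e4)) F"
    unfolding eq mat2_mult trace_mat2 e1_def e2_def e3_def e4_def
    by (intro tendsto_intros lim assms)
  moreover have "e1 * e1 + e2 * e3 + (e3 * e2 + e4 * e4) = 4 * (1 - 4 * (real n + 1) * (1 - g))\<^sup>2 - 2"
  proof -
    define y q where "y = (2 - 2 * g) / \<omega>" and "q = 2 - 2 * g"
    have y: "\<omega> * y = q" using \<open>\<omega> \<noteq> 0\<close> by (simp add: y_def q_def)
    have g: "g = 1 - q / 2" by (simp add: q_def diff_divide_distrib)
    define e where "e = 1 - q - (2 * real n + 1) * q"
    have "e1 = 1 - q - (2 * real n + 1) * (\<omega> * y)" "e4 = 1 - q - (2 * real n + 1) * (\<omega> * y)"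
      unfolding e1_def e4_def y_def[symmetric] by (simp_all add: algebra_simps g)
    moreover have "e2 * e3 = - (2 * (1 + real n)) * (\<omega> * y) * (2 * (1 - q) - 2 * real n * (\<omega> * y))"
      unfolding e2_def e3_def y_def[symmetric] by (simp add: algebra_simps g)
    ultimately have "e1 = e" "e4 = e" "e2 * e3 = - (2 * (1 + real n)) * q * (2 * (1 - q) - 2 * real n * q)"
      by (simp_all only: y e_def)
    \<comment> \<open>This is the unit determinant of the limit matrix, whose diagonal entries are
      both \<open>e\<close>.\<close>
    moreover have "- (2 * (1 + real n)) * q * (2 * (1 - q) - 2 * real n * q) = e\<^sup>2 - 1"
      unfolding e_def by (simp add: power2_eq_square algebra_simps)
    moreover have "1 - 4 * (real n + 1) * (1 - g) = e" by (simp add: e_def g algebra_simps)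
    moreover have "e3 * e2 = e2 * e3" by simp
    ultimately show ?thesis by (simp add: power2_eq_square)
  qed
  ultimately show ?thesis by simp
qed

section \<open>Asymptotics of the smoothened segment for \<alpha> \<rightarrow> 0\<close>

locale profile =
  fixes \<rho> :: real and h :: "real \<Rightarrow> real"
  assumes \<rho>_pos: "\<rho> > 0"
    and h_cont: "continuous_on {0..1} h"
    and h_nonneg: "\<And>\<zeta>. \<zeta> \<in> {0..1} \<Longrightarrow> h \<zeta> \<ge> 0"
    and H_pos: "integral {0..1} h > 0"
begin

abbreviation H :: real where "H \<equiv> integral {0..1} h"

lemma Theta_cont: "continuous_on {0..1} (Theta h)"
  unfolding Theta_def using H_pos
  by (intro continuous_on_divide continuous_on_integral[OF h_cont] continuous_intros) auto

lemma Theta_bounds: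
  assumes "\<zeta> \<in> {0..1}"
  shows "0 \<le> Theta h \<zeta>" "Theta h \<zeta> \<le> 1"
proof -
  have i: "h integrable_on {0..1}" using h_cont by (rule integrable_continuous_real)
  have "integral {0..\<zeta>} h + integral {\<zeta>..1} h = H"
    by (rule Henstock_Kurzweil_Integration.integral_combine[OF _ _ i]) (use assms in auto)
  moreover have "integral {0..\<zeta>} h \<ge> 0"
    by (rule integral_nonneg[OF integrable_subinterval_real[OF i]]) (use assms h_nonneg in auto)
  moreover have "integral {\<zeta>..1} h \<ge> 0"
    by (rule integral_nonneg[OF integrable_subinterval_real[OF i]]) (use assms h_nonneg in auto)
  ultimately show "0 \<le> Theta h \<zeta>" "Theta h \<zeta> \<le> 1" using H_pos by (auto simp: Theta_def)
qed

text \<open>The integrand cos (\<alpha> \<Theta>) differs from 1 by at most \<alpha>, and the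
  integral carries a factor \<alpha>. The error is of second order uniformly in \<zeta>, so it
  vanishes even after division by \<alpha>.\<close>

lemma Gamma_x_bound:
  assumes "\<alpha> \<ge> 0" "\<zeta> \<in> {0..1}"
  shows "\<bar>Gamma_x \<rho> h \<alpha> \<zeta> - \<alpha> * (\<rho> * (1 - \<zeta>) / H)\<bar> \<le> \<alpha> * (\<rho> * \<alpha> / H)"
proof -
  have c: "continuous_on {\<zeta>..1} (\<lambda>\<xi>. cos (\<alpha> * Theta h \<xi>))"
    using assms by (intro continuous_intros continuous_on_subset[OF Theta_cont]) auto
  have "integral {\<zeta>..1} (\<lambda>\<xi>. cos (\<alpha> * Theta h \<xi>) - 1) = integral {\<zeta>..1} (\<lambda>\<xi>. cos (\<alpha> * Theta h \<xi>)) - (1 - \<zeta>)"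
    using assms by (subst Henstock_Kurzweil_Integration.integral_diff)
      (auto intro!: integrable_continuous_real c)
  moreover have "norm (integral {\<zeta>..1} (\<lambda>\<xi>. cos (\<alpha> * Theta h \<xi>) - 1)) \<le> \<alpha> * (1 - \<zeta>)"
  proof (rule integral_bound)
    fix \<xi> assume "\<xi> \<in> {\<zeta>..1}"
    then have \<xi>: "\<xi> \<in> {0..1}" using assms by auto
    have "1 - cos x \<le> \<bar>x\<bar>" for x :: real
    proof -
      have "1 - cos x = 2 * (\<bar>sin (x / 2)\<bar> * \<bar>sin (x / 2)\<bar>)"
        using cos_double_sin[of "x / 2"] by (simp add: power2_eq_square)
      also have "\<bar>sin (x / 2)\<bar> * \<bar>sin (x / 2)\<bar> \<le> \<bar>x / 2\<bar> * 1"
        by (intro mult_mono abs_sin_x_le_abs_x) auto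
      finally show ?thesis by simp
    qed
    from this[of "\<alpha> * Theta h \<xi>"] show "norm (cos (\<alpha> * Theta h \<xi>) - 1) \<le> \<alpha>"
      using Theta_bounds[OF \<xi>] assms mult_left_mono[of "Theta h \<xi>" 1 \<alpha>] by (simp add: abs_mult)
  qed (use assms in \<open>auto intro!: continuous_intros c\<close>)
  ultimately have i: "\<bar>integral {\<zeta>..1} (\<lambda>\<xi>. cos (\<alpha> * Theta h \<xi>)) - (1 - \<zeta>)\<bar> \<le> \<alpha>"
    using assms mult_left_mono[of "1 - \<zeta>" 1 \<alpha>] by simp
  have "Gamma_x \<rho> h \<alpha> \<zeta> - \<alpha> * (\<rho> * (1 - \<zeta>) / H)
    = \<rho> * \<alpha> / H * (integral {\<zeta>..1} (\<lambda>\<xi>. cos (\<alpha> * Theta h \<xi>)) - (1 - \<zeta>))"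
    by (simp add: Gamma_x_def divide_inverse algebra_simps)
  also have "\<bar>\<dots>\<bar> \<le> \<rho> * \<alpha> / H * \<alpha>"
    unfolding abs_mult using i assms \<rho>_pos H_pos by (intro mult_mono) auto
  finally show ?thesis by (simp add: algebra_simps)
qed

lemma Gamma_y_bound:
  assumes "\<alpha> \<ge> 0" "\<zeta> \<in> {0..1}"
  shows "\<bar>Gamma_y \<rho> h \<alpha> \<zeta> - \<rho> * cos \<alpha>\<bar> \<le> \<rho> * \<alpha> / H"
proof -
  have "norm (integral {0..\<zeta>} (\<lambda>\<xi>. sin (\<alpha> * Theta h \<xi>))) \<le> 1 * (\<zeta> - 0)"
    using assms by (intro integral_bound continuous_intros continuous_on_subset[OF Theta_cont]) auto
  then have "\<bar>integral {0..\<zeta>} (\<lambda>\<xi>. sin (\<alpha> * Theta h \<xi>))\<bar> \<le> 1" using assms by simp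
  then have "\<bar>\<rho> * \<alpha> / H * integral {0..\<zeta>} (\<lambda>\<xi>. sin (\<alpha> * Theta h \<xi>))\<bar> \<le> \<rho> * \<alpha> / H * 1"
    unfolding abs_mult using assms \<rho>_pos H_pos by (intro mult_mono) auto
  then show ?thesis by (simp add: Gamma_y_def algebra_simps)
qed

context
  fixes F :: "'a filter" and a z :: "'a \<Rightarrow> real"
  assumes a: "(a \<longlongrightarrow> 0) F" "\<forall>\<^sub>F x in F. a x > 0" and z: "\<forall>\<^sub>F x in F. z x \<in> {0..1}"
begin

text \<open>Here \<zeta> may vary along an arbitrary filter. This serves limits at fixed \<zeta>,
  limits for \<zeta> \<rightarrow> \<zeta>0 and statements uniform in \<zeta>.\<close>

lemma Gamma_x_quotient_tendsto:
  "((\<lambda>x. Gamma_x \<rho> h (a x) (z x) / a x - \<rho> * (1 - z x) / H) \<longlongrightarrow> 0) F"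
proof (rule Lim_null_comparison)
  show "\<forall>\<^sub>F x in F. norm (Gamma_x \<rho> h (a x) (z x) / a x - \<rho> * (1 - z x) / H) \<le> \<rho> * a x / H"
    using a(2) z
  proof eventually_elim
    case (elim x)
    have "Gamma_x \<rho> h (a x) (z x) / a x - \<rho> * (1 - z x) / H
      = (Gamma_x \<rho> h (a x) (z x) - a x * (\<rho> * (1 - z x) / H)) / a x"
      using elim by (simp add: diff_divide_distrib)
    also have "norm \<dots> = \<bar>Gamma_x \<rho> h (a x) (z x) - a x * (\<rho> * (1 - z x) / H)\<bar> / a x"
      using elim by (simp add: abs_divide)
    also have "\<dots> \<le> a x * (\<rho> * a x / H) / a x"
      using Gamma_x_bound[of "a x" "z x"] elim by (intro divide_right_mono) auto
    finally show ?case using elim by simp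
  qed
  show "((\<lambda>x. \<rho> * a x / H) \<longlongrightarrow> 0) F"
    using H_pos by (auto intro!: tendsto_eq_intros a)
qed

lemma Gamma_x_tendsto: "((\<lambda>x. Gamma_x \<rho> h (a x) (z x)) \<longlongrightarrow> 0) F"
proof (rule Lim_null_comparison)
  show "\<forall>\<^sub>F x in F. norm (Gamma_x \<rho> h (a x) (z x)) \<le> a x * (\<rho> / H) + a x * (\<rho> * a x / H)"
    using a(2) z
  proof eventually_elim
    case (elim x)
    have "\<bar>a x * (\<rho> * (1 - z x) / H)\<bar> \<le> a x * (\<rho> * 1 / H)"
      unfolding abs_mult abs_divide using elim \<rho>_pos H_pos
      by (intro mult_mono frac_le) (auto simp: mult_le_cancel_left1)
    then have "\<bar>a x * (\<rho> * (1 - z x) / H)\<bar> \<le> a x * (\<rho> / H)" by simp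
    moreover have "\<bar>Gamma_x \<rho> h (a x) (z x) - a x * (\<rho> * (1 - z x) / H)\<bar> \<le> a x * (\<rho> * a x / H)"
      using Gamma_x_bound elim by simp
    moreover have "\<bar>g\<bar> \<le> u + v" if "\<bar>b\<bar> \<le> u" "\<bar>g - b\<bar> \<le> v" for b g u v :: real
      using that by linarith
    ultimately show ?case unfolding real_norm_def by blast
  qed
  show "((\<lambda>x. a x * (\<rho> / H) + a x * (\<rho> * a x / H)) \<longlongrightarrow> 0) F"
    using H_pos by (auto intro!: tendsto_eq_intros a)
qed

lemma Gamma_y_tendsto: "((\<lambda>x. Gamma_y \<rho> h (a x) (z x)) \<longlongrightarrow> \<rho>) F"
proof -
  have "((\<lambda>x. Gamma_y \<rho> h (a x) (z x) - \<rho> * cos (a x)) \<longlongrightarrow> 0) F"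
  proof (rule Lim_null_comparison)
    show "\<forall>\<^sub>F x in F. norm (Gamma_y \<rho> h (a x) (z x) - \<rho> * cos (a x)) \<le> \<rho> * a x / H"
      using a(2) z by eventually_elim (use Gamma_y_bound in auto)
    show "((\<lambda>x. \<rho> * a x / H) \<longlongrightarrow> 0) F"
      using H_pos by (auto intro!: tendsto_eq_intros a)
  qed
  moreover have "((\<lambda>x. \<rho> * cos (a x)) \<longlongrightarrow> \<rho> * cos 0) F"
    by (intro tendsto_mult isCont_tendsto_compose[OF isCont_cos] tendsto_const a)
  ultimately have "((\<lambda>x. (Gamma_y \<rho> h (a x) (z x) - \<rho> * cos (a x)) + \<rho> * cos (a x)) \<longlongrightarrow> 0 + \<rho> * cos 0) F"
    by (rule tendsto_add)
  then show ?thesis by simp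
qed

lemma Theta_tendsto: "((\<lambda>x. a x * Theta h (z x)) \<longlongrightarrow> 0) F"
proof (rule Lim_null_comparison[OF _ a(1)])
  show "\<forall>\<^sub>F x in F. norm (a x * Theta h (z x)) \<le> a x"
    using a(2) z
  proof eventually_elim
    case (elim x)
    then show ?case
      using Theta_bounds[of "z x"] mult_left_mono[of "Theta h (z x)" 1 "a x"] by (simp add: abs_mult)
  qed
qed

end

lemma arc_centre_tendsto:
  assumes "(a \<longlongrightarrow> 0) F" "\<forall>\<^sub>F x in F. a x > 0"
  shows "((\<lambda>x. arc_centre \<rho> h (a x)) \<longlongrightarrow> 0) F"
proof -
  have "((\<lambda>x. Gamma_x \<rho> h (a x) 0 - \<rho> * sin (a x)) \<longlongrightarrow> 0 - \<rho> * sin 0) F"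
    by (intro tendsto_diff tendsto_mult isCont_tendsto_compose[OF isCont_sin] tendsto_const Gamma_x_tendsto assms) auto
  then show ?thesis by (simp add: arc_centre_def)
qed

lemma Gamma_cont:
  "continuous_on {0..1} (Gamma_x \<rho> h \<alpha>)" "continuous_on {0..1} (Gamma_y \<rho> h \<alpha>)"
  unfolding Gamma_x_def[abs_def] Gamma_y_def[abs_def] using H_pos
  by (intro continuous_intros continuous_on_integral Theta_cont; auto)+

end

lemma tendsto_cos_sin:
  assumes "(f \<longlongrightarrow> (x :: real)) F"
  shows "((\<lambda>y. cos (f y)) \<longlongrightarrow> cos x) F" "((\<lambda>y. sin (f y)) \<longlongrightarrow> sin x) F"
  using assms by (auto intro: isCont_tendsto_compose[OF isCont_cos] isCont_tendsto_compose[OF isCont_sin])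

text \<open>The base point \<open>u x\<close> moves along with the increment, so the addition
  theorems are used to reduce the quotient to derivatives at 0.\<close>

lemma sin_cos_difference_quotient:
  fixes u a :: "'a \<Rightarrow> real"
  assumes u: "(u \<longlongrightarrow> u0) F" and a: "filterlim a (at 0) F"
  shows "((\<lambda>x. (sin (u x + c * a x) - sin (u x)) / a x) \<longlongrightarrow> c * cos u0) F"
    "((\<lambda>x. (cos (u x + c * a x) - cos (u x)) / a x) \<longlongrightarrow> - c * sin u0) F"
proof -
  have "((\<lambda>y. sin (c * y)) has_real_derivative c) (at 0)" "((\<lambda>y. cos (c * y)) has_real_derivative 0) (at 0)"
    by (auto intro!: derivative_eq_intros)
  then have "((\<lambda>y. sin (c * y) / y) \<longlongrightarrow> c) (at 0)" "((\<lambda>y. (cos (c * y) - 1) / y) \<longlongrightarrow> 0) (at 0)"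
    by (simp_all add: DERIV_def)
  then have lim: "((\<lambda>x. sin (c * a x) / a x) \<longlongrightarrow> c) F" "((\<lambda>x. (cos (c * a x) - 1) / a x) \<longlongrightarrow> 0) F"
    using filterlim_compose[OF _ a] by blast+
  have "((\<lambda>x. sin (u x) * ((cos (c * a x) - 1) / a x) + cos (u x) * (sin (c * a x) / a x)) \<longlongrightarrow>
      sin u0 * 0 + cos u0 * c) F"
    "((\<lambda>x. cos (u x) * ((cos (c * a x) - 1) / a x) - sin (u x) * (sin (c * a x) / a x)) \<longlongrightarrow>
      cos u0 * 0 - sin u0 * c) F"
    by (intro tendsto_add tendsto_diff tendsto_mult tendsto_cos_sin lim u)+
  moreover have "(sin (u x + c * a x) - sin (u x)) / a x
      = sin (u x) * ((cos (c * a x) - 1) / a x) + cos (u x) * (sin (c * a x) / a x)"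
    "(cos (u x + c * a x) - cos (u x)) / a x
      = cos (u x) * ((cos (c * a x) - 1) / a x) - sin (u x) * (sin (c * a x) / a x)" for x
    by (simp_all add: sin_add cos_add divide_inverse algebra_simps)
  ultimately show "((\<lambda>x. (sin (u x + c * a x) - sin (u x)) / a x) \<longlongrightarrow> c * cos u0) F"
    "((\<lambda>x. (cos (u x + c * a x) - cos (u x)) / a x) \<longlongrightarrow> - c * sin u0) F"
    by (simp_all add: mult.commute)
qed

section \<open>The closing condition near the regular polygon\<close>

locale resonant_profile = profile +
  fixes n :: nat and \<zeta>0 :: real
  assumes h0: "h 0 = 1" and h1: "h 1 = 0"
    and \<zeta>0: "0 < \<zeta>0" "\<zeta>0 < 1"
    and h_lower: "(2 * real n + 1) / (2 * real n + 2) < h \<zeta>0" and h_upper: "h \<zeta>0 < 1"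
    and h_neq: "h \<zeta>0 \<noteq> (2 * real n + 3 / 2) / (2 * real n + 2)"
    and root: "integral {\<zeta>0..1} h = (2 * real n + 1) / (2 * real n + 2) * (1 - \<zeta>0)"
begin

text \<open>The limit polygon has 2 (2 n + 2) sides of central angle \<open>\<beta>0\<close>, and
  \<open>\<sigma>\<close> is the sine of their angle with the circle. The chord after the n-th
  bounce from the axis has its normal half a step further, at the angle \<nu> \<beta>.\<close>

definition \<nu> :: real where "\<nu> = real n + 1 / 2"
definition \<beta>0 :: real where "\<beta>0 = pi / (2 * real n + 2)"
definition \<sigma> :: real where "\<sigma> = sin (\<beta>0 / 2)"

lemma \<nu>_pos: "\<nu> > 0" by (simp add: \<nu>_def)

lemma \<beta>0_bounds: "0 < \<beta>0" "\<beta>0 \<le> pi / 2" "\<nu> * \<beta>0 = pi / 2 - \<beta>0 / 2" "real n * \<beta>0 = pi / 2 - \<beta>0"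
proof -
  show "0 < \<beta>0" by (auto simp: \<beta>0_def intro!: divide_pos_pos)
  have "2 * \<beta>0 \<le> (2 * real n + 2) * \<beta>0" using \<open>0 < \<beta>0\<close> by (intro mult_right_mono) auto
  moreover have m: "(2 * real n + 2) * \<beta>0 = pi" by (simp add: \<beta>0_def)
  ultimately show "\<beta>0 \<le> pi / 2" by linarith
  show "\<nu> * \<beta>0 = pi / 2 - \<beta>0 / 2" "real n * \<beta>0 = pi / 2 - \<beta>0"
    using m by (simp_all add: \<nu>_def algebra_simps)
qed

lemma \<sigma>_pos: "\<sigma> > 0"
  unfolding \<sigma>_def using \<beta>0_bounds pi_gt_zero by (intro sin_gt_zero) linarith+

lemma cos_sin_\<nu>\<beta>0: "cos (\<nu> * \<beta>0) = \<sigma>" "sin (\<nu> * \<beta>0) = cos (\<beta>0 / 2)"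
  unfolding \<beta>0_bounds(3) \<sigma>_def by (simp_all add: cos_diff sin_diff)

text \<open>\<open>line_defect q b\<close> vanishes if the line through \<open>q\<close> (relative to the centre of the circle) with
  normal angle \<open>\<nu> b\<close> cuts a chord of central angle \<open>b\<close> out of the circle.\<close>

definition line_defect :: "real \<times> real \<Rightarrow> real \<Rightarrow> real" where
  "line_defect q b = fst q * cos (\<nu> * b) + snd q * sin (\<nu> * b) - \<rho> * cos (b / 2)"

text \<open>At (0, \<rho>), the limit of the smoothened segment, the defect has derivative \<rho>
  \<sigma> (\<nu> + 1 / 2) > 0 in the angle, so nearby the angle is a continuous function of the
  base point. The neighbourhood is independent of \<alpha> and \<zeta>.\<close>

lemma chord_angle_exists:
  "\<exists>V B. open V \<and> (0, \<rho>) \<in> V \<and> continuous_on V B \<and> B (0, \<rho>) = \<beta>0 \<and> (\<forall>q\<in>V. line_defect q (B q) = 0)"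
proof -
  define g where "g q b = - fst q * \<nu> * sin (\<nu> * b) + snd q * \<nu> * cos (\<nu> * b) + \<rho> / 2 * sin (b / 2)"
    for q :: "real \<times> real" and b
  have "open {p. 0 < g (fst p) (snd p)}" unfolding g_def
    by (intro open_Collect_less continuous_intros) auto
  moreover have "((0, \<rho>), \<beta>0) \<in> {p. 0 < g (fst p) (snd p)}"
    using \<sigma>_pos \<rho>_pos \<nu>_pos by (simp add: g_def cos_sin_\<nu>\<beta>0 add_pos_pos flip: \<sigma>_def)
  ultimately obtain U W where U: "open U" "open W" "(0, \<rho>) \<in> U" "\<beta>0 \<in> W"
    "U \<times> W \<subseteq> {p. 0 < g (fst p) (snd p)}" by (rule open_prod_elim) blast
  obtain e where e: "e > 0" "cball \<beta>0 e \<subseteq> W" using U open_contains_cball by blast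
  have pos: "g q b > 0" if "q \<in> U" "\<beta>0 - e \<le> b" "b \<le> \<beta>0 + e" for q b
  proof -
    have "b \<in> W" using that e by (auto simp: dist_real_def subset_iff)
    then have "(q, b) \<in> U \<times> W" using that by simp
    then show ?thesis using U(5) by auto
  qed
  obtain V B where "open V" "(0, \<rho>) \<in> V" "V \<subseteq> U" "continuous_on V B" "B (0, \<rho>) = \<beta>0"
    "\<And>q. q \<in> V \<Longrightarrow> line_defect q (B q) = 0"
  proof (rule monotone_implicit_function[OF U(1,3) e(1), where F = line_defect and ?b0.0 = \<beta>0])
    show "line_defect (0, \<rho>) \<beta>0 = 0" by (simp add: line_defect_def cos_sin_\<nu>\<beta>0)
    show "continuous_on U (\<lambda>x. line_defect x b)" for b
      unfolding line_defect_def by (intro continuous_intros)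
    show "continuous_on {\<beta>0 - e..\<beta>0 + e} (line_defect x)" for x
      unfolding line_defect_def by (intro continuous_intros) auto
    show "line_defect x b < line_defect x b'"
      if "x \<in> U" "\<beta>0 - e \<le> b" "b < b'" "b' \<le> \<beta>0 + e" for x b b'
    proof (rule DERIV_pos_imp_increasing[OF that(3)])
      fix y assume "b \<le> y" "y \<le> b'"
      then have "g x y > 0" using that by (intro pos) auto
      moreover have "(line_defect x has_real_derivative g x y) (at y)"
        unfolding line_defect_def[abs_def] g_def by (auto intro!: derivative_eq_intros)
      ultimately show "\<exists>d. (line_defect x has_real_derivative d) (at y) \<and> 0 < d" by blast
    qed
  qed blast
  then show ?thesis by blast
qed

definition chord_data :: "(real \<times> real) set \<times> (real \<times> real \<Rightarrow> real)" where
  "chord_data = (SOME (V, B). open V \<and> (0, \<rho>) \<in> V \<and> continuous_on V B \<and> B (0, \<rho>) = \<beta>0 \<and>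
     (\<forall>q\<in>V. line_defect q (B q) = 0))"

definition chord_domain where "chord_domain = fst chord_data"
definition chord_angle where "chord_angle = snd chord_data"

lemma chord_angle: "open chord_domain" "(0, \<rho>) \<in> chord_domain" "continuous_on chord_domain chord_angle" "chord_angle (0, \<rho>) = \<beta>0"
  "q \<in> chord_domain \<Longrightarrow> line_defect q (chord_angle q) = 0"
proof -
  have "\<exists>p. case p of (V, B) \<Rightarrow> open V \<and> (0, \<rho>) \<in> V \<and> continuous_on V B \<and> B (0, \<rho>) = \<beta>0 \<and>
     (\<forall>q\<in>V. line_defect q (B q) = 0)" using chord_angle_exists by simp
  from someI_ex[OF this] show "open chord_domain" "(0, \<rho>) \<in> chord_domain" "continuous_on chord_domain chord_angle" "chord_angle (0, \<rho>) = \<beta>0"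
  "q \<in> chord_domain \<Longrightarrow> line_defect q (chord_angle q) = 0"
    by (auto simp: chord_domain_def chord_angle_def chord_data_def case_prod_unfold)
qed

definition base :: "real \<Rightarrow> real \<Rightarrow> real \<times> real" where
  "base \<alpha> \<zeta> = (Gamma_x \<rho> h \<alpha> \<zeta> - arc_centre \<rho> h \<alpha>, Gamma_y \<rho> h \<alpha> \<zeta>)"

definition \<beta> :: "real \<Rightarrow> real \<Rightarrow> real" where "\<beta> \<alpha> \<zeta> = chord_angle (base \<alpha> \<zeta>)"

definition \<beta>' :: "real \<Rightarrow> real \<Rightarrow> real" where "\<beta>' \<alpha> \<zeta> = \<beta> \<alpha> \<zeta> + 2 * (\<alpha> * Theta h \<zeta>) / \<nu>"

text \<open>If the orbit leaves \<open>\<Gamma> \<zeta>\<close> on the right with chord angle \<open>\<beta>\<close>, the reflection law forces \<open>\<beta>'\<close> on the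
  left; \<open>closing\<close> measures the failure of the chord on the left to fit the left circle.\<close>

definition closing :: "real \<Rightarrow> real \<Rightarrow> real \<Rightarrow> real" where
  "closing \<alpha> L \<zeta> = line_defect (- L - Gamma_x \<rho> h \<alpha> \<zeta> - arc_centre \<rho> h \<alpha>, Gamma_y \<rho> h \<alpha> \<zeta>) (\<beta>' \<alpha> \<zeta>)"

lemma \<nu>\<beta>': "\<nu> * \<beta>' \<alpha> \<zeta> = \<nu> * \<beta> \<alpha> \<zeta> + 2 * (\<alpha> * Theta h \<zeta>)"
  using \<nu>_pos by (simp add: \<beta>'_def field_simps)

context
  fixes F :: "'a filter" and a l z :: "'a \<Rightarrow> real"
  assumes a: "(a \<longlongrightarrow> 0) F" "\<forall>\<^sub>F x in F. a x > 0" and z: "\<forall>\<^sub>F x in F. z x \<in> {0..1}"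
begin

lemma base_tendsto: "((\<lambda>x. base (a x) (z x)) \<longlongrightarrow> (0, \<rho>)) F"
proof -
  have "((\<lambda>x. base (a x) (z x)) \<longlongrightarrow> (0 - 0, \<rho>)) F"
    unfolding base_def using a z
    by (intro tendsto_Pair tendsto_diff Gamma_x_tendsto Gamma_y_tendsto arc_centre_tendsto)
  then show ?thesis by simp
qed

lemma eventually_base_in_domain: "\<forall>\<^sub>F x in F. base (a x) (z x) \<in> chord_domain"
  using topological_tendstoD[OF base_tendsto chord_angle(1,2)] .

lemma \<beta>_tendsto: "((\<lambda>x. \<beta> (a x) (z x)) \<longlongrightarrow> \<beta>0) F"
proof -
  have "isCont chord_angle (0, \<rho>)"
    using chord_angle(1-3) by (simp add: continuous_on_eq_continuous_at)
  from isCont_tendsto_compose[OF this base_tendsto] show ?thesis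
    by (simp add: \<beta>_def chord_angle(4))
qed

lemma \<beta>'_tendsto: "((\<lambda>x. \<beta>' (a x) (z x)) \<longlongrightarrow> \<beta>0) F"
proof -
  have "((\<lambda>x. \<beta> (a x) (z x) + 2 * (a x * Theta h (z x)) / \<nu>) \<longlongrightarrow> \<beta>0 + 2 * 0 / \<nu>) F"
    using \<nu>_pos by (intro tendsto_add tendsto_divide tendsto_mult tendsto_const \<beta>_tendsto Theta_tendsto a z) auto
  then show ?thesis by (simp add: \<beta>'_def)
qed

end

text \<open>Every \<zeta> satisfies the condition to order zero, hence the division by \<alpha>.
  Subtracting the line equation on the right leaves three terms of first order: the displacement - L
  - 2 \<open>Gamma_x\<close> of the point, the turn of the normal by 2 \<theta> \<alpha> and the
  change of the half angle by \<theta> \<alpha> / \<nu>. The last two combine to the factor 1 + 1 /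
  (2 \<nu>) = (n + 1) / \<nu>.\<close>

lemma closing_quotient_tendsto:
  fixes F :: "'a filter" and a l :: "'a \<Rightarrow> real"
  assumes a: "(a \<longlongrightarrow> 0) F" "\<forall>\<^sub>F x in F. a x > 0" and l: "((\<lambda>x. l x / a x) \<longlongrightarrow> 0) F"
    and \<zeta>: "\<zeta> \<in> {0..1}"
  shows "((\<lambda>x. closing (a x) (l x) \<zeta> / a x) \<longlongrightarrow>
    2 * \<rho> * \<sigma> * (real n + 1) / (\<nu> * H) * (integral {\<zeta>..1} h - \<nu> / (real n + 1) * (1 - \<zeta>))) F"
proof -
  have z: "\<forall>\<^sub>F x in F. \<zeta> \<in> {0..1}" using \<zeta> by simp
  define \<theta> where "\<theta> = Theta h \<zeta>"
  define b where "b x = \<beta> (a x) \<zeta>" for x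
  have b: "(b \<longlongrightarrow> \<beta>0) F" unfolding b_def by (rule \<beta>_tendsto[OF a z])
  have a0: "filterlim a (at 0) F" using a by (auto simp: filterlim_at elim: eventually_mono)
  have nb: "((\<lambda>x. \<nu> * b x) \<longlongrightarrow> \<nu> * \<beta>0) F" "((\<lambda>x. b x / 2) \<longlongrightarrow> \<beta>0 / 2) F"
    by (intro tendsto_intros b; simp)+
  have gx: "((\<lambda>x. Gamma_x \<rho> h (a x) \<zeta> / a x) \<longlongrightarrow> \<rho> * (1 - \<zeta>) / H) F"
    using Gamma_x_quotient_tendsto[OF a z] by (simp add: LIM_zero_iff)
  have gx0: "((\<lambda>x. Gamma_x \<rho> h (a x) \<zeta> - arc_centre \<rho> h (a x)) \<longlongrightarrow> 0 - 0) F"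
    by (intro tendsto_diff Gamma_x_tendsto arc_centre_tendsto a z)
  have gy: "((\<lambda>x. Gamma_y \<rho> h (a x) \<zeta>) \<longlongrightarrow> \<rho>) F" by (rule Gamma_y_tendsto[OF a z])
  have at: "((\<lambda>x. 2 * \<theta> * a x) \<longlongrightarrow> 2 * \<theta> * 0) F" by (intro tendsto_intros a)
  have lim: "((\<lambda>x. (- (l x / a x) - 2 * (Gamma_x \<rho> h (a x) \<zeta> / a x)) * cos (\<nu> * b x + 2 * \<theta> * a x)
    + (Gamma_x \<rho> h (a x) \<zeta> - arc_centre \<rho> h (a x)) * ((cos (\<nu> * b x + 2 * \<theta> * a x) - cos (\<nu> * b x)) / a x)
    + Gamma_y \<rho> h (a x) \<zeta> * ((sin (\<nu> * b x + 2 * \<theta> * a x) - sin (\<nu> * b x)) / a x)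
    - \<rho> * ((cos (b x / 2 + \<theta> / \<nu> * a x) - cos (b x / 2)) / a x)) \<longlongrightarrow>
    (- 0 - 2 * (\<rho> * (1 - \<zeta>) / H)) * cos (\<nu> * \<beta>0 + 2 * \<theta> * 0)
    + (0 - 0) * (- (2 * \<theta>) * sin (\<nu> * \<beta>0)) + \<rho> * (2 * \<theta> * cos (\<nu> * \<beta>0))
    - \<rho> * (- (\<theta> / \<nu>) * sin (\<beta>0 / 2))) F"
    by (intro tendsto_add tendsto_diff tendsto_mult tendsto_minus tendsto_const tendsto_cos_sin
        sin_cos_difference_quotient a0 nb gx gx0 gy at l)
  have "\<forall>\<^sub>F x in F. closing (a x) (l x) \<zeta> / a x =
    (- (l x / a x) - 2 * (Gamma_x \<rho> h (a x) \<zeta> / a x)) * cos (\<nu> * b x + 2 * \<theta> * a x)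
    + (Gamma_x \<rho> h (a x) \<zeta> - arc_centre \<rho> h (a x)) * ((cos (\<nu> * b x + 2 * \<theta> * a x) - cos (\<nu> * b x)) / a x)
    + Gamma_y \<rho> h (a x) \<zeta> * ((sin (\<nu> * b x + 2 * \<theta> * a x) - sin (\<nu> * b x)) / a x)
    - \<rho> * ((cos (b x / 2 + \<theta> / \<nu> * a x) - cos (b x / 2)) / a x)"
    using eventually_base_in_domain[OF a z] a(2)
  proof eventually_elim
    case (elim x)
    \<comment> \<open>The chord on the right satisfies its line equation exactly; this turns the
      values on the left into differences.\<close>
    have zero: "(Gamma_x \<rho> h (a x) \<zeta> - arc_centre \<rho> h (a x)) * cos (\<nu> * b x) + Gamma_y \<rho> h (a x) \<zeta> * sin (\<nu> * b x)
      - \<rho> * cos (b x / 2) = 0"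
      using chord_angle(5)[OF elim(1)] by (simp add: line_defect_def base_def b_def \<beta>_def)
    have nb': "\<nu> * \<beta>' (a x) \<zeta> = \<nu> * b x + 2 * \<theta> * a x" "\<beta>' (a x) \<zeta> / 2 = b x / 2 + \<theta> / \<nu> * a x"
      unfolding \<nu>\<beta>' by (simp_all add: b_def \<theta>_def \<beta>'_def add_divide_distrib)
    define i where "i = 1 / a x"
    have div: "y / a x = y * i" for y by (simp add: i_def)
    show ?case
      unfolding closing_def line_defect_def nb' fst_conv snd_conv div using zero by algebra
  qed
  then have "((\<lambda>x. closing (a x) (l x) \<zeta> / a x) \<longlongrightarrow>
    (- 0 - 2 * (\<rho> * (1 - \<zeta>) / H)) * cos (\<nu> * \<beta>0 + 2 * \<theta> * 0)
    + (0 - 0) * (- (2 * \<theta>) * sin (\<nu> * \<beta>0)) + \<rho> * (2 * \<theta> * cos (\<nu> * \<beta>0))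
    - \<rho> * (- (\<theta> / \<nu>) * sin (\<beta>0 / 2))) F"
    by (subst tendsto_cong) (use lim in auto)
  moreover have "(- 0 - 2 * (\<rho> * (1 - \<zeta>) / H)) * cos (\<nu> * \<beta>0 + 2 * \<theta> * 0)
    + (0 - 0) * (- (2 * \<theta>) * sin (\<nu> * \<beta>0)) + \<rho> * (2 * \<theta> * cos (\<nu> * \<beta>0))
    - \<rho> * (- (\<theta> / \<nu>) * sin (\<beta>0 / 2)) =
    2 * \<rho> * \<sigma> * (real n + 1) / (\<nu> * H) * (integral {\<zeta>..1} h - \<nu> / (real n + 1) * (1 - \<zeta>))"
  proof -
    define v i w where "v = 1 / \<nu>" and "i = 1 / H" and "w = \<nu> / (real n + 1)"
    have vw: "\<nu> * v = 1" "(real n + 1) * w = \<nu>" "2 * \<nu> = 2 * real n + 1"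
      using \<nu>_pos by (simp_all add: v_def w_def \<nu>_def)
    have div: "x / \<nu> = x * v" "x / H = x * i" "x / (\<nu> * H) = x * (v * i)" for x
      by (simp_all add: v_def i_def)
    show ?thesis
      unfolding cos_sin_\<nu>\<beta>0 mult_zero_right add_0_right \<sigma>_def[symmetric] \<theta>_def Theta_def
        w_def[symmetric] div using vw by algebra
  qed
  ultimately show ?thesis by simp
qed

text \<open>Every quantity tends to its value for the regular polygon, where all side conditions are
  strict, so they hold eventually. \<open>z\<close> is only required to approach
  \<open>\<zeta>0\<close>, because the actual root depends on \<alpha> and L.\<close>

lemma eventually_elliptic:
  fixes F :: "'a filter" and a l z :: "'a \<Rightarrow> real"
  assumes a: "(a \<longlongrightarrow> 0) F" "\<forall>\<^sub>F x in F. a x > 0" and l: "\<forall>\<^sub>F x in F. l x \<ge> 0" "(l \<longlongrightarrow> 0) F"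
    and z: "(z \<longlongrightarrow> \<zeta>0) F"
  shows "\<forall>\<^sub>F x in F. closing (a x) (l x) (z x) = 0 \<longrightarrow>
    has_elliptic_periodic_orbit (stadium_boundary \<rho> h (a x) (l x))"
proof -
  have "\<forall>\<^sub>F x in F. z x \<in> {0<..<1}" using topological_tendstoD[OF z, of "{0<..<1}"] \<zeta>0 by simp
  then have z01: "\<forall>\<^sub>F x in F. z x \<in> {0..1}" by eventually_elim auto
  define b b' t where "b x = \<beta> (a x) (z x)" and "b' x = \<beta>' (a x) (z x)" and "t x = a x * Theta h (z x)" for x
  have b: "(b \<longlongrightarrow> \<beta>0) F" "(b' \<longlongrightarrow> \<beta>0) F"
    unfolding b_def b'_def by (rule \<beta>_tendsto[OF a z01] \<beta>'_tendsto[OF a z01])+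
  have t: "(t \<longlongrightarrow> 0) F" unfolding t_def by (rule Theta_tendsto[OF a z01])
  define gx gy c where "gx x = Gamma_x \<rho> h (a x) (z x)" and "gy x = Gamma_y \<rho> h (a x) (z x)"
    and "c x = arc_centre \<rho> h (a x)" for x
  have g: "(gx \<longlongrightarrow> 0) F" "(gy \<longlongrightarrow> \<rho>) F" "(c \<longlongrightarrow> 0) F"
    unfolding gx_def gy_def c_def
    by (rule Gamma_x_tendsto[OF a z01] Gamma_y_tendsto[OF a z01] arc_centre_tendsto[OF a])+
  define d where "d x = - (gx x - c x - \<rho> * cos (real n * b x)) * sin (\<nu> * b x)
    + (gy x - \<rho> * sin (real n * b x)) * cos (\<nu> * b x)" for x
  define d' where "d' x = - (- l x - gx x - c x - \<rho> * cos (real n * b' x)) * sin (\<nu> * b' x)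
    + (gy x - \<rho> * sin (real n * b' x)) * cos (\<nu> * b' x)" for x
  define D where "D x = cos (\<nu> * b x + t x)" for x
  have d0: "- (0 - \<rho> * cos (real n * \<beta>0)) * sin (\<nu> * \<beta>0) + (\<rho> - \<rho> * sin (real n * \<beta>0)) * cos (\<nu> * \<beta>0)
    = 2 * \<rho> * \<sigma>"
  proof -
    have "sin (\<nu> * \<beta>0) * cos (real n * \<beta>0) - cos (\<nu> * \<beta>0) * sin (real n * \<beta>0) = sin (\<nu> * \<beta>0 - real n * \<beta>0)"
      by (simp add: sin_diff)
    also have "\<nu> * \<beta>0 - real n * \<beta>0 = \<beta>0 / 2" by (simp add: \<nu>_def algebra_simps)
    finally have "sin (\<nu> * \<beta>0) * cos (real n * \<beta>0) - \<sigma> * sin (real n * \<beta>0) = \<sigma>"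
      by (simp add: \<sigma>_def cos_sin_\<nu>\<beta>0)
    moreover have "- (0 - \<rho> * cos (real n * \<beta>0)) * sin (\<nu> * \<beta>0) + (\<rho> - \<rho> * sin (real n * \<beta>0)) * \<sigma>
      = \<rho> * (sin (\<nu> * \<beta>0) * cos (real n * \<beta>0) - \<sigma> * sin (real n * \<beta>0)) + \<rho> * \<sigma>"
      by (simp add: algebra_simps)
    ultimately show ?thesis unfolding cos_sin_\<nu>\<beta>0(1) by simp
  qed
  have "(d \<longlongrightarrow> - (0 - 0 - \<rho> * cos (real n * \<beta>0)) * sin (\<nu> * \<beta>0) + (\<rho> - \<rho> * sin (real n * \<beta>0)) * cos (\<nu> * \<beta>0)) F"
    "(d' \<longlongrightarrow> - (- 0 - 0 - 0 - \<rho> * cos (real n * \<beta>0)) * sin (\<nu> * \<beta>0) + (\<rho> - \<rho> * sin (real n * \<beta>0)) * cos (\<nu> * \<beta>0)) F"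
    unfolding d_def d'_def
    by (intro tendsto_add tendsto_diff tendsto_mult tendsto_minus tendsto_const tendsto_cos_sin b g l)+
  then have d: "(d \<longlongrightarrow> 2 * \<rho> * \<sigma>) F" "(d' \<longlongrightarrow> 2 * \<rho> * \<sigma>) F" using d0 by simp_all
  have "(D \<longlongrightarrow> cos (\<nu> * \<beta>0 + 0)) F" unfolding D_def
    by (intro tendsto_add tendsto_mult tendsto_const tendsto_cos_sin b t)
  then have D: "(D \<longlongrightarrow> \<sigma>) F" by (simp add: cos_sin_\<nu>\<beta>0)
  have S: "((\<lambda>x. sin (b x / 2)) \<longlongrightarrow> \<sigma>) F" "((\<lambda>x. sin (b' x / 2)) \<longlongrightarrow> \<sigma>) F"
    unfolding \<sigma>_def by (intro tendsto_divide tendsto_const tendsto_cos_sin b; simp)+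
  have "isCont h \<zeta>0" using continuous_on_interior[OF h_cont] \<zeta>0 by simp
  from isCont_tendsto_compose[OF this z]
  have K: "((\<lambda>x. h (z x) / \<rho>) \<longlongrightarrow> h \<zeta>0 / \<rho>) F" using \<rho>_pos by (intro tendsto_intros) auto
  define e where "e = 1 - 4 * (real n + 1) * (1 - h \<zeta>0)"
  have "((\<lambda>x. \<bar>trace (half_orbit_matrix \<rho> n (sin (b' x / 2)) (D x) (d' x) (h (z x) / \<rho>) **
      half_orbit_matrix \<rho> n (sin (b x / 2)) (D x) (d x) (h (z x) / \<rho>)) / 2\<bar>) \<longlongrightarrow> \<bar>(4 * e\<^sup>2 - 2) / 2\<bar>) F"
    unfolding e_def
    by (intro tendsto_intros trace_tendsto[OF \<rho>_pos \<sigma>_pos S D d K]) simp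
  \<comment> \<open>With m = 2 n + 2, the bound h \<zeta>0 > (m - 1) / m is e > - 1, the bound h
    \<zeta>0 < 1 is e < 1, and \<open>h_neq\<close> is e \<noteq> 0; hence 2 e^2 - 1 lies strictly
    between -1 and 1.\<close>
  moreover have "\<bar>(4 * e\<^sup>2 - 2) / 2\<bar> < 1"
  proof -
    have "(2 * real n + 1) < h \<zeta>0 * (2 * real n + 2)" "h \<zeta>0 * (2 * real n + 2) \<noteq> 2 * real n + 3 / 2"
      using h_lower h_neq by (auto simp: field_simps)
    moreover have "(1 - h \<zeta>0) * (real n + 1) > 0" using h_upper by simp
    ultimately have "e > - 1" "e \<noteq> 0" "e < 1" unfolding e_def by (auto simp: algebra_simps)
    then have "e\<^sup>2 < 1" "e\<^sup>2 > 0" by (auto simp: abs_square_less_1)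
    then show ?thesis by (simp add: abs_less_iff)
  qed
  ultimately have tr: "\<forall>\<^sub>F x in F. \<bar>trace (half_orbit_matrix \<rho> n (sin (b' x / 2)) (D x) (d' x) (h (z x) / \<rho>) **
      half_orbit_matrix \<rho> n (sin (b x / 2)) (D x) (d x) (h (z x) / \<rho>)) / 2\<bar> < 1"
    by (rule order_tendstoD(2))
  have dpos: "\<forall>\<^sub>F x in F. d x > 0" "\<forall>\<^sub>F x in F. d' x > 0" "\<forall>\<^sub>F x in F. D x > 0"
    using order_tendstoD(1)[OF d(1)] order_tendstoD(1)[OF d(2)] order_tendstoD(1)[OF D] \<rho>_pos \<sigma>_pos by simp_all
  have b2: "0 < \<beta>0" "\<beta>0 < 2 * pi" using \<beta>0_bounds pi_gt_zero by linarith+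
  have bpos: "\<forall>\<^sub>F x in F. b x > 0" "\<forall>\<^sub>F x in F. b' x > 0" "\<forall>\<^sub>F x in F. b x < 2 * pi" "\<forall>\<^sub>F x in F. b' x < 2 * pi"
    using order_tendstoD[OF b(1)] order_tendstoD[OF b(2)] b2 by simp_all
  have "((\<lambda>x. real n * b x + a x) \<longlongrightarrow> real n * \<beta>0 + 0) F" "((\<lambda>x. real n * b' x + a x) \<longlongrightarrow> real n * \<beta>0 + 0) F"
    by (intro tendsto_add tendsto_mult tendsto_const b a)+
  from order_tendstoD(2)[OF this(1), of "pi / 2"] order_tendstoD(2)[OF this(2), of "pi / 2"]
  have nb: "\<forall>\<^sub>F x in F. real n * b x + a x < pi / 2" "\<forall>\<^sub>F x in F. real n * b' x + a x < pi / 2"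
    unfolding \<beta>0_bounds(4) using b2 by simp_all
  have "\<forall>\<^sub>F x in F. a x < pi / 2" using order_tendstoD(2)[OF a(1), of "pi / 2"] by simp
  then show ?thesis
    using a(2) l(1) z01 tr dpos bpos nb eventually_base_in_domain[OF a z01]
  proof eventually_elim
    case (elim x)
    have st: "stadium \<rho> (a x) (l x) h"
      using elim h_cont h_nonneg h0 h1 H_pos \<rho>_pos by unfold_locales auto
    show ?case
    proof
      assume cl: "closing (a x) (l x) (z x) = 0"
      have \<nu>: "\<nu> = real n + 1 / 2" by (simp add: \<nu>_def)
      show "has_elliptic_periodic_orbit (stadium_boundary \<rho> h (a x) (l x))"
      proof (rule stadium.elliptic_of_reflection_law[OF st, of "z x" n "b x" "b' x", folded \<nu>])
        show "(Gamma_x \<rho> h (a x) (z x) - arc_centre \<rho> h (a x)) * cos (\<nu> * b x) + Gamma_y \<rho> h (a x) (z x) * sin (\<nu> * b x)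
            = \<rho> * cos (b x / 2)"
          using chord_angle(5)[OF elim(15)] by (simp add: line_defect_def base_def b_def \<beta>_def)
        show "(- l x - Gamma_x \<rho> h (a x) (z x) - arc_centre \<rho> h (a x)) * cos (\<nu> * b' x) + Gamma_y \<rho> h (a x) (z x) * sin (\<nu> * b' x)
            = \<rho> * cos (b' x / 2)"
          using cl by (simp add: closing_def line_defect_def b'_def)
        show "\<nu> * b' x = \<nu> * b x + 2 * (a x * Theta h (z x))" by (simp add: b_def b'_def \<nu>\<beta>')
      qed (use elim in \<open>simp_all add: d_def d'_def D_def t_def gx_def gy_def c_def\<close>)
    qed
  qed
qed

end

text \<open>The bound \<open>L \<le> \<alpha>\<^sup>2\<close> makes \<open>L\<close> negligible against \<open>\<alpha>\<close>.\<close>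

definition small_separation :: "(real \<times> real) filter" where
  "small_separation = inf (filtercomap fst (at_right 0)) (principal {(\<alpha>, L). 0 \<le> L \<and> L \<le> \<alpha>\<^sup>2})"

lemma eventually_small_separation:
  "eventually Q small_separation \<longleftrightarrow>
    (\<exists>\<epsilon>>0. \<forall>\<alpha> L. 0 < \<alpha> \<and> \<alpha> < \<epsilon> \<and> 0 \<le> L \<and> L \<le> \<alpha>\<^sup>2 \<longrightarrow> Q (\<alpha>, L))"
proof -
  have "eventually Q small_separation \<longleftrightarrow>
    (\<exists>R. eventually R (at_right (0 :: real)) \<and> (\<forall>\<alpha> L. R \<alpha> \<and> 0 \<le> L \<and> L \<le> \<alpha>\<^sup>2 \<longrightarrow> Q (\<alpha>, L)))"
    by (auto simp: small_separation_def eventually_inf_principal eventually_filtercomap)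
  also have "\<dots> \<longleftrightarrow> (\<exists>\<epsilon>>0. \<forall>\<alpha> L. 0 < \<alpha> \<and> \<alpha> < \<epsilon> \<and> 0 \<le> L \<and> L \<le> \<alpha>\<^sup>2 \<longrightarrow> Q (\<alpha>, L))"
  proof
    assume "\<exists>R. eventually R (at_right (0 :: real)) \<and> (\<forall>\<alpha> L. R \<alpha> \<and> 0 \<le> L \<and> L \<le> \<alpha>\<^sup>2 \<longrightarrow> Q (\<alpha>, L))"
    then show "\<exists>\<epsilon>>0. \<forall>\<alpha> L. 0 < \<alpha> \<and> \<alpha> < \<epsilon> \<and> 0 \<le> L \<and> L \<le> \<alpha>\<^sup>2 \<longrightarrow> Q (\<alpha>, L)"
      unfolding eventually_at_right_field by blast
  next
    assume "\<exists>\<epsilon>>0. \<forall>\<alpha> L. 0 < \<alpha> \<and> \<alpha> < \<epsilon> \<and> 0 \<le> L \<and> L \<le> \<alpha>\<^sup>2 \<longrightarrow> Q (\<alpha>, L)"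
    then obtain \<epsilon> :: real where e: "\<epsilon> > 0" "\<And>\<alpha> L. 0 < \<alpha> \<and> \<alpha> < \<epsilon> \<and> 0 \<le> L \<and> L \<le> \<alpha>\<^sup>2 \<Longrightarrow> Q (\<alpha>, L)"
      by blast
    have "eventually (\<lambda>\<alpha>. 0 < \<alpha> \<and> \<alpha> < \<epsilon>) (at_right 0)"
      unfolding eventually_at_right_field using e(1) by blast
    then show "\<exists>R. eventually R (at_right (0 :: real)) \<and> (\<forall>\<alpha> L. R \<alpha> \<and> 0 \<le> L \<and> L \<le> \<alpha>\<^sup>2 \<longrightarrow> Q (\<alpha>, L))"
      using e(2) by (intro exI[of _ "\<lambda>\<alpha>. 0 < \<alpha> \<and> \<alpha> < \<epsilon>"]) auto
  qed
  finally show ?thesis .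
qed

lemma small_separation_limits:
  "(fst \<longlongrightarrow> 0) small_separation" "\<forall>\<^sub>F p in small_separation. fst p > 0"
  "\<forall>\<^sub>F p in small_separation. snd p \<ge> 0" "(snd \<longlongrightarrow> 0) small_separation"
  "((\<lambda>p. snd p / fst p) \<longlongrightarrow> 0) small_separation"
proof -
  show p: "\<forall>\<^sub>F p in small_separation. fst p > 0" "\<forall>\<^sub>F p in small_separation. snd p \<ge> 0"
    unfolding eventually_small_separation by (auto intro!: exI[of _ 1])
  show a: "(fst \<longlongrightarrow> 0) small_separation"
    by (rule tendstoI) (auto simp: eventually_small_separation dist_real_def)
  have le: "\<forall>\<^sub>F p in small_separation. snd p \<le> (fst p)\<^sup>2"
    unfolding eventually_small_separation by (auto intro!: exI[of _ 1])
  show "(snd \<longlongrightarrow> 0) small_separation"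
  proof (rule Lim_null_comparison)
    show "\<forall>\<^sub>F p in small_separation. norm (snd p) \<le> (fst p)\<^sup>2"
      using p(2) le by eventually_elim auto
    show "((\<lambda>p. (fst p)\<^sup>2) \<longlongrightarrow> 0) small_separation" using tendsto_power[OF a, of 2] by simp
  qed
  show "((\<lambda>p. snd p / fst p) \<longlongrightarrow> 0) small_separation"
  proof (rule Lim_null_comparison[OF _ a])
    show "\<forall>\<^sub>F p in small_separation. norm (snd p / fst p) \<le> fst p"
      using p le by eventually_elim (auto simp: field_simps power2_eq_square)
  qed
qed

context resonant_profile
begin

section \<open>Roots of the closing condition for small \<alpha> and L\<close>

definition turning :: "real \<Rightarrow> real" where
  "turning \<zeta> = integral {\<zeta>..1} h - \<nu> / (real n + 1) * (1 - \<zeta>)"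

text \<open>With m = 2 n + 2 the derivative at \<open>\<zeta>0\<close> is (m - 1) / m - h \<zeta>0 <
  0, so the root is crossed strictly. \<open>\<epsilon>\<close> keeps both points where ellipticity
  is known.\<close>

lemma turning_sign_change:
  assumes "\<epsilon> > 0"
  obtains \<zeta>1 \<zeta>2 where "\<zeta>0 - \<epsilon> < \<zeta>1" "\<zeta>1 < \<zeta>2" "\<zeta>2 < \<zeta>0 + \<epsilon>" "0 < \<zeta>1" "\<zeta>2 < 1" "turning \<zeta>1 > 0" "turning \<zeta>2 < 0"
proof -
  have w: "\<nu> / (real n + 1) = (2 * real n + 1) / (2 * real n + 2)" by (simp add: \<nu>_def field_simps)
  have zero: "turning \<zeta>0 = 0" using root by (simp add: turning_def w)
  have "(turning has_real_derivative - h \<zeta>0 - \<nu> / (real n + 1) * (0 - 1)) (at \<zeta>0)"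
    unfolding turning_def[abs_def]
    by (intro DERIV_diff DERIV_cmult DERIV_const DERIV_ident integral_upper_deriv(2)[OF h_cont] \<zeta>0)
  moreover have "- h \<zeta>0 - \<nu> / (real n + 1) * (0 - 1) < 0" using h_lower w by simp
  ultimately obtain d1 d2 where d: "d1 > 0" "\<And>e. \<lbrakk>0 < e; e < d1\<rbrakk> \<Longrightarrow> turning \<zeta>0 < turning (\<zeta>0 - e)"
    "d2 > 0" "\<And>e. \<lbrakk>0 < e; e < d2\<rbrakk> \<Longrightarrow> turning (\<zeta>0 + e) < turning \<zeta>0"
    using DERIV_neg_dec_left DERIV_neg_dec_right by metis
  define e where "e = Min {d1 / 2, d2 / 2, \<epsilon> / 2, \<zeta>0 / 2, (1 - \<zeta>0) / 2}"
  have "e \<le> x" if "x \<in> {d1 / 2, d2 / 2, \<epsilon> / 2, \<zeta>0 / 2, (1 - \<zeta>0) / 2}" for x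
    unfolding e_def using that by (intro Min_le) auto
  note le = this[of "d1 / 2"] this[of "d2 / 2"] this[of "\<epsilon> / 2"] this[of "\<zeta>0 / 2"] this[of "(1 - \<zeta>0) / 2"]
  have "0 < e" unfolding e_def using d(1,3) assms \<zeta>0 by (subst Min_gr_iff) auto
  then have e: "0 < e" "e < d1" "e < d2" "e < \<epsilon>" "e < \<zeta>0" "e < 1 - \<zeta>0"
    using d(1,3) assms \<zeta>0 le by simp_all
  show thesis
    using that[of "\<zeta>0 - e" "\<zeta>0 + e"] e d(2)[of e] d(4)[of e] zero by simp
qed

lemma closing_continuous:
  assumes "\<And>\<zeta>. \<zeta> \<in> {0..1} \<Longrightarrow> base \<alpha> \<zeta> \<in> chord_domain"
  shows "continuous_on {0..1} (closing \<alpha> L)"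
proof -
  have "continuous_on {0..1} (base \<alpha>)"
    unfolding base_def[abs_def] by (intro continuous_intros Gamma_cont)
  then have "continuous_on {0..1} (\<beta> \<alpha>)"
    unfolding \<beta>_def[abs_def] using assms by (intro continuous_on_compose2[OF chord_angle(3)]) auto
  then show ?thesis
    unfolding closing_def[abs_def] line_defect_def \<beta>'_def fst_conv snd_conv using \<nu>_pos
    by (intro continuous_intros Gamma_cont Theta_cont) auto
qed

text \<open>The order of choices matters: a neighbourhood of \<open>\<zeta>0\<close> in which roots
  are elliptic, then two fixed points in it with opposite signs of \<open>turning\<close>, and last
  a bound on \<alpha> below which \<open>closing\<close> inherits these signs. Thus limits at two
  fixed points suffice to locate a root.\<close>

lemma elliptic_for_small_angles:
  "\<exists>\<epsilon>>0. \<forall>\<alpha> L. 0 < \<alpha> \<and> \<alpha> < \<epsilon> \<and> 0 \<le> L \<and> L \<le> \<alpha>\<^sup>2 \<longrightarrow>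
    has_elliptic_periodic_orbit (stadium_boundary \<rho> h \<alpha> L)"
proof -
  let ?G = small_separation
  note lim = small_separation_limits
  \<comment> \<open>An eventual statement along the product filter splits into a condition on
    (\<alpha>, L) and a neighbourhood of \<open>\<zeta>0\<close> independent of them.\<close>
  let ?F = "?G \<times>\<^sub>F nhds \<zeta>0"
  have f: "filterlim fst ?G ?F" "filterlim snd (nhds \<zeta>0) ?F"
    by (rule filterlim_fst filterlim_snd)+
  have "\<forall>\<^sub>F x in ?F. closing (fst (fst x)) (snd (fst x)) (snd x) = 0 \<longrightarrow>
    has_elliptic_periodic_orbit (stadium_boundary \<rho> h (fst (fst x)) (snd (fst x)))"
    by (intro eventually_elliptic filterlim_compose[OF lim(1) f(1)] filterlim_compose[OF lim(4) f(1)] f(2)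
        eventually_compose_filterlim[OF lim(2) f(1)] eventually_compose_filterlim[OF lim(3) f(1)])
  then obtain Pf Pg where P: "eventually Pf ?G" "eventually Pg (nhds \<zeta>0)"
    "\<And>p \<zeta>. \<lbrakk>Pf p; Pg \<zeta>; closing (fst p) (snd p) \<zeta> = 0\<rbrakk> \<Longrightarrow>
      has_elliptic_periodic_orbit (stadium_boundary \<rho> h (fst p) (snd p))"
    unfolding eventually_prod_filter by auto
  obtain \<epsilon> where \<epsilon>: "\<epsilon> > 0" "\<And>\<zeta>. dist \<zeta> \<zeta>0 < \<epsilon> \<Longrightarrow> Pg \<zeta>"
    using P(2) unfolding eventually_nhds_metric by blast
  obtain \<zeta>1 \<zeta>2 where \<zeta>: "\<zeta>0 - \<epsilon> < \<zeta>1" "\<zeta>1 < \<zeta>2" "\<zeta>2 < \<zeta>0 + \<epsilon>" "0 < \<zeta>1" "\<zeta>2 < 1"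
    "turning \<zeta>1 > 0" "turning \<zeta>2 < 0"
    using turning_sign_change[OF \<epsilon>(1)] .
  let ?c = "2 * \<rho> * \<sigma> * (real n + 1) / (\<nu> * H)"
  have c: "?c > 0" using \<rho>_pos \<sigma>_pos \<nu>_pos H_pos by simp
  have "((\<lambda>p. closing (fst p) (snd p) \<zeta>1 / fst p) \<longlongrightarrow> ?c * turning \<zeta>1) ?G"
    "((\<lambda>p. closing (fst p) (snd p) \<zeta>2 / fst p) \<longlongrightarrow> ?c * turning \<zeta>2) ?G"
    unfolding turning_def
    by (rule closing_quotient_tendsto[OF lim(1,2,5)]; use \<zeta> in simp)+
  moreover have "?c * turning \<zeta>1 > 0" "?c * turning \<zeta>2 < 0"
    using c \<zeta> by (simp_all only: mult_pos_pos mult_pos_neg)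
  ultimately have sign: "\<forall>\<^sub>F p in ?G. closing (fst p) (snd p) \<zeta>1 / fst p > 0"
    "\<forall>\<^sub>F p in ?G. closing (fst p) (snd p) \<zeta>2 / fst p < 0"
    using order_tendstoD by blast+
  have "\<forall>\<^sub>F p in ?G. \<forall>\<zeta>\<in>{0..1}. base (fst p) \<zeta> \<in> chord_domain"
  proof -
    \<comment> \<open>The principal filter leaves \<zeta> arbitrary in \<open>{0..1}\<close>, so the
      eventual statement is uniform in \<zeta>.\<close>
    let ?F' = "?G \<times>\<^sub>F principal {0..1}"
    have f': "filterlim fst ?G ?F'" "filterlim snd (principal {0..1}) ?F'"
      by (rule filterlim_fst filterlim_snd)+
    have "\<forall>\<^sub>F x in ?F'. base (fst (fst x)) (snd x) \<in> chord_domain"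
      using f'(2) by (intro eventually_base_in_domain filterlim_compose[OF lim(1) f'(1)]
          eventually_compose_filterlim[OF lim(2) f'(1)]) (simp add: filterlim_principal)
    then obtain Qf Qg where "eventually Qf ?G" "eventually Qg (principal {0..1})"
      "\<forall>p \<zeta>. Qf p \<longrightarrow> Qg \<zeta> \<longrightarrow> base (fst (fst (p, \<zeta>))) (snd (p, \<zeta>)) \<in> chord_domain"
      unfolding eventually_prod_filter by blast
    then show ?thesis by (auto simp: eventually_principal elim!: eventually_mono)
  qed
  with sign P(1) lim(2)
  have "\<forall>\<^sub>F p in ?G. has_elliptic_periodic_orbit (stadium_boundary \<rho> h (fst p) (snd p))"
  proof eventually_elim
    case (elim p)
    have "closing (fst p) (snd p) \<zeta>1 > 0" "closing (fst p) (snd p) \<zeta>2 < 0"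
      using elim by (auto simp: zero_less_divide_iff divide_less_0_iff)
    moreover have "continuous_on {\<zeta>1..\<zeta>2} (closing (fst p) (snd p))"
      using elim \<zeta> by (intro continuous_on_subset[OF closing_continuous]) auto
    ultimately obtain \<zeta> where "\<zeta>1 \<le> \<zeta>" "\<zeta> \<le> \<zeta>2" "closing (fst p) (snd p) \<zeta> = 0"
      using IVT2'[of "closing (fst p) (snd p)" \<zeta>2 0 \<zeta>1] \<zeta> by auto
    moreover have "dist \<zeta> \<zeta>0 < \<epsilon>" using \<zeta> calculation by (auto simp: dist_real_def)
    ultimately show ?case using P(3) \<epsilon>(2) elim by blast
  qed
  then show ?thesis by (simp add: eventually_small_separation)
qed

end

section \<open>The root of the limit equation\<close>

lemma integral_le_bound:
  fixes h :: "real \<Rightarrow> real"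
  assumes "a \<le> b" "continuous_on {a..b} h" "\<And>x. x \<in> {a..b} \<Longrightarrow> h x \<le> M"
  shows "integral {a..b} h \<le> M * (b - a)"
proof -
  have "integral {a..b} h \<le> integral {a..b} (\<lambda>_. M)"
    using assms by (intro integral_le integrable_continuous_real) auto
  then show ?thesis using assms(1) by (simp add: mult.commute)
qed

theorem theorem2p1:
  fixes \<rho> :: real and h :: "real \<Rightarrow> real"
  assumes "\<rho> > 0"
    and "continuous_on {0..1} h"
    and "\<And>\<zeta>. \<zeta> \<in> {0..1} \<Longrightarrow> h \<zeta> \<ge> 0"
    and "h 0 = 1" and "h 1 = 0"
    and "antimono_on {0..1} h"
    and "\<And>\<zeta>. \<zeta> \<in> {0<..1} \<Longrightarrow> h \<zeta> < h 0"
    and "integral {0..1} h > 1 / 2"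
    and "nondegenerate h"
  shows "\<exists>\<alpha>\<^sub>0. 0 < \<alpha>\<^sub>0 \<and> \<alpha>\<^sub>0 \<le> pi / 2 \<and>
    (\<forall>\<alpha>. 0 < \<alpha> \<and> \<alpha> < \<alpha>\<^sub>0 \<longrightarrow>
      (\<exists>L\<^sub>h\<^sub>\<alpha> > 0. \<forall>L. 0 \<le> L \<and> L < L\<^sub>h\<^sub>\<alpha> \<longrightarrow>
        has_elliptic_periodic_orbit (stadium_boundary \<rho> h \<alpha> L)))"
proof -
  obtain n :: nat where n: "(2 * real n + 1) / (2 * real n + 2) < integral {0..1} h"
    "\<And>\<zeta>. \<lbrakk>\<zeta> \<in> {0..1}; (2 * real n + 1) / (2 * real n + 2) * (1 - \<zeta>) = integral {\<zeta>..1} h\<rbrakk> \<Longrightarrow>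
      h \<zeta> \<noteq> (2 * real n + 3 / 2) / (2 * real n + 2)"
    using assms(9) unfolding nondegenerate_def by blast
  define w where "w = (2 * real n + 1) / (2 * real n + 2)"
  have w: "0 < w" by (simp add: w_def)
  define R where "R \<zeta> = integral {\<zeta>..1} h - w * (1 - \<zeta>)" for \<zeta>
  have hc: "continuous_on {a..b} h" if "0 \<le> a" "b \<le> 1" for a b
    using that by (intro continuous_on_subset[OF assms(2)]) auto
  have anti: "h y \<le> h x" if "0 \<le> x" "x \<le> y" "y \<le> 1" for x y
    using assms(6) that by (auto simp: monotone_on_def)
  have near_one: "\<exists>\<zeta>. a < \<zeta> \<and> \<zeta> < 1 \<and> h \<zeta> < w" if a: "0 \<le> a" "a < 1" for a
  proof -
    have "(h \<longlongrightarrow> 0) (at 1 within {0..1})" 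
      using assms(2)[unfolded continuous_on_def, rule_format, of 1] assms(5) by simp
    then have "(h \<longlongrightarrow> 0) (at_left 1)" by (simp add: at_within_Icc_at_left)
    then have "\<forall>\<^sub>F \<zeta> in at_left 1. h \<zeta> < w" using w by (rule order_tendstoD(2))
    moreover have "\<forall>\<^sub>F \<zeta> in at_left 1. a < \<zeta> \<and> \<zeta> < 1"
      using eventually_at_left_real[OF a(2)] by eventually_elim auto
    ultimately have "\<forall>\<^sub>F \<zeta> in at_left (1 :: real). a < \<zeta> \<and> \<zeta> < 1 \<and> h \<zeta> < w" by eventually_elim auto
    then show ?thesis using eventually_happens[of _ "at_left (1::real)"] by auto
  qed
  \<comment> \<open>Once h has dropped to \<open>w\<close>, its mean over the rest is below
    \<open>w\<close>, strictly because h takes values below \<open>w\<close> before 1. Hence h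
    exceeds \<open>w\<close> at every root before 1.\<close>
  have tail: "integral {\<zeta>..1} h < w * (1 - \<zeta>)" if \<zeta>: "0 \<le> \<zeta>" "\<zeta> < 1" "h \<zeta> \<le> w" for \<zeta>
  proof -
    obtain \<eta> where \<eta>: "\<zeta> < \<eta>" "\<eta> < 1" "h \<eta> < w" using near_one[OF \<zeta>(1,2)] by blast
    have "integral {\<zeta>..1} h = integral {\<zeta>..\<eta>} h + integral {\<eta>..1} h"
      by (rule Henstock_Kurzweil_Integration.integral_combine[symmetric])
         (use \<zeta> \<eta> in \<open>auto intro!: integrable_continuous_real hc\<close>)
    also have "\<dots> \<le> w * (\<eta> - \<zeta>) + h \<eta> * (1 - \<eta>)"
    proof (intro add_mono integral_le_bound hc)
      show "h x \<le> w" if "x \<in> {\<zeta>..\<eta>}" for x using anti[of \<zeta> x] that \<zeta> \<eta> by auto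
      show "h x \<le> h \<eta>" if "x \<in> {\<eta>..1}" for x using anti[of \<eta> x] that \<zeta> \<eta> by auto
    qed (use \<zeta> \<eta> in auto)
    also have "\<dots> < w * (\<eta> - \<zeta>) + w * (1 - \<eta>)" using \<eta> by simp
    finally show ?thesis by (simp add: algebra_simps)
  qed
  \<comment> \<open>\<open>R\<close> also vanishes at 1, a trivial root; stopping at a point before
    1 where \<open>R\<close> is negative avoids it.\<close>
  obtain \<eta> where \<eta>: "0 < \<eta>" "\<eta> < 1" "h \<eta> < w" using near_one[of 0] by auto
  have "R \<eta> < 0" using tail[of \<eta>] \<eta> by (simp add: R_def)
  moreover have "R 0 > 0" using n(1) by (simp add: R_def w_def)
  moreover have "continuous_on {0..\<eta>} R"
    unfolding R_def using \<eta>
    by (intro continuous_intros continuous_on_subset[OF continuous_on_integral(2)[OF assms(2)]]) auto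
  ultimately obtain \<zeta>0 where \<zeta>0: "0 \<le> \<zeta>0" "\<zeta>0 \<le> \<eta>" "R \<zeta>0 = 0"
    using IVT2'[of R \<eta> 0 0] \<eta> by auto
  have "\<zeta>0 \<noteq> 0" using \<open>R 0 > 0\<close> \<zeta>0 by auto
  then have pos: "0 < \<zeta>0" "\<zeta>0 < 1" using \<zeta>0 \<eta> by auto
  have root: "integral {\<zeta>0..1} h = w * (1 - \<zeta>0)" using \<zeta>0(3) by (simp add: R_def)
  interpret resonant_profile \<rho> h n \<zeta>0
  proof
    show "integral {0..1} h > 0" using assms(8) by linarith
    show "(2 * real n + 1) / (2 * real n + 2) < h \<zeta>0"
      using tail[of \<zeta>0] root pos by (force simp: w_def)
    show "h \<zeta>0 < 1" using assms(4,7) pos by force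
    show "h \<zeta>0 \<noteq> (2 * real n + 3 / 2) / (2 * real n + 2)"
      using n(2)[of \<zeta>0] root pos by (simp add: w_def)
    show "integral {\<zeta>0..1} h = (2 * real n + 1) / (2 * real n + 2) * (1 - \<zeta>0)"
      using root by (simp add: w_def)
  qed (use assms pos in auto)
  obtain \<epsilon> where \<epsilon>: "\<epsilon> > 0" "\<And>\<alpha> L. \<lbrakk>0 < \<alpha>; \<alpha> < \<epsilon>; 0 \<le> L; L \<le> \<alpha>\<^sup>2\<rbrakk> \<Longrightarrow>
    has_elliptic_periodic_orbit (stadium_boundary \<rho> h \<alpha> L)"
    using elliptic_for_small_angles by blast
  show ?thesis
  proof (rule exI[of _ "min \<epsilon> (pi / 2)"], intro conjI allI impI)
    fix \<alpha> assume "0 < \<alpha> \<and> \<alpha> < min \<epsilon> (pi / 2)"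
    then show "\<exists>L\<^sub>h\<^sub>\<alpha> > 0. \<forall>L. 0 \<le> L \<and> L < L\<^sub>h\<^sub>\<alpha> \<longrightarrow>
        has_elliptic_periodic_orbit (stadium_boundary \<rho> h \<alpha> L)"
      using \<epsilon>(2) by (intro exI[of _ "\<alpha>\<^sup>2"]) auto
  qed (use \<epsilon>(1) in auto)
qed

end
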